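(* Let $1<p<\infty$, $p\neq 2$. If $X\in\mathcal{C}_p$, then $X$ does not admit an equivalent almost transitive norm. In particular, no infinite-dimensional subspace of a quotient space of $\ell_p$ admits an equivalent almost transitive norm.
   Context: Banach spaces are infinite-dimensional, real or complex, and "subspace" means closed infinite-dimensional linear subspace. A norm on $X$ is almost transitive if for every $x$ in the unit sphere of $X$ the orbit $\{Tx: T\in\operatorname{Isom}(X)\}$ is norm dense in the unit sphere, where $\operatorname{Isom}(X)$ is the group of surjective linear isometries of $X$ for that norm. $\mathcal{C}_p$ denotes the class of (infinite-dimensional) Banach spaces which are isomorphic to a subspace of an $\ell_p$-sum $(\sum_{n=1}^\infty\oplus F_n)_p$ of a sequence of finite-dimensional normed spaces $F_n$. *)

theory Defs
  imports "HOL-Analysis.Analysis" "HOL-Algebra.Module" "HOL-Algebra.AbelCoset"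
    "HOL-Algebra.Algebraic_Closure_Type"
begin

text \<open>
  The scalar field is a type \<open>'k\<close>, to be instantiated with \<^typ>\<open>real\<close> and with \<^typ>\<open>complex\<close>;
  \<^const>\<open>ring_of_type_algebra\<close> turns it into a ring in the sense of HOL-Algebra. A normed space
  is a module over this ring, with an explicit carrier, together with a norm. Explicit carriers
  are needed because \<open>\<ell>\<^sub>p\<close>-sums depend on the real number \<open>p\<close> and because the points of a
  quotient space are cosets. The multiplicative part of the record is never used.
\<close>

record ('k, 'a) nspace = "('k, 'a) module" +
  nrm :: "'a \<Rightarrow> real"

locale normed_space = module "ring_of_type_algebra :: 'k ring" E
  for E :: "('k::real_normed_field, 'a) nspace" (structure) +
  assumes nrm_nonneg: "x \<in> carrier E \<Longrightarrow> 0 \<le> nrm E x"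
    and nrm_eq_zero_iff: "x \<in> carrier E \<Longrightarrow> nrm E x = 0 \<longleftrightarrow> x = \<zero>"
    and nrm_smult: "x \<in> carrier E \<Longrightarrow> nrm E (a \<odot> x) = norm a * nrm E x"
    and nrm_triangle: "x \<in> carrier E \<Longrightarrow> y \<in> carrier E \<Longrightarrow> nrm E (x \<oplus> y) \<le> nrm E x + nrm E y"

text \<open>The case distinction is there because \<^locale>\<open>Metric_space\<close> asks for nonnegativity and
  symmetry outside the carrier, too.\<close>

definition ndist :: "('k, 'a) nspace \<Rightarrow> 'a \<Rightarrow> 'a \<Rightarrow> real" where
  "ndist E x y = (if x \<in> carrier E \<and> y \<in> carrier E then nrm E (x \<ominus>\<^bsub>E\<^esub> y) else 0)"

definition norm_topology :: "('k, 'a) nspace \<Rightarrow> 'a topology" where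
  "norm_topology E = Metric_space.mtopology (carrier E) (ndist E)"

definition banach_space :: "('k::real_normed_field, 'a) nspace \<Rightarrow> bool" where
  "banach_space E \<longleftrightarrow> normed_space E \<and> Metric_space.mcomplete (carrier E) (ndist E)"

definition finite_dim :: "('k, 'a) nspace \<Rightarrow> bool" where
  "finite_dim E \<longleftrightarrow> (\<exists>B. finite B \<and> B \<subseteq> carrier E \<and>
     (\<forall>x\<in>carrier E. \<exists>a. x = (\<Oplus>\<^bsub>E\<^esub>v\<in>B. a v \<odot>\<^bsub>E\<^esub> v)))"

definition restrict_to :: "('k, 'a) nspace \<Rightarrow> 'a set \<Rightarrow> ('k, 'a) nspace" where
  "restrict_to E W = E\<lparr>carrier := W\<rparr>"

definition closed_linear_subspace :: "'a set \<Rightarrow> ('k::real_normed_field, 'a) nspace \<Rightarrow> bool" where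
  "closed_linear_subspace W E \<longleftrightarrow>
     submodule W (ring_of_type_algebra :: 'k ring) E \<and> closedin (norm_topology E) W"

definition infinite_dim_closed_subspace ::
    "'a set \<Rightarrow> ('k::real_normed_field, 'a) nspace \<Rightarrow> bool" where
  "infinite_dim_closed_subspace W E \<longleftrightarrow>
     closed_linear_subspace W E \<and> \<not> finite_dim (restrict_to E W)"

definition linear_maps :: "('k, 'a) nspace \<Rightarrow> ('k, 'b) nspace \<Rightarrow> ('a \<Rightarrow> 'b) set" where
  "linear_maps E F = {T \<in> hom (add_monoid E) (add_monoid F).
     \<forall>a. \<forall>x\<in>carrier E. T (a \<odot>\<^bsub>E\<^esub> x) = a \<odot>\<^bsub>F\<^esub> T x}"

definition isomorphic_nspaces :: "('k, 'a) nspace \<Rightarrow> ('k, 'b) nspace \<Rightarrow> bool" where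
  "isomorphic_nspaces E F \<longleftrightarrow>
     (\<exists>T\<in>linear_maps E F. homeomorphic_map (norm_topology E) (norm_topology F) T)"

definition Isom :: "('k, 'a) nspace \<Rightarrow> ('a \<Rightarrow> 'a) set" where
  "Isom E = {T \<in> linear_maps E E.
     T ` carrier E = carrier E \<and> (\<forall>x\<in>carrier E. nrm E (T x) = nrm E x)}"

definition unit_sphere :: "('k, 'a) nspace \<Rightarrow> 'a set" where
  "unit_sphere E = {x \<in> carrier E. nrm E x = 1}"

definition almost_transitive :: "('k, 'a) nspace \<Rightarrow> bool" where
  "almost_transitive E \<longleftrightarrow>
     (\<forall>x\<in>unit_sphere E. unit_sphere E \<subseteq> norm_topology E closure_of {T x | T. T \<in> Isom E})"

definition equivalent_norm :: "('k::real_normed_field, 'a) nspace \<Rightarrow> ('a \<Rightarrow> real) \<Rightarrow> bool" where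
  "equivalent_norm E N \<longleftrightarrow> normed_space (E\<lparr>nrm := N\<rparr>) \<and>
     (\<exists>c>0. \<exists>C>0. \<forall>x\<in>carrier E. c * nrm E x \<le> N x \<and> N x \<le> C * nrm E x)"

definition admits_equivalent_almost_transitive_norm ::
    "('k::real_normed_field, 'a) nspace \<Rightarrow> bool" where
  "admits_equivalent_almost_transitive_norm E \<longleftrightarrow>
     (\<exists>N. equivalent_norm E N \<and> almost_transitive (E\<lparr>nrm := N\<rparr>))"

definition lp_sum :: "real \<Rightarrow> (nat \<Rightarrow> ('k, 'b) nspace) \<Rightarrow> ('k, nat \<Rightarrow> 'b) nspace" where
  "lp_sum p F =
     \<lparr>carrier = {x. (\<forall>n. x n \<in> carrier (F n)) \<and> summable (\<lambda>n. nrm (F n) (x n) powr p)},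
      mult = undefined, one = undefined,
      zero = (\<lambda>n. \<zero>\<^bsub>F n\<^esub>),
      add = (\<lambda>x y n. x n \<oplus>\<^bsub>F n\<^esub> y n),
      smult = (\<lambda>a x n. a \<odot>\<^bsub>F n\<^esub> x n),
      nrm = (\<lambda>x. (\<Sum>n. nrm (F n) (x n) powr p) powr (1 / p))\<rparr>"

text \<open>The summands \<open>F n\<close> may carry unrelated vector space structures, but HOL makes them subsets
  of one type \<open>'b\<close>. Every sequence of finite-dimensional spaces is isometric to one with
  \<open>'b = (nat \<Rightarrow> 'k)\<close>; a statement about \<open>class_C TYPE('b) p\<close> is meant to be made for all \<open>'b\<close>.\<close>

definition class_C :: "'b itself \<Rightarrow> real \<Rightarrow> ('k::real_normed_field, 'a) nspace set" where
  "class_C _ p = {E. banach_space E \<and> \<not> finite_dim E \<and>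
     (\<exists>(F :: nat \<Rightarrow> ('k, 'b) nspace) W.
        (\<forall>n. normed_space (F n) \<and> finite_dim (F n)) \<and>
        infinite_dim_closed_subspace W (lp_sum p F) \<and>
        isomorphic_nspaces E (restrict_to (lp_sum p F) W))}"

definition scalar_nspace :: "('k::real_normed_field, 'k) nspace" where
  "scalar_nspace = \<lparr>carrier = UNIV, mult = (*), one = 1, zero = 0, add = (+),
     smult = (*), nrm = norm\<rparr>"

definition ell_p :: "real \<Rightarrow> ('k::real_normed_field, nat \<Rightarrow> 'k) nspace" where
  "ell_p p = lp_sum p (\<lambda>_. scalar_nspace)"

text \<open>In the scalar multiplication the summand \<open>M\<close> only matters for \<open>a = 0\<close>.\<close>

definition quotient_nspace :: "('k, 'a) nspace \<Rightarrow> 'a set \<Rightarrow> ('k, 'a set) nspace" where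
  "quotient_nspace E M =
     \<lparr>carrier = a_rcosets\<^bsub>E\<^esub> M,
      mult = undefined, one = undefined,
      zero = M,
      add = set_add E,
      smult = (\<lambda>a C. M <+>\<^bsub>E\<^esub> ((\<lambda>x. a \<odot>\<^bsub>E\<^esub> x) ` C)),
      nrm = (\<lambda>C. Inf (nrm E ` C))\<rparr>"

end

theory Submission
  imports Defs "HOL-Analysis.Finite_Function_Topology" "HOL-Real_Asymp.Real_Asymp"
begin

text \<open>
  Let \<open>N\<close> be an almost transitive norm equivalent to the given norm \<open>M\<close>. Every finite-dimensional
  subspace carries Euclidean norms, and comparing \<open>N\<close> on a subspace of large dimension with an
  (almost) extremal ellipsoid inscribed in, respectively circumscribed about, its unit ball gives
  arbitrarily many almost orthogonal almost contact points \<open>y\<^sub>0, \<dots>, y\<^sub>K\<close>. Given \<open>x\<close>, an isometry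
  moves \<open>y\<^sub>0\<close> close to \<open>x / N x\<close>; the differences \<open>y = y\<^sub>i - y\<^sub>j\<close> then satisfy
  \<open>N (x + y)\<^sup>2 \<le> N x\<^sup>2 + 4\<close>, respectively \<open>N (x + y)\<^sup>2 \<ge> N x\<^sup>2 + 1\<close>. On the other hand, among sufficiently
  many bounded vectors there are two whose difference \<open>y\<close> is almost disjoint from \<open>x\<close> in the
  \<open>\<ell>\<^sub>p\<close>-sum, so that \<open>M (x + y)\<^sup>p\<close> is almost \<open>M x\<^sup>p + M y\<^sup>p\<close>. After \<open>n\<close> such steps \<open>M\<close> has grown to
  the order of \<open>n\<close> to the power \<open>1 / p\<close>, whereas \<open>N\<close> is at most (if \<open>p < 2\<close>), respectively at least
  (if \<open>p > 2\<close>), of the order of \<open>n\<close> to the power \<open>1 / 2\<close>. For subspaces of quotients of \<open>\<ell>\<^sub>p\<close> the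
  additivity of \<open>M\<close> is obtained from coordinatewise convergent sequences of lifts, without embedding
  them into an \<open>\<ell>\<^sub>p\<close>-sum.
\<close>

text \<open>The syntax of \<^const>\<open>Sum_any\<close> makes infinite sums of reals ambiguous.\<close>

no_syntax
  "_Sum_any" :: "pttrn \<Rightarrow> 'a \<Rightarrow> 'a::comm_monoid_add"    (\<open>(\<open>indent=2 notation=\<open>binder \<Sum>\<close>\<close>\<Sum>_. _)\<close> [0, 10] 10)

section \<open>Seminorms and finite-dimensional subspaces\<close>

text \<open>No extremal ellipsoid is ever constructed. If \<open>K\<close> almost orthogonal almost
  contact points are missing, the form can be multiplied by a fixed factor q (below 1 for
  circumscribed, above 1 for inscribed ellipsoids) off a subspace of codimension at most
  \<open>K\<close> without losing its comparison with \<open>N\<close>. After \<open>L\<close>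
  rounds the gain is \<open>q ^ L\<close> off codimension \<open>L * K\<close>, while the comparison
  constants of the starting form cost only a power of \<open>n = L * K + 1\<close>, and a geometric
  factor beats a polynomial one. This is why the starting forms must have constants that are
  polynomial in \<open>n\<close>, and hence why vectors with uniformly bounded coefficients are
  produced.

  The other obstacle is the orbit: an isometry can move one point near the direction of x, but
  nothing controls where it puts the remaining contact points. Therefore \<open>K\<close> is fixed
  before the points are, and a pigeonhole argument finds two of them with a good difference wherever
  they land. Everything is done over the reals with seminorms on formal linear combinations, which
  treats real and complex spaces with explicit carriers alike.\<close>

lemma seq_choice:
  assumes "\<And>B. finite B \<Longrightarrow> \<exists>y. Q B y"
  shows "\<exists>e::nat \<Rightarrow> 'a. \<forall>n. Q (e ` {..<n}) (e n)"
proof -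
  obtain f where f: "\<And>B. finite B \<Longrightarrow> Q B (f B)"
    using assms by metis
  define E where "E = rec_nat {} (\<lambda>_ B. insert (f B) B)"
  have E: "E 0 = {}" "E (Suc n) = insert (f (E n)) (E n)" for n
    by (simp_all add: E_def)
  define e where "e n = f (E n)" for n
  have "E n = e ` {..<n}" for n
    by (induction n) (auto simp: E e_def lessThan_Suc)
  then show ?thesis
    by (intro exI[of _ e]) (metis e_def f finite_imageI finite_lessThan)
qed

text \<open>Seminorms instead of norms: the main instances live on formal linear combinations and
  vanish on the relations that hold in the actual space.\<close>

locale seminorm =
  fixes N :: "'v::real_vector \<Rightarrow> real"
  assumes add_le: "N (x + y) \<le> N x + N y"
    and scale: "N (c *\<^sub>R x) = \<bar>c\<bar> * N x"
begin

lemma zero [simp]: "N 0 = 0"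
  using scale[of 0 0] by simp

lemma minus [simp]: "N (- x) = N x"
  using scale[of "-1" x] by simp

lemma nonneg [simp]: "0 \<le> N x"
  using add_le[of x "- x"] by simp

lemma diff_le: "N (x - y) \<le> N x + N y"
  using add_le[of x "- y"] by simp

lemma diff_commute: "N (x - y) = N (y - x)"
  using minus[of "x - y"] by simp

lemma le_add_diff: "N x \<le> N y + N (x - y)"
  using add_le[of y "x - y"] by simp

lemma diff_triangle: "N (x - z) \<le> N (x - y) + N (y - z)"
  using add_le[of "x - y" "y - z"] by simp

lemma sum_le: "N (\<Sum>i\<in>I. f i) \<le> (\<Sum>i\<in>I. N (f i))"
proof (induction I rule: infinite_finite_induct)
  case (insert i I)
  then show ?case using add_le[of "f i" "sum f I"] by simp
qed simp_all

text \<open>Dividing by \<open>k\<close> turns the vector into \<open>b\<close> minus an element of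
  the span. This controls the coefficient of a generator that keeps a positive distance from the
  others.\<close>

lemma dist_coeff_le:
  assumes d: "\<And>y. y \<in> span B \<Longrightarrow> d \<le> N (b - y)" and y: "y \<in> span B"
  shows "\<bar>k\<bar> * d \<le> N (k *\<^sub>R b + y)"
proof (cases "k = 0")
  case False
  have "k *\<^sub>R b + y = k *\<^sub>R (b - (- inverse k) *\<^sub>R y)"
    using False by (simp add: algebra_simps)
  moreover have "d \<le> N (b - (- inverse k) *\<^sub>R y)"
    using d span_scale[OF y] by blast
  ultimately show ?thesis
    by (metis scale mult_left_mono abs_ge_zero)
qed simp

text \<open>Induction on the generators. As \<open>B\<close> may be dependent and \<open>N\<close>
  degenerate, the case distinction is whether the new generator has a positive distance
  \<open>d\<close> from the old span. If so, its coefficient is at most \<open>R / d\<close> and can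
  be discretised; otherwise it is replaced by good approximations from the old span.\<close>

lemma span_net:
  assumes "finite B" "0 < \<epsilon>"
  shows "\<exists>A. finite A \<and> (\<forall>x\<in>span B. N x \<le> R \<longrightarrow> (\<exists>a\<in>A. N (x - a) \<le> \<epsilon>))"
  using assms
proof (induction B arbitrary: R \<epsilon>)
  case empty
  then show ?case by (intro exI[of _ "{0}"]) auto
next
  case (insert b B)
  show ?case
  proof (cases "\<exists>d>0. \<forall>y\<in>span B. d \<le> N (b - y)")
    case False
    obtain A where A: "finite A" "\<And>x. x \<in> span B \<Longrightarrow> N x \<le> R + \<epsilon> / 2 \<Longrightarrow> \<exists>a\<in>A. N (x - a) \<le> \<epsilon> / 2"
      using insert.IH[of "\<epsilon> / 2" "R + \<epsilon> / 2"] insert.prems by auto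
    have "\<exists>a\<in>A. N (x - a) \<le> \<epsilon>" if x: "x \<in> span (insert b B)" and R: "N x \<le> R" for x
    proof -
      obtain k where k: "x - k *\<^sub>R b \<in> span B"
        using x span_breakdown_eq by metis
      \<comment> \<open>Nothing bounds \<open>k\<close> in this case, so the accuracy of the
        substitute for \<open>b\<close> depends on \<open>k\<close>; the summand 1 covers
        \<open>k = 0\<close>.\<close>
      have "\<epsilon> / (2 * (\<bar>k\<bar> + 1)) > 0" using insert.prems by (auto intro!: divide_pos_pos)
      then obtain y where y: "y \<in> span B" "N (b - y) < \<epsilon> / (2 * (\<bar>k\<bar> + 1))"
        using False by (meson not_le)
      define x' where "x' = (x - k *\<^sub>R b) + k *\<^sub>R y"
      have x': "x' \<in> span B" unfolding x'_def
        using k y span_add span_scale by blast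
      have "N (x - x') = \<bar>k\<bar> * N (b - y)"
        unfolding x'_def using scale[of k "b - y"] by (simp add: algebra_simps)
      also have "\<dots> \<le> (\<bar>k\<bar> + 1) * (\<epsilon> / (2 * (\<bar>k\<bar> + 1)))"
        using y by (intro mult_mono) auto
      also have "\<dots> = \<epsilon> / 2" by (simp add: field_simps)
      finally have xx': "N (x - x') \<le> \<epsilon> / 2" .
      have "N x' \<le> R + \<epsilon> / 2"
        using le_add_diff[of x' x] R xx' diff_commute[of x x'] by simp
      then obtain a where "a \<in> A" "N (x' - a) \<le> \<epsilon> / 2"
        using A x' by blast
      then show ?thesis
        using diff_triangle[of x a x'] xx' by (intro bexI[of _ a]) auto
    qed
    then show ?thesis using A by blast
  next
    case True
    then obtain d where d: "d > 0" "\<And>y. y \<in> span B \<Longrightarrow> d \<le> N (b - y)" by blast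
    \<comment> \<open>Mesh of the grid for the coefficient: rounding it costs at most half of the
      tolerance, also when \<open>N b = 0\<close>.\<close>
    define h where "h = \<epsilon> / (2 * (N b + 1))"
    have Nb: "N b + 1 > 0" using nonneg[of b] by linarith
    have h: "h > 0" unfolding h_def using insert.prems Nb by simp
    obtain A where A: "finite A" "\<And>x. x \<in> span B \<Longrightarrow> N x \<le> R + R / d * N b \<Longrightarrow> \<exists>a\<in>A. N (x - a) \<le> \<epsilon> / 2"
      using insert.IH[of "\<epsilon> / 2" "R + R / d * N b"] insert.prems by auto
    define G where "G = (\<lambda>i. h * of_int i) ` {\<lfloor>- (R / d / h)\<rfloor>..\<lfloor>R / d / h\<rfloor>}"
    have "\<exists>a\<in>(\<lambda>(g, a). g *\<^sub>R b + a) ` (G \<times> A). N (x - a) \<le> \<epsilon>"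
      if x: "x \<in> span (insert b B)" and R: "N x \<le> R" for x
    proof -
      obtain k where k: "x - k *\<^sub>R b \<in> span B"
        using x span_breakdown_eq by metis
      define y where "y = x - k *\<^sub>R b"
      have "\<bar>k\<bar> * d \<le> R"
        using dist_coeff_le[of B d b "x - k *\<^sub>R b" k] d k R by simp
      then have kR: "\<bar>k\<bar> \<le> R / d" using d by (simp add: field_simps)
      have "N y \<le> N x + \<bar>k\<bar> * N b" unfolding y_def using diff_le scale by metis
      also have "\<dots> \<le> R + R / d * N b" using R kR by (intro add_mono mult_right_mono) auto
      finally obtain a where a: "a \<in> A" "N (y - a) \<le> \<epsilon> / 2" using A k y_def by blast
      define i where "i = \<lfloor>k / h\<rfloor>"
      have "- (R / d / h) \<le> k / h" "k / h \<le> R / d / h"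
        using kR h by (simp_all add: pos_le_divide_eq pos_divide_le_eq abs_le_iff)
      then have i: "h * of_int i \<in> G"
        unfolding G_def i_def by (intro imageI) (auto intro: floor_mono)
      have "\<bar>k / h - of_int i\<bar> \<le> 1" unfolding i_def by linarith
      then have "h * \<bar>k / h - of_int i\<bar> \<le> h" using h by (simp add: mult_le_cancel_left1)
      moreover have "h * \<bar>k / h - of_int i\<bar> = \<bar>k - h * of_int i\<bar>"
        using h abs_mult[of h "k / h - of_int i"] by (simp add: right_diff_distrib)
      ultimately have kh: "\<bar>k - h * of_int i\<bar> \<le> h" by simp
      have "x - ((h * of_int i) *\<^sub>R b + a) = (k - h * of_int i) *\<^sub>R b + (y - a)"
        unfolding y_def by (simp add: algebra_simps)
      then have "N (x - ((h * of_int i) *\<^sub>R b + a)) \<le> \<bar>k - h * of_int i\<bar> * N b + N (y - a)"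
        by (metis add_le scale)
      also have "\<dots> \<le> h * (N b + 1) + \<epsilon> / 2"
        using kh a h by (intro add_mono mult_mono) auto
      also have "\<dots> = \<epsilon>" unfolding h_def using Nb by (simp add: field_simps)
      finally show ?thesis using i a by force
    qed
    moreover have "finite ((\<lambda>(g, a). g *\<^sub>R b + a) ` (G \<times> A))"
      unfolding G_def using A by auto
    ultimately show ?thesis by blast
  qed
qed

text \<open>A generator at distance 0 from the old span can be exchanged for a vector of that span,
  by the induction hypothesis. Otherwise the coefficients of approximating vectors form a Cauchy
  sequence by \<open>dist_coeff_le\<close>, and its limit \<open>s\<close> reduces the problem to
  \<open>x - s *\<^sub>R b\<close>. Completeness of the reals is the only completeness that
  enters.\<close>

lemma span_closed:
  assumes "finite B" "\<And>\<epsilon>. 0 < \<epsilon> \<Longrightarrow> \<exists>y\<in>span B. N (x - y) < \<epsilon>"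
  shows "\<exists>y\<in>span B. N (x - y) = 0"
  using assms
proof (induction B arbitrary: x)
  case empty
  then show ?case
    by simp (metis nonneg less_le order_less_irrefl)
next
  case (insert b B)
  show ?case
  proof (cases "\<exists>d>0. \<forall>y\<in>span B. d \<le> N (b - y)")
    case False
    then obtain b' where b': "b' \<in> span B" "N (b - b') = 0"
      using insert.IH[of b] by (meson not_le)
    have "\<exists>y\<in>span B. N (x - y) < \<epsilon>" if "0 < \<epsilon>" for \<epsilon>
    proof -
      obtain z where z: "z \<in> span (insert b B)" "N (x - z) < \<epsilon>"
        using insert.prems \<open>0 < \<epsilon>\<close> by blast
      obtain k where k: "z - k *\<^sub>R b \<in> span B"
        using z span_breakdown_eq by metis
      define y where "y = (z - k *\<^sub>R b) + k *\<^sub>R b'"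
      have "N (z - y) = \<bar>k\<bar> * N (b - b')"
        unfolding y_def using scale[of k "b - b'"] by (simp add: algebra_simps)
      then have "N (x - y) < \<epsilon>"
        using diff_triangle[of x y z] z b' by simp
      moreover have "y \<in> span B" unfolding y_def
        using k b' span_add span_scale by blast
      ultimately show ?thesis by blast
    qed
    then obtain y where "y \<in> span B" "N (x - y) = 0" using insert.IH by blast
    then show ?thesis by (meson span_mono subset_insertI subsetD)
  next
    case True
    then obtain d where d: "d > 0" "\<And>y. y \<in> span B \<Longrightarrow> d \<le> N (b - y)" by blast
    have "\<exists>k y. y \<in> span B \<and> N (x - (k *\<^sub>R b + y)) < 1 / Suc n" for n
    proof -
      obtain z where z: "z \<in> span (insert b B)" "N (x - z) < 1 / Suc n"
        using insert.prems(1)[of "1 / Suc n"] by auto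
      obtain k where k: "z - k *\<^sub>R b \<in> span B"
        using z span_breakdown_eq by metis
      show ?thesis using z k by (intro exI[of _ k] exI[of _ "z - k *\<^sub>R b"]) simp
    qed
    then obtain k y where ky: "\<And>n. y n \<in> span B" "\<And>n. N (x - (k n *\<^sub>R b + y n)) < 1 / Suc n"
      by metis
    have kk: "\<bar>k m - k n\<bar> * d \<le> 1 / Suc m + 1 / Suc n" for m n
    proof -
      have "\<bar>k m - k n\<bar> * d \<le> N ((k m - k n) *\<^sub>R b + (y m - y n))"
        using d ky by (intro dist_coeff_le) (auto simp: span_diff)
      also have "(k m - k n) *\<^sub>R b + (y m - y n) = (x - (k n *\<^sub>R b + y n)) - (x - (k m *\<^sub>R b + y m))"
        by (simp add: algebra_simps)
      also have "N \<dots> \<le> 1 / Suc n + 1 / Suc m"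
        using diff_le ky(2)[of n] ky(2)[of m] by (smt (verit))
      finally show ?thesis by simp
    qed
    have "Cauchy k"
    proof (rule CauchyI)
      fix e :: real assume "0 < e"
      obtain n0 where n0: "1 / Suc n0 < e * d / 2"
        using reals_Archimedean[of "e * d / 2"] \<open>0 < e\<close> d by (auto simp: inverse_eq_divide)
      have "norm (k m - k n) < e" if "m \<ge> n0" "n \<ge> n0" for m n
      proof -
        have "1 / Suc m \<le> 1 / Suc n0" "1 / Suc n \<le> 1 / Suc n0"
          using that by (auto simp: frac_le)
        then have "\<bar>k m - k n\<bar> * d < e * d" using kk[of m n] n0 by linarith
        then show ?thesis using d by simp
      qed
      then show "\<exists>M. \<forall>m\<ge>M. \<forall>n\<ge>M. norm (k m - k n) < e" by blast
    qed
    then obtain s where s: "k \<longlonglongrightarrow> s" by (meson Cauchy_convergent convergentD)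
    have "\<exists>y\<in>span B. N ((x - s *\<^sub>R b) - y) < \<epsilon>" if "0 < \<epsilon>" for \<epsilon>
    proof -
      have "(\<lambda>n. 1 / Suc n + \<bar>k n - s\<bar> * N b) \<longlonglongrightarrow> 0 + \<bar>s - s\<bar> * N b"
        by (intro tendsto_intros s) real_asymp
      then have "eventually (\<lambda>n. 1 / Suc n + \<bar>k n - s\<bar> * N b < \<epsilon>) sequentially"
        using \<open>0 < \<epsilon>\<close> by (intro order_tendstoD) auto
      then obtain n where n: "1 / Suc n + \<bar>k n - s\<bar> * N b < \<epsilon>"
        by (meson eventually_sequentially order_refl)
      have "(x - s *\<^sub>R b) - y n = (x - (k n *\<^sub>R b + y n)) + (k n - s) *\<^sub>R b"
        by (simp add: algebra_simps)
      then have "N ((x - s *\<^sub>R b) - y n) \<le> N (x - (k n *\<^sub>R b + y n)) + \<bar>k n - s\<bar> * N b"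
        by (metis add_le scale)
      then have "N ((x - s *\<^sub>R b) - y n) < \<epsilon>" using ky(2)[of n] n by linarith
      then show ?thesis using ky by blast
    qed
    then obtain y where y: "y \<in> span B" "N ((x - s *\<^sub>R b) - y) = 0"
      using insert.IH by blast
    have "s *\<^sub>R b + y \<in> span (insert b B)"
      using y by (meson span_add span_scale span_base insertI1 span_mono subset_insertI subsetD)
    then show ?thesis using y by (metis diff_diff_add)
  qed
qed

text \<open>By \<open>span_closed\<close> the distance \<open>D\<close> of some \<open>x\<close>
  from the span is positive. Subtracting a point \<open>y0\<close> at distance below
  \<open>2 * D\<close> and normalising leaves a distance of at least 1 / 2.\<close>

lemma riesz:
  assumes inf: "\<And>B. finite B \<Longrightarrow> \<exists>x. \<forall>y\<in>span B. N (x - y) \<noteq> 0" and B: "finite B"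
  shows "\<exists>x. N x = 1 \<and> (\<forall>y\<in>span B. 1 / 2 \<le> N (x - y))"
proof -
  obtain x where x: "\<And>y. y \<in> span B \<Longrightarrow> N (x - y) \<noteq> 0" using inf B by blast
  then obtain d where d: "d > 0" "\<And>y. y \<in> span B \<Longrightarrow> d \<le> N (x - y)"
    using span_closed[OF B, of x] by (meson not_le)
  define D where "D = Inf ((\<lambda>y. N (x - y)) ` span B)"
  have bdd: "bdd_below ((\<lambda>y. N (x - y)) ` span B)" by (rule bdd_belowI[of _ 0]) auto
  have "d \<le> D" unfolding D_def using d by (intro cInf_greatest) (auto intro: span_zero)
  then have D: "D > 0" using d by simp
  have Dle: "D \<le> N (x - y)" if "y \<in> span B" for y
    unfolding D_def using bdd that by (intro cInf_lower) auto
  have "\<exists>y\<in>span B. N (x - y) < 2 * D"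
    using cInf_lessD[of "(\<lambda>y. N (x - y)) ` span B" "2 * D"] D span_zero D_def by auto
  then obtain y0 where y0: "y0 \<in> span B" "N (x - y0) < 2 * D" by blast
  define c where "c = N (x - y0)"
  have c: "c > 0" using x[OF y0(1)] nonneg[of "x - y0"] unfolding c_def by linarith
  show ?thesis
  proof (intro exI[of _ "inverse c *\<^sub>R (x - y0)"] conjI ballI)
    show "N (inverse c *\<^sub>R (x - y0)) = 1" using c by (simp add: scale c_def)
  next
    fix y assume y: "y \<in> span B"
    have "inverse c *\<^sub>R (x - y0) - y = inverse c *\<^sub>R (x - (y0 + c *\<^sub>R y))"
      using c by (simp add: algebra_simps)
    then have "N (inverse c *\<^sub>R (x - y0) - y) = inverse c * N (x - (y0 + c *\<^sub>R y))"
      using c scale by simp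
    also have "\<dots> \<ge> inverse c * D"
      using c y y0 by (intro mult_left_mono Dle span_add span_scale) auto
    also have "inverse c * D \<ge> 1 / 2" using y0 c by (simp add: c_def field_simps)
    finally show "1 / 2 \<le> N (inverse c *\<^sub>R (x - y0) - y)" .
  qed
qed

lemma separated_seq:
  assumes inf: "\<And>B. finite B \<Longrightarrow> \<exists>x. \<forall>y\<in>span B. N (x - y) \<noteq> 0"
  shows "\<exists>e::nat \<Rightarrow> 'v. \<forall>i. N (e i) = 1 \<and> (\<forall>j. i \<noteq> j \<longrightarrow> 1 / 2 \<le> N (e i - e j))"
proof -
  obtain e :: "nat \<Rightarrow> 'v" where e: "\<And>n. N (e n) = 1 \<and> (\<forall>y\<in>span (e ` {..<n}). 1 / 2 \<le> N (e n - y))"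
    using seq_choice[of "\<lambda>B x. N x = 1 \<and> (\<forall>y\<in>span B. 1 / 2 \<le> N (x - y))"] riesz[OF inf] by blast
  have "1 / 2 \<le> N (e i - e j)" if "j < i" for i j
    using e[of i] that by (auto intro: span_base)
  then show ?thesis using e diff_commute by (metis nat_neq_iff)
qed

end


section \<open>Additivity of p-th powers and almost monotone sequences\<close>

abbreviation almost_additive :: "real \<Rightarrow> ('v::real_vector \<Rightarrow> real) \<Rightarrow> real \<Rightarrow> 'v \<Rightarrow> 'v \<Rightarrow> bool" where
  "almost_additive p M \<epsilon> x y \<equiv> \<bar>M (x + y) powr p - M x powr p - M y powr p\<bar> \<le> \<epsilon>"

text \<open>\<open>K\<close> is chosen before the vectors \<open>e\<close>, because in the
  increments the vectors are found only after their number is known. Differences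
  \<open>e i - e j\<close> appear because they are what a pigeonhole argument delivers.\<close>

definition lp_additive :: "real \<Rightarrow> ('v::real_vector \<Rightarrow> real) \<Rightarrow> bool" where
  "lp_additive p M \<longleftrightarrow> (\<forall>A \<epsilon> R. finite A \<longrightarrow> 0 < \<epsilon> \<longrightarrow>
     (\<exists>K. \<forall>e :: nat \<Rightarrow> 'v. (\<forall>i<K. M (e i) \<le> R) \<longrightarrow>
       (\<exists>i j. i < j \<and> j < K \<and>
         (\<forall>x\<in>A. almost_additive p M \<epsilon> x (e i - e j)))))"

context seminorm
begin

text \<open>Adding a vector \<open>y\<close> almost disjoint from \<open>x\<close> cannot lower the
  p-th power of the norm: the error \<open>(1/2) powr p\<close> is absorbed by
  \<open>N y powr p\<close>. This is applied to a finite net of the vectors of medium size; for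
  small \<open>x\<close> the vector \<open>y\<close> dominates, for large \<open>x\<close> it is
  negligible.\<close>

lemma almost_monotone_extension:
  assumes inf: "\<And>B. finite B \<Longrightarrow> \<exists>x. \<forall>y\<in>span B. N (x - y) \<noteq> 0"
    and add: "lp_additive p N" and p: "1 < p"
    and B: "finite B" and \<eta>: "0 < \<eta>"
  shows "\<exists>y. 1 / 2 \<le> N y \<and> N y \<le> 2 \<and> (\<forall>x\<in>span B. \<forall>t. (1 - \<eta>) * N x \<le> N (x + t *\<^sub>R y))"
proof -
  obtain A where A: "finite A" "\<And>x. x \<in> span B \<Longrightarrow> N x \<le> 2 / \<eta> \<Longrightarrow> \<exists>a\<in>A. N (x - a) \<le> \<eta> / 8"
    using span_net[OF B, of "\<eta> / 8" "2 / \<eta>"] \<eta> by auto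
  obtain e :: "nat \<Rightarrow> 'v" where e: "\<And>i. N (e i) = 1" "\<And>i j. i \<noteq> j \<Longrightarrow> 1 / 2 \<le> N (e i - e j)"
    using separated_seq[OF inf] by blast
  have "\<exists>K. \<forall>e :: nat \<Rightarrow> 'v. (\<forall>i<K. N (e i) \<le> 1) \<longrightarrow>
       (\<exists>i j. i < j \<and> j < K \<and>
         (\<forall>x\<in>A. almost_additive p N ((1/2) powr p) x (e i - e j)))"
    using add A unfolding lp_additive_def by simp
  then obtain i j where ij: "i < j"
    "\<And>x. x \<in> A \<Longrightarrow> almost_additive p N ((1/2) powr p) x (e i - e j)"
    using e(1) by (metis order_refl)
  define y where "y = e i - e j"
  have y: "1 / 2 \<le> N y" "N y \<le> 2"
    using e(2)[of i j] ij diff_le[of "e i" "e j"] e(1) by (auto simp: y_def)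
  have main: "(1 - \<eta>) * N x \<le> N (x + y)" if x: "x \<in> span B" for x
  proof -
    have \<eta>N: "0 \<le> \<eta> * N x" using \<eta> by simp
    consider "N x \<le> 1 / 4" | "2 / \<eta> \<le> N x" | "1 / 4 \<le> N x" "N x \<le> 2 / \<eta>" by linarith
    then show ?thesis
    proof cases
      case 1
      have "N y \<le> N (x + y) + N x" using diff_le[of "x + y" x] by simp
      then show ?thesis using y 1 \<eta>N by (simp add: algebra_simps)
    next
      case 2
      then have "2 \<le> \<eta> * N x" using \<eta> by (simp add: field_simps)
      moreover have "N x \<le> N (x + y) + N y" using diff_le[of "x + y" y] by simp
      ultimately show ?thesis using y by (simp add: algebra_simps)
    next
      case 3
      then obtain a where a: "a \<in> A" "N (x - a) \<le> \<eta> / 8" using A x by blast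
      have "(1/2) powr p \<le> N y powr p" using y p by (intro powr_mono2) auto
      then have "N a powr p \<le> N (a + y) powr p" using ij(2)[OF a(1)] by (simp add: y_def)
      then have "N a \<le> N (a + y)"
        using p powr_less_mono2[of p "N (a + y)" "N a"] by (meson not_le nonneg less_trans zero_less_one)
      moreover have "N (a + y) \<le> N (x + y) + N (x - a)"
        using diff_le[of "x + y" "x - a"] by (simp add: add.commute)
      moreover have "N x \<le> N a + N (x - a)" using le_add_diff .
      moreover have "\<eta> / 4 \<le> \<eta> * N x" using 3 \<eta> by (simp add: field_simps)
      ultimately show ?thesis using a by (simp add: algebra_simps)
    qed
  qed
  have "(1 - \<eta>) * N x \<le> N (x + t *\<^sub>R y)" if x: "x \<in> span B" for x t
  proof (cases "t = 0")
    case True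
    have "0 \<le> \<eta> * N x" using \<eta> by simp
    then show ?thesis using True by (simp add: algebra_simps)
  next
    case False
    have "x + t *\<^sub>R y = t *\<^sub>R (inverse t *\<^sub>R x + y)"
      using False by (simp add: algebra_simps)
    then have "N (x + t *\<^sub>R y) = \<bar>t\<bar> * N (inverse t *\<^sub>R x + y)" by (metis scale)
    also have "\<dots> \<ge> \<bar>t\<bar> * ((1 - \<eta>) * N (inverse t *\<^sub>R x))"
      by (intro mult_left_mono main span_scale x) auto
    also have "\<bar>t\<bar> * ((1 - \<eta>) * N (inverse t *\<^sub>R x)) = (1 - \<eta>) * N x"
      using False by (simp add: scale)
    finally show ?thesis .
  qed
  then show ?thesis using y by blast
qed

text \<open>Iterating the extension gives a sequence whose partial sums have at most twice the norm
  of the full sum. A summand is the difference of two partial sums, hence has at most four times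
  that norm, and \<open>1 / 2 \<le> N (v k)\<close> turns 4 into 8.\<close>

lemma uniform_coefficients:
  assumes inf: "\<And>B. finite B \<Longrightarrow> \<exists>x. \<forall>y\<in>span B. N (x - y) \<noteq> 0"
    and add: "lp_additive p N" and p: "1 < p"
  shows "\<exists>v::nat \<Rightarrow> 'v. (\<forall>i. N (v i) \<le> 2) \<and> (\<forall>a k. k < n \<longrightarrow> \<bar>a k\<bar> \<le> 8 * N (\<Sum>i<n. a i *\<^sub>R v i))"
proof -
  \<comment> \<open>By Bernoulli's inequality, \<open>n\<close> losses of a factor
    \<open>1 - \<eta>\<close> amount to a factor of at least 1 / 2.\<close>
  define \<eta> where "\<eta> = 1 / (2 * (real n + 1))"
  have \<eta>: "0 < \<eta>" "\<eta> < 1" unfolding \<eta>_def by (auto simp: field_simps)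
  have "1 + real n * (- \<eta>) \<le> (1 + (- \<eta>)) ^ n" using \<eta> by (intro Bernoulli_inequality) auto
  moreover have "real n * \<eta> \<le> 1 / 2" unfolding \<eta>_def by (simp add: field_simps)
  ultimately have half: "1 / 2 \<le> (1 - \<eta>) ^ n" by simp
  have ex: "\<exists>y. 1 / 2 \<le> N y \<and> N y \<le> 2 \<and> (\<forall>x\<in>span B. \<forall>t. (1 - \<eta>) * N x \<le> N (x + t *\<^sub>R y))"
    if "finite B" for B
    using almost_monotone_extension[OF inf add p that \<eta>(1)] .
  obtain v :: "nat \<Rightarrow> 'v" where v: "\<And>k. 1 / 2 \<le> N (v k)" "\<And>k. N (v k) \<le> 2"
    "\<And>k x t. x \<in> span (v ` {..<k}) \<Longrightarrow> (1 - \<eta>) * N x \<le> N (x + t *\<^sub>R v k)"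
    using seq_choice[of "\<lambda>B y. 1 / 2 \<le> N y \<and> N y \<le> 2 \<and> (\<forall>x\<in>span B. \<forall>t. (1 - \<eta>) * N x \<le> N (x + t *\<^sub>R y))"] ex
    by blast
  have "\<bar>a k\<bar> \<le> 8 * N (\<Sum>i<n. a i *\<^sub>R v i)" if k: "k < n" for a k
  proof -
    define S where "S m = (\<Sum>i<m. a i *\<^sub>R v i)" for m
    have S: "S m \<in> span (v ` {..<m})" for m
      unfolding S_def by (intro span_sum span_scale span_base) auto
    have step: "(1 - \<eta>) * N (S m) \<le> N (S (Suc m))" for m
      using v(3)[OF S[of m], of "a m"] by (simp add: S_def)
    have pow: "(1 - \<eta>) ^ d * N (S m) \<le> N (S (m + d))" for m d
    proof (induction d)
      case (Suc d)
      have "(1 - \<eta>) ^ Suc d * N (S m) = (1 - \<eta>) * ((1 - \<eta>) ^ d * N (S m))" by simp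
      also have "\<dots> \<le> (1 - \<eta>) * N (S (m + d))" using Suc \<eta> by (intro mult_left_mono) auto
      also have "\<dots> \<le> N (S (m + Suc d))" using step by simp
      finally show ?case .
    qed simp
    have two: "N (S m) \<le> 2 * N (S n)" if "m \<le> n" for m
    proof -
      have "1 / 2 \<le> (1 - \<eta>) ^ (n - m)"
        using half power_decreasing[of "n - m" n "1 - \<eta>"] \<eta> by linarith
      then have "1 / 2 * N (S m) \<le> (1 - \<eta>) ^ (n - m) * N (S m)" by (intro mult_right_mono) auto
      also have "\<dots> \<le> N (S n)" using pow[of "n - m" m] that by simp
      finally show ?thesis by simp
    qed
    have "a k *\<^sub>R v k = S (Suc k) - S k" by (simp add: S_def)
    then have "\<bar>a k\<bar> * N (v k) \<le> N (S (Suc k)) + N (S k)" by (metis diff_le scale)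
    also have "\<dots> \<le> 4 * N (S n)" using two[of k] two[of "Suc k"] k by simp
    finally have "\<bar>a k\<bar> * N (v k) \<le> 4 * N (S n)" .
    moreover have "\<bar>a k\<bar> * (1 / 2) \<le> \<bar>a k\<bar> * N (v k)" using v by (intro mult_left_mono) auto
    ultimately show ?thesis by (simp add: S_def)
  qed
  then show ?thesis using v by blast
qed

end

section \<open>Linear systems and symmetric bilinear forms\<close>

lemma homogeneous_solution:
  fixes c :: "'l \<Rightarrow> 'i \<Rightarrow> real"
  assumes "finite \<Lambda>" "finite I" "card \<Lambda> < card I"
  shows "\<exists>a. (\<exists>i\<in>I. a i \<noteq> 0) \<and> (\<forall>l\<in>\<Lambda>. (\<Sum>i\<in>I. a i * c l i) = 0)"
  using assms
proof (induction \<Lambda> arbitrary: I c rule: finite_induct)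
  case empty
  then have "I \<noteq> {}" by auto
  then show ?case by (intro exI[of _ "\<lambda>_. 1"]) auto
next
  case (insert l \<Lambda>)
  show ?case
  proof (cases "\<exists>i\<in>I. c l i \<noteq> 0")
    case False
    obtain a where "\<exists>i\<in>I. a i \<noteq> 0" "\<forall>l\<in>\<Lambda>. (\<Sum>i\<in>I. a i * c l i) = 0"
      using insert.IH[of I c] insert.prems insert.hyps by auto
    then show ?thesis using False by (intro exI[of _ a]) auto
  next
    case True
    then obtain k where k: "k \<in> I" "c l k \<noteq> 0" by blast
    define r where "r i = c l i / c l k" for i
    have "card \<Lambda> < card (I - {k})"
      using insert.prems insert.hyps k by (simp add: card_Diff_singleton)
    then obtain a where a: "\<exists>i\<in>I - {k}. a i \<noteq> 0"
      "\<And>m. m \<in> \<Lambda> \<Longrightarrow> (\<Sum>i\<in>I - {k}. a i * (c m i - r i * c m k)) = 0"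
      using insert.IH[of "I - {k}" "\<lambda>m i. c m i - r i * c m k"] insert.prems by auto
    \<comment> \<open>The pivot unknown \<open>k\<close> is determined by equation \<open>l\<close>;
      substituting it into the other equations gives the reduced system that \<open>a\<close>
      solves.\<close>
    define b where "b i = (if i = k then - (\<Sum>i\<in>I - {k}. a i * r i) else a i)" for i
    have split: "(\<Sum>i\<in>I. b i * c m i) = (\<Sum>i\<in>I - {k}. a i * (c m i - r i * c m k))" for m
    proof -
      have "(\<Sum>i\<in>I. b i * c m i) = b k * c m k + (\<Sum>i\<in>I - {k}. b i * c m i)"
        using k insert.prems by (intro sum.remove) auto
      also have "(\<Sum>i\<in>I - {k}. b i * c m i) = (\<Sum>i\<in>I - {k}. a i * c m i)"
        by (intro sum.cong) (auto simp: b_def)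
      finally show ?thesis
        by (simp add: b_def sum_distrib_right right_diff_distrib sum_subtractf mult.assoc)
    qed
    have "(\<Sum>i\<in>I. b i * c m i) = 0" if "m \<in> insert l \<Lambda>" for m
    proof (cases "m = l")
      case True
      then show ?thesis unfolding split using k by (simp add: r_def)
    next
      case False
      then show ?thesis unfolding split using that a(2) by blast
    qed
    moreover have "\<exists>i\<in>I. b i \<noteq> 0" using a(1) by (auto simp: b_def)
    ultimately show ?thesis by (intro exI[of _ b]) auto
  qed
qed

text \<open>Definiteness is left out: a form lives on the whole space but is compared with
  \<open>N\<close> only on a subspace, where the comparison supplies the positivity.\<close>

definition symform :: "('v::real_vector \<Rightarrow> 'v \<Rightarrow> real) \<Rightarrow> bool" where
  "symform B \<longleftrightarrow> (\<forall>x. linear (B x)) \<and> (\<forall>x y. B x y = B y x)"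

locale symmetric_form =
  fixes B :: "'v::real_vector \<Rightarrow> 'v \<Rightarrow> real"
  assumes symform: "symform B"
begin

lemma commute: "B x y = B y x"
  using symform by (simp add: symform_def)

lemma linear: "linear (B x)"
  using symform by (simp add: symform_def)

lemma add_right: "B x (y + z) = B x y + B x z"
  and scale_right: "B x (c *\<^sub>R y) = c * B x y"
  and diff_right: "B x (y - z) = B x y - B x z"
  and sum_right: "B x (\<Sum>i\<in>I. f i) = (\<Sum>i\<in>I. B x (f i))"
  using linear[of x] by (simp_all add: linear_add linear_scale linear_diff linear_sum)

lemma add_left: "B (y + z) x = B y x + B z x"
  and scale_left: "B (c *\<^sub>R y) x = c * B y x"
  and diff_left: "B (y - z) x = B y x - B z x"
  and sum_left: "B (\<Sum>i\<in>I. f i) x = (\<Sum>i\<in>I. B (f i) x)"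
  by (simp_all add: commute[of _ x] add_right scale_right diff_right sum_right)

lemmas bilinear_simps = add_left add_right scale_left scale_right diff_left diff_right

lemma orthogonal_projection:
  fixes k :: nat
  assumes w: "w = (\<Sum>i<k. (B x (h i) / B (h i) (h i)) *\<^sub>R h i)"
    and orth: "\<And>i j. i < k \<Longrightarrow> j < k \<Longrightarrow> i \<noteq> j \<Longrightarrow> B (h i) (h j) = 0"
    and nz: "\<And>i. i < k \<Longrightarrow> B (h i) (h i) \<noteq> 0"
  shows "\<And>j. j < k \<Longrightarrow> B (x - w) (h j) = 0"
    and "B x x = B (x - w) (x - w) + B w w"
    and "B w w = (\<Sum>i<k. B x (h i) * B x (h i) / B (h i) (h i))"
proof -
  show o: "B (x - w) (h j) = 0" if j: "j < k" for j
  proof -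
    have "B w (h j) = (\<Sum>i<k. B x (h i) / B (h i) (h i) * B (h i) (h j))"
      by (simp add: w sum_left scale_left)
    also have "\<dots> = (\<Sum>i<k. if i = j then B x (h j) else 0)"
      using orth nz j by (intro sum.cong) auto
    also have "\<dots> = B x (h j)" using j by simp
    finally show ?thesis by (simp add: diff_left)
  qed
  have z: "B (x - w) w = 0"
    unfolding w[unfolded w] using o by (subst (2) w) (simp add: sum_right scale_right)
  then show "B x x = B (x - w) (x - w) + B w w"
    using commute[of w "x - w"] by (simp add: bilinear_simps commute)
  have "B w w = B x w" using z by (simp add: diff_left)
  also have "\<dots> = (\<Sum>i<k. B x (h i) * B x (h i) / B (h i) (h i))"
    by (subst w) (simp add: sum_right scale_right)
  finally show "B w w = (\<Sum>i<k. B x (h i) * B x (h i) / B (h i) (h i))" .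
qed

end

text \<open>Both improvements of a form below rescale it and correct it along finitely many
  directions; \<open>k = 0\<close> gives the rescalings that start the iterations.\<close>

lemma symform_combination:
  fixes k :: nat
  assumes "symform B"
  shows "symform (\<lambda>x y. \<alpha> * B x y + (\<Sum>i<k. \<beta> i * B x (h i) * B y (h i)))"
proof -
  interpret symmetric_form B using assms by unfold_locales
  have "linear (\<lambda>y. \<alpha> * B x y + (\<Sum>i<k. \<beta> i * B x (h i) * B y (h i)))" for x
    by (intro linearI) (simp_all add: bilinear_simps algebra_simps sum.distrib sum_distrib_left)
  moreover have "\<alpha> * B x y + (\<Sum>i<k. \<beta> i * B x (h i) * B y (h i)) =
      \<alpha> * B y x + (\<Sum>i<k. \<beta> i * B y (h i) * B x (h i))" for x y
    using commute[of x y] by (simp add: mult_ac)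
  ultimately show ?thesis by (simp add: symform_def)
qed

section \<open>Contact points of extremal ellipsoids\<close>

text \<open>The last clause plays the role of a dimension of at least \<open>n\<close> modulo the
  kernel of \<open>N\<close>: fewer than \<open>n\<close> linear conditions always leave a vector of
  \<open>E\<close> on which \<open>N\<close> does not vanish. \<open>D\<close> will be independent
  of \<open>n\<close>.\<close>

definition comparable_form ::
    "('v::real_vector \<Rightarrow> real) \<Rightarrow> real \<Rightarrow> nat \<Rightarrow> 'v set \<Rightarrow> ('v \<Rightarrow> 'v \<Rightarrow> real) \<Rightarrow> bool" where
  "comparable_form N D n E B \<longleftrightarrow> subspace E \<and> symform B \<and>
    (\<forall>x\<in>E. N x ^ 2 \<le> D * n * B x x \<and> B x x \<le> D * n * N x ^ 2) \<and>
    (\<forall>\<Lambda>. finite \<Lambda> \<longrightarrow> card \<Lambda> < n \<longrightarrow> (\<forall>l\<in>\<Lambda>. linear l) \<longrightarrow>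
      (\<exists>x\<in>E. N x \<noteq> 0 \<and> (\<forall>l\<in>\<Lambda>. l x = (0::real))))"

text \<open>The form is the sum of the squared coordinates with respect to \<open>v\<close>. The
  Cauchy-Schwarz inequality and \<open>M (v i) \<le> 2\<close> give the first comparison, with
  constant \<open>(2 * C)\<^sup>2\<close>; the coefficient bound, summed over \<open>n\<close>
  coordinates, gives the second, with \<open>(8 / c)\<^sup>2\<close>.\<close>

lemma initial_form:
  fixes N M :: "'v::real_vector \<Rightarrow> real"
  assumes "seminorm N" "seminorm M" "0 < c" "0 < C"
    and lower: "\<And>x. c * M x \<le> N x" and upper: "\<And>x. N x \<le> C * M x"
    and v: "\<And>i. M (v i) \<le> 2" and coeff: "\<And>a k. k < n \<Longrightarrow> \<bar>a k\<bar> \<le> 8 * M (\<Sum>i<n. a i *\<^sub>R v i)"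
    and D: "(2 * C)\<^sup>2 \<le> D" "(8 / c)\<^sup>2 \<le> D"
  shows "\<exists>E B. comparable_form N D n E B"
proof -
  interpret N: seminorm N by fact
  interpret M: seminorm M by fact
  have inj: "inj_on v {..<n}"
  proof (rule inj_onI, rule ccontr)
    fix i j assume ij: "i \<in> {..<n}" "j \<in> {..<n}" "v i = v j" "i \<noteq> j"
    \<comment> \<open>If two of the vectors agreed, the coefficients 1 and -1 would give a vanishing
      sum, against \<open>coeff\<close>.\<close>
    define a where "a k = (if k = i then 1 else if k = j then - 1 else 0 :: real)" for k
    have "(\<Sum>k<n. a k *\<^sub>R v k) = (\<Sum>k\<in>{i, j}. a k *\<^sub>R v k)"
      using ij by (intro sum.mono_neutral_right) (auto simp: a_def)
    then have "(\<Sum>k<n. a k *\<^sub>R v k) = 0" using ij by (simp add: a_def)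
    then show False using coeff[of i a] ij by (simp add: a_def)
  qed
  have indep: "independent (v ` {..<n})"
  proof
    assume "dependent (v ` {..<n})"
    then obtain u where u: "\<exists>x\<in>v ` {..<n}. u x \<noteq> 0" "(\<Sum>x\<in>v ` {..<n}. u x *\<^sub>R x) = 0"
      by (auto simp: dependent_finite)
    then have "(\<Sum>i<n. u (v i) *\<^sub>R v i) = 0" using inj by (simp add: sum.reindex)
    then show False using u(1) coeff[of _ "\<lambda>i. u (v i)"] by auto
  qed
  \<comment> \<open>The coordinate functionals are extended to the whole space, where forms are
    defined.\<close>
  have "\<exists>f. linear f \<and> (\<forall>j<n. f (v j) = (if j = i then 1 else 0 :: real))" if "i < n" for i
  proof -
    obtain f where f: "linear f" "\<forall>x\<in>v ` {..<n}. f x = (if x = v i then 1 else 0 :: real)"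
      using linear_independent_extend[OF indep, of "\<lambda>x. if x = v i then 1 else 0 :: real"] by auto
    have "f (v j) = (if j = i then 1 else 0)" if "j < n" for j
      using f(2) inj_on_eq_iff[OF inj, of j i] that \<open>i < n\<close> by simp
    then show ?thesis using f(1) by blast
  qed
  then obtain f :: "nat \<Rightarrow> 'v \<Rightarrow> real" where
    f: "\<And>i. i < n \<Longrightarrow> linear (f i)" "\<And>i j. i < n \<Longrightarrow> j < n \<Longrightarrow> f i (v j) = (if j = i then 1 else 0)"
    by metis
  define S where "S a = (\<Sum>i<n. a i *\<^sub>R v i)" for a
  have fS: "f i (S a) = a i" if i: "i < n" for i a
  proof -
    have "f i (S a) = (\<Sum>j<n. a j * f i (v j))"
      unfolding S_def using f(1)[OF i] by (simp add: linear_sum linear_scale)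
    also have "\<dots> = (\<Sum>j<n. if j = i then a j else 0)"
      using f(2) i by (intro sum.cong) auto
    also have "\<dots> = a i" using i by simp
    finally show ?thesis .
  qed
  define B where "B x y = (\<Sum>i<n. f i x * f i y)" for x y
  have "symform B"
    unfolding symform_def B_def using f(1)
    by (auto intro!: linearI sum.cong simp: linear_add linear_scale algebra_simps sum.distrib sum_distrib_left)
  moreover have "subspace (range S)"
  proof (rule subspaceI)
    show "0 \<in> range S" by (rule range_eqI[of _ _ "\<lambda>_. 0"]) (simp add: S_def)
  next
    fix x y assume "x \<in> range S" "y \<in> range S"
    then obtain a b where "x = S a" "y = S b" by auto
    then show "x + y \<in> range S"
      by (intro range_eqI[of _ _ "\<lambda>i. a i + b i"]) (simp add: S_def scaleR_left_distrib sum.distrib)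
  next
    fix c x assume "x \<in> range S"
    then obtain a where "x = S a" by auto
    then show "c *\<^sub>R x \<in> range S"
      by (intro range_eqI[of _ _ "\<lambda>i. c * a i"]) (simp add: S_def scaleR_sum_right)
  qed
  moreover have "N x ^ 2 \<le> D * n * B x x \<and> B x x \<le> D * n * N x ^ 2" if x: "x \<in> range S" for x
  proof -
    obtain a where a: "x = S a" using x by auto
    have B: "B x x = (\<Sum>i<n. (a i)\<^sup>2)"
      unfolding B_def a by (intro sum.cong) (simp_all add: fS power2_eq_square)
    have "M x \<le> (\<Sum>i<n. \<bar>a i\<bar> * M (v i))"
      unfolding a S_def using M.sum_le[of "\<lambda>i. a i *\<^sub>R v i" "{..<n}"] by (simp add: M.scale)
    also have "\<dots> \<le> (\<Sum>i<n. \<bar>a i\<bar> * 2)" using v by (intro sum_mono mult_left_mono) auto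
    finally have "C * M x \<le> C * (2 * (\<Sum>i<n. \<bar>a i\<bar>))"
      using \<open>0 < C\<close> by (simp add: sum_distrib_right[symmetric] mult.commute)
    then have "N x \<le> 2 * C * (\<Sum>i<n. \<bar>a i\<bar>)" using upper[of x] by simp
    then have "N x ^ 2 \<le> (2 * C * (\<Sum>i<n. \<bar>a i\<bar>))\<^sup>2" by (intro power_mono) auto
    also have "\<dots> = (2 * C)\<^sup>2 * (\<Sum>i<n. \<bar>a i\<bar>)\<^sup>2" by (simp add: power_mult_distrib)
    also have "\<dots> \<le> D * (n * B x x)"
      using D sum_squared_le_sum_of_squares[of "\<lambda>i. \<bar>a i\<bar>" "{..<n}"]
      by (intro mult_mono) (auto simp: B mult.commute intro: order_trans[OF zero_le_power2])
    finally have 1: "N x ^ 2 \<le> D * n * B x x" by (simp add: mult.assoc)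
    have "(a i)\<^sup>2 \<le> D * N x ^ 2" if "i < n" for i
    proof -
      have "\<bar>a i\<bar> \<le> 8 * M x" using coeff[OF that, of a] by (simp add: a S_def)
      also have "\<dots> \<le> 8 / c * N x" using lower[of x] \<open>0 < c\<close> by (simp add: field_simps)
      finally have "\<bar>a i\<bar>\<^sup>2 \<le> (8 / c * N x)\<^sup>2" by (intro power_mono) auto
      also have "\<dots> = (8 / c)\<^sup>2 * (N x)\<^sup>2" by (simp add: power_mult_distrib power_divide)
      also have "\<dots> \<le> D * (N x)\<^sup>2" using D by (intro mult_right_mono) auto
      finally show ?thesis by simp
    qed
    then have "B x x \<le> (\<Sum>i<n. D * N x ^ 2)" unfolding B by (intro sum_mono) auto
    then show ?thesis using 1 by (simp add: mult_ac)
  qed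
  moreover have "\<forall>\<Lambda>::('v \<Rightarrow> real) set. finite \<Lambda> \<longrightarrow> card \<Lambda> < n \<longrightarrow> (\<forall>l\<in>\<Lambda>. linear l) \<longrightarrow>
      (\<exists>x\<in>range S. N x \<noteq> 0 \<and> (\<forall>l\<in>\<Lambda>. l x = 0))"
  proof (intro allI impI)
    fix \<Lambda> :: "('v \<Rightarrow> real) set"
    assume \<Lambda>: "finite \<Lambda>" "card \<Lambda> < n" "\<forall>l\<in>\<Lambda>. linear l"
    obtain a where a: "\<exists>i<n. a i \<noteq> 0" "\<And>l. l \<in> \<Lambda> \<Longrightarrow> (\<Sum>i<n. a i * l (v i)) = 0"
      using homogeneous_solution[of \<Lambda> "{..<n}" "\<lambda>l i. l (v i)"] \<Lambda> by auto
    obtain i where "i < n" "a i \<noteq> 0" using a by blast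
    then have "M (S a) > 0" using coeff[of i a] by (simp add: S_def)
    then have "N (S a) \<noteq> 0" using lower[of "S a"] \<open>0 < c\<close> mult_pos_pos[of c "M (S a)"] by linarith
    moreover have "l (S a) = 0" if "l \<in> \<Lambda>" for l
      unfolding S_def using \<Lambda>(3) that a(2) by (simp add: linear_sum linear_scale)
    ultimately show "\<exists>x\<in>range S. N x \<noteq> 0 \<and> (\<forall>l\<in>\<Lambda>. l x = 0)" by auto
  qed
  ultimately show ?thesis
    unfolding comparable_form_def by (intro exI[of _ "range S"] exI[of _ B]) simp
qed

text \<open>\<open>m\<close> bounds the codimension on which the two forms need not be proportional.\<close>

definition proportional_off :: "nat \<Rightarrow> real \<Rightarrow> ('v::real_vector \<Rightarrow> 'v \<Rightarrow> real) \<Rightarrow> ('v \<Rightarrow> 'v \<Rightarrow> real) \<Rightarrow> bool" where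
  "proportional_off m q B B' \<longleftrightarrow> (\<exists>\<Lambda>. finite \<Lambda> \<and> card \<Lambda> \<le> m \<and> (\<forall>l\<in>\<Lambda>. linear l) \<and>
     (\<forall>x. (\<forall>l\<in>\<Lambda>. l x = (0::real)) \<longrightarrow> B' x x = q * B x x))"

lemma proportional_off_trans:
  assumes "proportional_off m q B B'" "proportional_off m' q' B' B''"
  shows "proportional_off (m + m') (q' * q) B B''"
proof -
  obtain \<Lambda> where 1: "finite \<Lambda>" "card \<Lambda> \<le> m" "\<forall>l\<in>\<Lambda>. linear l"
    "\<forall>x. (\<forall>l\<in>\<Lambda>. l x = (0::real)) \<longrightarrow> B' x x = q * B x x"
    using assms(1) unfolding proportional_off_def by auto
  obtain \<Lambda>' where 2: "finite \<Lambda>'" "card \<Lambda>' \<le> m'" "\<forall>l\<in>\<Lambda>'. linear l"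
    "\<forall>x. (\<forall>l\<in>\<Lambda>'. l x = (0::real)) \<longrightarrow> B'' x x = q' * B' x x"
    using assms(2) unfolding proportional_off_def by auto
  have "card (\<Lambda> \<union> \<Lambda>') \<le> m + m'" using 1(2) 2(2) card_Un_le[of \<Lambda> \<Lambda>'] by simp
  moreover have "B'' x x = q' * q * B x x" if "\<forall>l\<in>\<Lambda> \<union> \<Lambda>'. l x = 0" for x
    using 1(4) 2(4) that by simp
  ultimately show ?thesis
    unfolding proportional_off_def using 1 2 by (intro exI[of _ "\<Lambda> \<union> \<Lambda>'"]) auto
qed

text \<open>Gains multiply and codimensions add, so the gain is exponential in \<open>L\<close>
  while the exceptional codimension is only linear.\<close>

lemma iterate_forms:
  assumes step: "\<And>B. I B \<Longrightarrow> \<exists>B'. I B' \<and> proportional_off K q B B'"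
    and "I B"
  shows "\<exists>B'. I B' \<and> proportional_off (L * K) (q ^ L) B B'"
proof (induction L)
  case 0
  have "proportional_off (0 * K) (q ^ 0) B B"
    unfolding proportional_off_def by (intro exI[of _ "{}"]) simp
  then show ?case using assms by blast
next
  case (Suc L)
  then obtain B1 where 1: "I B1" "proportional_off (L * K) (q ^ L) B B1" by blast
  obtain B2 where 2: "I B2" "proportional_off K q B1 B2" using step[OF 1(1)] by blast
  have "proportional_off (Suc L * K) (q ^ Suc L) B B2"
    using proportional_off_trans[OF 1(2) 2(2)] by (simp add: add.commute)
  then show ?case using 2(1) by blast
qed

text \<open>This contradicts the absence of contact points: \<open>L * K + 1\<close> is the
  dimension \<open>n\<close>, and a factor \<open>D * n\<close> is lost twice, once in each
  comparison between form and norm. Taking square roots reduces the claim to the null sequence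
  \<open>L * sqrt q ^ L\<close>.\<close>

lemma exists_geometric_gain:
  fixes q D :: real and K :: nat
  assumes "0 < q" "q < 1" "0 < D"
  shows "\<exists>L. (D * (L * K + 1))\<^sup>2 * q ^ L < 1"
proof -
  have r: "0 < sqrt q" "sqrt q < 1" using assms by auto
  have "(\<lambda>L. D * K * (real L * sqrt q ^ L) + D * sqrt q ^ L) \<longlonglongrightarrow> D * K * 0 + D * 0"
    using r by (intro tendsto_intros powser_times_n_limit_0 LIMSEQ_power_zero) auto
  then have "eventually (\<lambda>L. D * K * (real L * sqrt q ^ L) + D * sqrt q ^ L < 1) sequentially"
    by (intro order_tendstoD) auto
  then obtain L where L: "D * K * (real L * sqrt q ^ L) + D * sqrt q ^ L < 1"
    by (meson eventually_sequentially order_refl)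
  have "D * (L * K + 1) * sqrt q ^ L < 1" using L by (simp add: algebra_simps)
  moreover have "0 \<le> D * (L * K + 1) * sqrt q ^ L" using assms by simp
  ultimately have "(D * (L * K + 1) * sqrt q ^ L)\<^sup>2 < 1" by (simp add: power_less_one_iff)
  moreover have "(sqrt q ^ L)\<^sup>2 = q ^ L" using assms by (metis real_sqrt_pow2 less_imp_le power_mult mult.commute)
  ultimately show ?thesis by (auto simp: power_mult_distrib)
qed

text \<open>Take an orthonormal system of almost contact points of a size that cannot be exceeded by
  one. On its orthogonal complement \<open>N\<close> is smaller than the Euclidean norm by a factor
  \<open>1 - \<delta>\<close>. This allows the form to shrink by \<open>1 - \<delta>\<close> there,
  at the price of a factor \<open>1 / \<delta>\<close> on the span of the system, which has fewer
  than \<open>K\<close> members.\<close>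

lemma upper_form_step:
  fixes N :: "'v::real_vector \<Rightarrow> real"
  assumes "seminorm N" "symform B" and E: "subspace E"
    and NB: "\<And>x. x \<in> E \<Longrightarrow> N x ^ 2 \<le> B x x" and \<delta>: "0 < \<delta>" "\<delta> < 1"
    and no: "\<nexists>y. \<forall>i<K. y i \<in> E \<and> 1 - \<delta> \<le> N (y i) \<and> (\<forall>j<K. B (y i) (y j) = (if i = j then 1 else 0))"
  shows "\<exists>B'. symform B' \<and> (\<forall>x\<in>E. N x ^ 2 \<le> B' x x) \<and> proportional_off K (1 - \<delta>) B B'"
proof -
  interpret N: seminorm N by fact
  interpret B: symmetric_form B using assms by unfold_locales
  define P where "P k \<longleftrightarrow> (\<exists>y. \<forall>i<k. y i \<in> E \<and> 1 - \<delta> \<le> N (y i) \<and>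
      (\<forall>j<k. B (y i) (y j) = (if i = j then 1 else 0)))" for k :: nat
  have "\<not> P K" "P 0" using no by (auto simp: P_def)
  then obtain k where k: "k < K" "P k" "\<not> P (Suc k)"
    using ex_least_nat_less[of "\<lambda>k. \<not> P k" K] by auto
  obtain y where y: "\<And>i. i < k \<Longrightarrow> y i \<in> E" "\<And>i. i < k \<Longrightarrow> 1 - \<delta> \<le> N (y i)"
    "\<And>i j. i < k \<Longrightarrow> j < k \<Longrightarrow> B (y i) (y j) = (if i = j then 1 else 0)"
    using k(2) unfolding P_def by blast
  have orth: "N h \<le> (1 - \<delta>) * sqrt (B h h)" if h: "h \<in> E" "\<And>i. i < k \<Longrightarrow> B h (y i) = 0" for h
  proof (rule ccontr)
    assume contr: "\<not> N h \<le> (1 - \<delta>) * sqrt (B h h)"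
    have pos: "B h h > 0"
    proof (rule ccontr)
      assume "\<not> B h h > 0"
      then have "(N h)\<^sup>2 \<le> 0" "B h h = 0" using NB[OF h(1)] zero_le_power2[of "N h"] by linarith+
      then show False using contr by simp
    qed
    define z where "z = inverse (sqrt (B h h)) *\<^sub>R h"
    have "B z z = 1" using pos by (simp add: z_def B.bilinear_simps field_simps)
    moreover have "1 - \<delta> \<le> N z"
    proof -
      have "0 < sqrt (B h h)" "(1 - \<delta>) * sqrt (B h h) \<le> N h" using contr pos by auto
      then have "1 - \<delta> \<le> N h / sqrt (B h h)" by (simp only: pos_le_divide_eq)
      also have "\<dots> = N z" using pos by (simp add: z_def N.scale divide_inverse)
      finally show ?thesis .
    qed
    moreover have "z \<in> E" unfolding z_def using E h by (simp add: subspace_scale)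
    moreover have "B z (y i) = 0" "B (y i) z = 0" if "i < k" for i
      using h(2)[OF that] by (simp_all add: z_def B.bilinear_simps B.commute[of "y i"])
    ultimately have "P (Suc k)"
      unfolding P_def using y by (intro exI[of _ "y(k := z)"]) (auto simp: less_Suc_eq)
    then show False using k by blast
  qed
  \<comment> \<open>With this value \<open>B' x x\<close> becomes
    \<open>(1 - \<delta>) * a\<^sup>2 + 1 / \<delta> * s\<^sup>2\<close>, where \<open>a\<close> and
    \<open>s\<close> are the Euclidean norms of the two orthogonal parts of
    \<open>x\<close>.\<close>
  define \<beta> where "\<beta> = 1 / \<delta> - (1 - \<delta>)"
  define B' where "B' u v = (1 - \<delta>) * B u v + (\<Sum>i<k. \<beta> * B u (y i) * B v (y i))" for u v
  have "symform B'" unfolding B'_def using symform_combination[OF \<open>symform B\<close>] .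
  moreover have "N x ^ 2 \<le> B' x x" if x: "x \<in> E" for x
  proof -
    define w where "w = (\<Sum>i<k. (B x (y i) / B (y i) (y i)) *\<^sub>R y i)"
    have nz: "i < k \<Longrightarrow> B (y i) (y i) \<noteq> 0" for i using y(3)[of i i] by simp
    have oo: "i < k \<Longrightarrow> j < k \<Longrightarrow> i \<noteq> j \<Longrightarrow> B (y i) (y j) = 0" for i j using y(3)[of i j] by simp
    note proj = B.orthogonal_projection[OF w_def oo nz]
    have w: "w \<in> E" unfolding w_def using E y by (intro subspace_sum subspace_scale) auto
    have h: "x - w \<in> E" using E x w by (simp add: subspace_diff)
    define a where "a = sqrt (B (x - w) (x - w))"
    define s where "s = sqrt (B w w)"
    have "0 \<le> B (x - w) (x - w)" "0 \<le> B w w"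
      using NB[OF h] NB[OF w] zero_le_power2 order_trans by blast+
    then have as: "a\<^sup>2 = B (x - w) (x - w)" "s\<^sup>2 = B w w" by (auto simp: a_def s_def)
    have "N w \<le> s" unfolding s_def using NB[OF w] by (simp add: real_le_rsqrt)
    moreover have "N (x - w) \<le> (1 - \<delta>) * a" unfolding a_def using orth[OF h] proj(1) by blast
    ultimately have "N x \<le> (1 - \<delta>) * a + s" using N.le_add_diff[of x w] by simp
    then have "N x ^ 2 \<le> ((1 - \<delta>) * a + s)\<^sup>2" by (intro power_mono) auto
    \<comment> \<open>This is the Cauchy-Schwarz inequality with weights \<open>1 - \<delta>\<close>
      and \<open>\<delta>\<close>, its defect written out as a square.\<close>
    also have "\<dots> \<le> ((1 - \<delta>) * a + s)\<^sup>2 + (1 - \<delta>) / \<delta> * (\<delta> * a - s)\<^sup>2" using \<delta> by simp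
    also have "\<dots> = (1 - \<delta>) * a\<^sup>2 + 1 / \<delta> * s\<^sup>2"
    proof -
      \<comment> \<open>For \<open>r = 1 / \<delta>\<close> the last term vanishes; a free
        \<open>r\<close> keeps the identity polynomial.\<close>
      have id: "((1 - \<delta>) * a + s)\<^sup>2 + (r - 1) * (\<delta> * a - s)\<^sup>2 =
          (1 - \<delta>) * a\<^sup>2 + r * s\<^sup>2 + (\<delta> * r - 1) * (\<delta> * a\<^sup>2 - 2 * a * s)" for r
        by (simp add: power2_eq_square algebra_simps)
      have "(1 - \<delta>) / \<delta> = 1 / \<delta> - 1" using \<delta> by (simp add: diff_divide_distrib)
      then show ?thesis using id[of "1 / \<delta>"] \<delta> by simp
    qed
    also have "\<dots> = (1 - \<delta>) * (a\<^sup>2 + s\<^sup>2) + \<beta> * s\<^sup>2" by (simp add: \<beta>_def algebra_simps)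
    also have "\<beta> * s\<^sup>2 = (\<Sum>i<k. \<beta> * B x (y i) * B x (y i))"
    proof -
      have "s\<^sup>2 = (\<Sum>i<k. B x (y i) * B x (y i) / B (y i) (y i))" using as(2) proj(3) by simp
      then show ?thesis unfolding sum_distrib_left using y(3) by (simp add: sum_distrib_left mult.assoc)
    qed
    also have "a\<^sup>2 + s\<^sup>2 = B x x" using proj(2) as by simp
    finally show ?thesis by (simp add: B'_def)
  qed
  moreover have "card (B ` y ` {..<k}) \<le> K"
    using card_image_le[of "{..<k}" y] card_image_le[of "y ` {..<k}" B] k by simp
  moreover have "B' x x = (1 - \<delta>) * B x x" if "\<forall>l\<in>B ` y ` {..<k}. l x = 0" for x
    using that B.commute by (auto simp: B'_def)
  ultimately show ?thesis
    unfolding proportional_off_def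
    using B.linear by (intro exI[of _ B'] conjI exI[of _ "B ` y ` {..<k}"]) auto
qed

text \<open>Dual to the upper step: vectors are projected onto the orthogonal complement instead of
  being taken from it. Hence a contact point \<open>x i\<close> comes with a nearby vector
  \<open>h i\<close>, in the construction its projection, and only the \<open>h i\<close> are
  orthogonal. If no longer system exists, the projection of every vector of \<open>E\<close> is
  short compared with its norm, which leaves room to enlarge the form by \<open>1 + \<delta>\<close>
  on the complement.\<close>

lemma lower_form_step:
  fixes N :: "'v::real_vector \<Rightarrow> real"
  assumes "seminorm N" "symform B" and E: "subspace E"
    and NB: "\<And>x. x \<in> E \<Longrightarrow> 0 \<le> B x x \<and> B x x \<le> N x ^ 2" and \<delta>: "0 < \<delta>" "\<delta> < 1"
    and no: "\<nexists>x h. \<forall>i<K. x i \<in> E \<and> h i \<in> E \<and> N (x i) = 1 \<and> 1 - \<delta> \<le> B (h i) (h i) \<and>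
      B (x i - h i) (x i - h i) \<le> \<delta> \<and> (\<forall>j<K. i \<noteq> j \<longrightarrow> B (h i) (h j) = 0)"
  shows "\<exists>B'. symform B' \<and> (\<forall>x\<in>E. 0 \<le> B' x x \<and> B' x x \<le> N x ^ 2) \<and> proportional_off K (1 + \<delta>) B B'"
proof -
  interpret N: seminorm N by fact
  interpret B: symmetric_form B using assms by unfold_locales
  define P where "P k \<longleftrightarrow> (\<exists>x h. \<forall>i<k. x i \<in> E \<and> h i \<in> E \<and> N (x i) = 1 \<and> 1 - \<delta> \<le> B (h i) (h i) \<and>
      B (x i - h i) (x i - h i) \<le> \<delta> \<and> (\<forall>j<k. i \<noteq> j \<longrightarrow> B (h i) (h j) = 0))" for k :: nat
  have "\<not> P K" "P 0" using no by (auto simp: P_def)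
  then obtain k where k: "k < K" "P k" "\<not> P (Suc k)"
    using ex_least_nat_less[of "\<lambda>k. \<not> P k" K] by auto
  obtain u y where y: "\<And>i. i < k \<Longrightarrow> u i \<in> E \<and> y i \<in> E \<and> N (u i) = 1 \<and> 1 - \<delta> \<le> B (y i) (y i) \<and>
      B (u i - y i) (u i - y i) \<le> \<delta>"
    "\<And>i j. i < k \<Longrightarrow> j < k \<Longrightarrow> i \<noteq> j \<Longrightarrow> B (y i) (y j) = 0"
    using k(2) unfolding P_def by blast
  have nz: "i < k \<Longrightarrow> B (y i) (y i) \<noteq> 0" for i using y(1)[of i] \<delta> by auto
  define w where "w x = (\<Sum>i<k. (B x (y i) / B (y i) (y i)) *\<^sub>R y i)" for x
  have proj: "\<And>x j. j < k \<Longrightarrow> B (x - w x) (y j) = 0"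
    "\<And>x. B x x = B (x - w x) (x - w x) + B (w x) (w x)"
    "\<And>x. B (w x) (w x) = (\<Sum>i<k. B x (y i) * B x (y i) / B (y i) (y i))"
    by (rule B.orthogonal_projection[OF w_def y(2) nz]; assumption)+
  have w: "w x \<in> E" for x unfolding w_def using E y by (intro subspace_sum subspace_scale) auto
  have h: "x - w x \<in> E" if "x \<in> E" for x using E that w by (simp add: subspace_diff)
  have key: "B (x - w x) (x - w x) \<le> (1 - \<delta>) * N x ^ 2" if x: "x \<in> E" for x
  proof (rule ccontr)
    assume contr: "\<not> B (x - w x) (x - w x) \<le> (1 - \<delta>) * N x ^ 2"
    have pos: "N x > 0"
    proof (rule ccontr)
      assume "\<not> N x > 0"
      then have "N x = 0" using N.nonneg[of x] by linarith
      then show False using contr NB[OF x] NB[OF w[of x]] proj(2)[of x] by simp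
    qed
    define t where "t = inverse (N x)"
    have t: "t > 0" "N x = 1 / t" using pos by (auto simp: t_def inverse_eq_divide)
    define z where "z = t *\<^sub>R x"
    define g where "g = t *\<^sub>R (x - w x)"
    have zg: "z - g = t *\<^sub>R w x" by (simp add: z_def g_def algebra_simps)
    have Bg: "B g g = t\<^sup>2 * B (x - w x) (x - w x)"
      by (simp add: g_def B.scale_left B.scale_right power2_eq_square)
    have "N z = 1" using pos by (simp add: z_def t_def N.scale)
    moreover have g1: "1 - \<delta> \<le> B g g"
      using contr t unfolding Bg by (simp add: field_simps)
    moreover have "B (z - g) (z - g) \<le> \<delta>"
    proof -
      have "t\<^sup>2 * B x x = t\<^sup>2 * B (x - w x) (x - w x) + t\<^sup>2 * B (w x) (w x)"
        using proj(2)[of x] by (simp add: distrib_left)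
      then have "B (z - g) (z - g) = t\<^sup>2 * B x x - B g g"
        unfolding zg Bg by (simp add: B.scale_left B.scale_right power2_eq_square)
      also have "t\<^sup>2 * B x x \<le> 1"
        using NB[OF x] t by (simp add: field_simps)
      finally show ?thesis using g1 by simp
    qed
    moreover have "z \<in> E" "g \<in> E" unfolding z_def g_def using E x h by (simp_all add: subspace_scale)
    moreover have "B g (y i) = 0" "B (y i) g = 0" if "i < k" for i
      using proj(1)[OF that, of x] by (simp_all add: g_def B.scale_left B.scale_right B.commute[of "y i"])
    ultimately have "P (Suc k)"
      unfolding P_def using y by (intro exI[of _ "u(k := z)"] exI[of _ "y(k := g)"]) (auto simp: less_Suc_eq)
    then show False using k by blast
  qed
  \<comment> \<open>The form is multiplied by \<open>1 + \<delta>\<close> on the complement and by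
    \<open>\<delta>\<^sup>2\<close> on the span of the \<open>y i\<close>; the latter is what
    \<open>(1 + \<delta>) * (1 - \<delta>)\<close> leaves of 1.\<close>
  define B' where "B' u v = (1 + \<delta>) * B u v +
      (\<Sum>i<k. (- (1 + \<delta> - \<delta>\<^sup>2) / B (y i) (y i)) * B u (y i) * B v (y i))" for u v
  have "symform B'" unfolding B'_def using symform_combination[OF \<open>symform B\<close>] .
  moreover have "0 \<le> B' x x \<and> B' x x \<le> N x ^ 2" if x: "x \<in> E" for x
  proof -
    have "(\<Sum>i<k. (- (1 + \<delta> - \<delta>\<^sup>2) / B (y i) (y i)) * B x (y i) * B x (y i)) =
        - (1 + \<delta> - \<delta>\<^sup>2) * B (w x) (w x)"
      unfolding proj(3) sum_distrib_left by (intro sum.cong) (auto simp: divide_simps)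
    then have B': "B' x x = (1 + \<delta>) * B (x - w x) (x - w x) + \<delta>\<^sup>2 * B (w x) (w x)"
      unfolding B'_def proj(2)[of x] by (simp add: algebra_simps)
    have nn: "0 \<le> B (x - w x) (x - w x)" "0 \<le> B (w x) (w x)" using NB h[OF x] w by blast+
    then have "0 \<le> B' x x" unfolding B' using \<delta> by simp
    moreover have "B (w x) (w x) \<le> N x ^ 2" using nn proj(2)[of x] NB[OF x] by linarith
    then have "B' x x \<le> (1 + \<delta>) * ((1 - \<delta>) * N x ^ 2) + \<delta>\<^sup>2 * N x ^ 2"
      unfolding B' using key[OF x] \<delta> by (intro add_mono mult_left_mono) auto
    then have "B' x x \<le> N x ^ 2" by (simp add: algebra_simps power2_eq_square)
    ultimately show ?thesis by blast
  qed
  moreover have "card (B ` y ` {..<k}) \<le> K"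
    using card_image_le[of "{..<k}" y] card_image_le[of "y ` {..<k}" B] k by simp
  moreover have "B' x x = (1 + \<delta>) * B x x" if "\<forall>l\<in>B ` y ` {..<k}. l x = 0" for x
    using that B.commute by (auto simp: B'_def)
  ultimately show ?thesis
    unfolding proportional_off_def
    using B.linear by (intro exI[of _ B'] conjI exI[of _ "B ` y ` {..<k}"]) auto
qed

section \<open>Almost transitive norms\<close>

text \<open>\<open>N\<close> is the almost transitive norm and \<open>M\<close> the given one. The
  maps \<open>T\<close> need not be linear, as they are lifted from isometries to formal linear
  combinations; only the combinations of three images that occur in the increments are required to
  keep their norm.\<close>

locale almost_transitive_renorming =
  fixes N M :: "'v::real_vector \<Rightarrow> real" and p c C :: real
  assumes seminorms: "seminorm N" "seminorm M"
    and c: "0 < c" "\<And>x. c * M x \<le> N x"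
    and C: "0 < C" "\<And>x. N x \<le> C * M x"
    and p: "1 < p"
    and infinite_dimensional: "\<And>B. finite B \<Longrightarrow> \<exists>x. \<forall>y\<in>span B. M (x - y) \<noteq> 0"
    and additive: "lp_additive p M"
    and transitive: "\<And>x y \<epsilon>. N x = 1 \<Longrightarrow> N y = 1 \<Longrightarrow> 0 < \<epsilon> \<Longrightarrow>
      \<exists>T. N (T x - y) < \<epsilon> \<and> (\<forall>s u v w. N (s *\<^sub>R T u + T v - T w) = N (s *\<^sub>R u + v - w))"
begin

sublocale N: seminorm N by (rule seminorms)
sublocale M: seminorm M by (rule seminorms)

section \<open>Existence of almost contact points\<close>

lemma forms: "\<exists>D>0. \<forall>n. \<exists>E B. comparable_form N D n E B"
proof (intro exI[of _ "(2 * C)\<^sup>2 + (8 / c)\<^sup>2"] conjI allI)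
  show "0 < (2 * C)\<^sup>2 + (8 / c)\<^sup>2" using c C by (intro add_pos_pos) auto
  fix n
  obtain v :: "nat \<Rightarrow> 'v" where v: "\<And>i. M (v i) \<le> 2" "\<And>a k. k < n \<Longrightarrow> \<bar>a k\<bar> \<le> 8 * M (\<Sum>i<n. a i *\<^sub>R v i)"
    using M.uniform_coefficients[OF infinite_dimensional additive p, of n] by auto
  show "\<exists>E B. comparable_form N ((2 * C)\<^sup>2 + (8 / c)\<^sup>2) n E B"
    by (rule initial_form[OF seminorms c(1) C(1) c(2) C(2) v]) auto
qed

text \<open>Otherwise \<open>upper_form_step\<close> applies to every form above
  \<open>N x ^ 2\<close> on \<open>E\<close>. After \<open>L\<close> rounds at most
  \<open>L * K\<close>, hence fewer than \<open>n\<close>, linear conditions have been spent, so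
  some \<open>x\<close> with \<open>N x \<noteq> 0\<close> satisfies them all, and its form value
  has shrunk below \<open>N x ^ 2\<close>.\<close>

lemma upper_contact_points:
  assumes \<delta>: "0 < \<delta>" "\<delta> < 1"
  shows "\<exists>E B y. subspace E \<and> symform B \<and> (\<forall>x\<in>E. N x ^ 2 \<le> B x x) \<and>
    (\<forall>i<K::nat. y i \<in> E \<and> 1 - \<delta> \<le> N (y i) \<and> (\<forall>j<K. B (y i) (y j) = (if i = j then 1 else 0)))"
proof (rule ccontr)
  assume contr: "\<not> ?thesis"
  obtain D where D: "0 < D" "\<And>n. \<exists>E B. comparable_form N D n E B"
    using forms by auto
  obtain L where L: "(D * (L * K + 1))\<^sup>2 * (1 - \<delta>) ^ L < 1"
    using exists_geometric_gain[of "1 - \<delta>" D K] \<delta> D by auto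
  define n where "n = L * K + 1"
  obtain E B where "comparable_form N D n E B" using D(2) by blast
  then have E: "subspace E" and B: "symform B"
    and NB: "\<forall>x\<in>E. N x ^ 2 \<le> D * real n * B x x \<and> B x x \<le> D * n * N x ^ 2"
    and ker: "\<And>\<Lambda>. finite \<Lambda> \<Longrightarrow> card \<Lambda> < n \<Longrightarrow> (\<forall>l\<in>\<Lambda>. linear l) \<Longrightarrow> (\<exists>x\<in>E. N x \<noteq> 0 \<and> (\<forall>l\<in>\<Lambda>. l x = (0::real)))"
    unfolding comparable_form_def by auto
  define B0 where "B0 x y = D * n * B x y" for x y
  define I where "I B \<longleftrightarrow> symform B \<and> (\<forall>x\<in>E. N x ^ 2 \<le> B x x)" for B
  have "symform B0" using symform_combination[OF B, where \<alpha> = "D * n" and k = 0] by (simp add: B0_def[abs_def])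
  then have "I B0" using NB by (auto simp: I_def B0_def)
  moreover have "\<exists>B'. I B' \<and> proportional_off K (1 - \<delta>) B B'" if "I B" for B
  proof -
    have "\<nexists>y. \<forall>i<K. y i \<in> E \<and> 1 - \<delta> \<le> N (y i) \<and> (\<forall>j<K. B (y i) (y j) = (if i = j then 1 else 0))"
      using contr E that unfolding I_def by blast
    then show ?thesis
      using upper_form_step[OF seminorms(1) _ E _ \<delta>, of B K] that unfolding I_def by blast
  qed
  ultimately obtain B' where B': "I B'" "proportional_off (L * K) ((1 - \<delta>) ^ L) B0 B'"
    using iterate_forms[of I K "1 - \<delta>" B0 L] by blast
  then obtain \<Lambda> where \<Lambda>: "finite \<Lambda>" "card \<Lambda> \<le> L * K" "\<forall>l\<in>\<Lambda>. linear l"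
    "\<forall>x. (\<forall>l\<in>\<Lambda>. l x = (0::real)) \<longrightarrow> B' x x = (1 - \<delta>) ^ L * B0 x x"
    unfolding proportional_off_def by auto
  obtain x where x: "x \<in> E" "N x \<noteq> 0" "\<forall>l\<in>\<Lambda>. l x = 0" using ker[of \<Lambda>] \<Lambda> by (auto simp: n_def)
  have "N x ^ 2 \<le> B' x x" using B'(1) x by (auto simp: I_def)
  also have "\<dots> = (1 - \<delta>) ^ L * (D * n) * B x x" using \<Lambda>(4) x by (simp add: B0_def)
  also have "\<dots> \<le> (1 - \<delta>) ^ L * (D * n) * (D * n * N x ^ 2)"
    using NB x \<delta> D by (intro mult_left_mono) auto
  also have "\<dots> = ((D * n)\<^sup>2 * (1 - \<delta>) ^ L) * N x ^ 2" by (simp add: power2_eq_square mult_ac)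
  also have "\<dots> < 1 * N x ^ 2" using L x by (intro mult_strict_right_mono) (auto simp: n_def add.commute)
  finally show False by simp
qed

text \<open>The same argument with growth in place of decay: the initial form, divided by its
  comparison constant, lies below \<open>N x ^ 2\<close> and would be pushed above it.\<close>

lemma lower_contact_points:
  assumes \<delta>: "0 < \<delta>" "\<delta> < 1"
  shows "\<exists>E B x h. subspace E \<and> symform B \<and> (\<forall>x\<in>E. 0 \<le> B x x \<and> B x x \<le> N x ^ 2) \<and>
    (\<forall>i<K::nat. x i \<in> E \<and> h i \<in> E \<and> N (x i) = 1 \<and> 1 - \<delta> \<le> B (h i) (h i) \<and>
      B (x i - h i) (x i - h i) \<le> \<delta> \<and> (\<forall>j<K. i \<noteq> j \<longrightarrow> B (h i) (h j) = 0))"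
proof (rule ccontr)
  assume contr: "\<not> ?thesis"
  obtain D where D: "0 < D" "\<And>n. \<exists>E B. comparable_form N D n E B"
    using forms by auto
  obtain L where L: "(D * (L * K + 1))\<^sup>2 * (1 / (1 + \<delta>)) ^ L < 1"
    using exists_geometric_gain[of "1 / (1 + \<delta>)" D K] \<delta> D by auto
  define n where "n = L * K + 1"
  have n: "(D * n)\<^sup>2 < (1 + \<delta>) ^ L" "0 < D * n"
    using L \<delta> by (simp add: n_def add.commute power_divide field_simps) (simp add: n_def D(1) add_pos_nonneg)
  obtain E B where "comparable_form N D n E B" using D(2) by blast
  then have E: "subspace E" and B: "symform B"
    and NB: "\<forall>x\<in>E. N x ^ 2 \<le> D * real n * B x x \<and> B x x \<le> D * n * N x ^ 2"
    and ker: "\<And>\<Lambda>. finite \<Lambda> \<Longrightarrow> card \<Lambda> < n \<Longrightarrow> (\<forall>l\<in>\<Lambda>. linear l) \<Longrightarrow> (\<exists>x\<in>E. N x \<noteq> 0 \<and> (\<forall>l\<in>\<Lambda>. l x = (0::real)))"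
    unfolding comparable_form_def by auto
  have B_lower: "N x ^ 2 / (D * n) \<le> B x x" if "x \<in> E" for x
    using NB that n(2) by (auto simp: pos_divide_le_eq mult.commute)
  define B0 where "B0 x y = 1 / (D * n) * B x y" for x y
  define I where "I B \<longleftrightarrow> symform B \<and> (\<forall>x\<in>E. 0 \<le> B x x \<and> B x x \<le> N x ^ 2)" for B
  have "symform B0" using symform_combination[OF B, where \<alpha> = "1 / (D * n)" and k = 0] by (simp add: B0_def[abs_def])
  moreover have "0 \<le> B0 x x \<and> B0 x x \<le> N x ^ 2" if "x \<in> E" for x
  proof -
    have "0 \<le> B x x" using B_lower[OF that] n(2)
      by (meson divide_nonneg_pos order_trans zero_le_power2)
    then show ?thesis using NB that n(2) by (auto simp: B0_def pos_divide_le_eq mult.commute)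
  qed
  ultimately have "I B0" by (auto simp: I_def)
  moreover have "\<exists>B'. I B' \<and> proportional_off K (1 + \<delta>) B B'" if "I B" for B
  proof -
    have "\<nexists>x h. \<forall>i<K. x i \<in> E \<and> h i \<in> E \<and> N (x i) = 1 \<and> 1 - \<delta> \<le> B (h i) (h i) \<and>
      B (x i - h i) (x i - h i) \<le> \<delta> \<and> (\<forall>j<K. i \<noteq> j \<longrightarrow> B (h i) (h j) = 0)"
      using contr E that unfolding I_def by blast
    then show ?thesis
      using lower_form_step[OF seminorms(1) _ E _ \<delta>, of B K] that unfolding I_def by blast
  qed
  ultimately obtain B' where B': "I B'" "proportional_off (L * K) ((1 + \<delta>) ^ L) B0 B'"
    using iterate_forms[of I K "1 + \<delta>" B0 L] by blast
  then obtain \<Lambda> where \<Lambda>: "finite \<Lambda>" "card \<Lambda> \<le> L * K" "\<forall>l\<in>\<Lambda>. linear l"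
    "\<forall>x. (\<forall>l\<in>\<Lambda>. l x = (0::real)) \<longrightarrow> B' x x = (1 + \<delta>) ^ L * B0 x x"
    unfolding proportional_off_def by auto
  obtain x where x: "x \<in> E" "N x \<noteq> 0" "\<forall>l\<in>\<Lambda>. l x = 0" using ker[of \<Lambda>] \<Lambda> by (auto simp: n_def)
  have "a = d\<^sup>2 * (a / d / d)" if "0 < d" for a d :: real
    using that by (simp add: power2_eq_square)
  then have "N x ^ 2 = (D * n)\<^sup>2 * (N x ^ 2 / (D * n) / (D * n))" using n(2) by blast
  also have "\<dots> < (1 + \<delta>) ^ L * (N x ^ 2 / (D * n) / (D * n))"
    using n x by (intro mult_strict_right_mono) auto
  also have "\<dots> \<le> (1 + \<delta>) ^ L * (B x x / (D * n))"
    using B_lower[OF x(1)] n(2) \<delta> by (intro mult_left_mono divide_right_mono) auto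
  also have "\<dots> = B' x x" using \<Lambda>(4) x by (simp add: B0_def)
  also have "\<dots> \<le> N x ^ 2" using B'(1) x by (auto simp: I_def)
  finally show False by simp
qed

section \<open>Increments almost disjoint from a given vector\<close>

definition additive_pairs :: "real \<Rightarrow> 'v \<Rightarrow> nat \<Rightarrow> bool" where
  "additive_pairs \<epsilon> x K \<longleftrightarrow> (\<forall>e :: nat \<Rightarrow> 'v. (\<forall>i<K. N (e i) \<le> 1) \<longrightarrow>
     (\<exists>i j. i < j \<and> j < K \<and> almost_additive p M \<epsilon> x (e i - e j)))"

lemma additive_pairs:
  assumes "0 < \<epsilon>"
  shows "\<exists>K. additive_pairs \<epsilon> x K"
proof -
  have "\<exists>K. \<forall>e :: nat \<Rightarrow> 'v. (\<forall>i<K. M (e i) \<le> 1 / c) \<longrightarrow>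
       (\<exists>i j. i < j \<and> j < K \<and> (\<forall>x\<in>{x}. almost_additive p M \<epsilon> x (e i - e j)))"
    using additive[unfolded lp_additive_def, THEN spec[of _ "{x}"], THEN spec[of _ \<epsilon>],
      THEN spec[of _ "1 / c"]] assms by simp
  then obtain K where K: "\<And>e :: nat \<Rightarrow> 'v. (\<forall>i<K. M (e i) \<le> 1 / c) \<Longrightarrow>
       (\<exists>i j. i < j \<and> j < K \<and> almost_additive p M \<epsilon> x (e i - e j))"
    by auto
  have "M z \<le> 1 / c" if "N z \<le> 1" for z
    using c(1) c(2)[of z] that by (simp add: field_simps)
  then show ?thesis
    unfolding additive_pairs_def by (intro exI[of _ K] allI impI K) auto
qed

text \<open>Measured by \<open>B\<close>, a multiple \<open>t\<close> of one contact point plus the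
  difference of two others has squared length \<open>t\<^sup>2 + 2\<close>. The remaining 2 in the
  bound pays, one unit each, for \<open>t\<close> exceeding \<open>N x\<close> and for the inexact
  position of the moved point.\<close>

lemma upper_increment:
  assumes x: "0 < N x" and \<epsilon>': "0 < \<epsilon>'"
  shows "\<exists>y. 1 / 4 \<le> N y \<and> N (x + y) ^ 2 \<le> N x ^ 2 + 4 \<and>
    almost_additive p M \<epsilon>' x y"
proof -
  define s where "s = N x"
  have s: "0 < s" using x by (simp add: s_def)
  \<comment> \<open>The first bound makes the contact points at least 7 / 8 long, the second ensures
    \<open>s\<^sup>2 / (1 - \<delta>)\<^sup>2 \<le> s\<^sup>2 + 1\<close>.\<close>
  define \<delta> where "\<delta> = min (1 / 8) (1 / (4 * (s\<^sup>2 + 1)))"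
  have s1: "0 < s\<^sup>2 + 1" by (simp add: add_nonneg_pos)
  have \<delta>: "0 < \<delta>" "\<delta> \<le> 1 / 8" "\<delta> \<le> 1 / (4 * (s\<^sup>2 + 1))" unfolding \<delta>_def using s1 by auto
  then have \<delta>1: "\<delta> < 1" by simp
  have s\<delta>: "s\<^sup>2 / (1 - \<delta>)\<^sup>2 \<le> s\<^sup>2 + 1"
  proof -
    have "\<delta> * (s\<^sup>2 + 1) \<le> 1 / 4" using \<delta>(3) s1 by (simp add: field_simps)
    then have "4 * \<delta> * s\<^sup>2 \<le> 1" using \<delta>(1) by (simp add: algebra_simps)
    moreover have "1 \<le> (1 + 4 * \<delta>) * (1 - \<delta>)\<^sup>2"
    proof -
      have "0 \<le> \<delta> * (2 - 7 * \<delta> + 4 * \<delta>\<^sup>2)" using \<delta> by (intro mult_nonneg_nonneg) auto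
      then show ?thesis by (simp add: power2_eq_square algebra_simps)
    qed
    then have "s\<^sup>2 * 1 \<le> s\<^sup>2 * ((1 + 4 * \<delta>) * (1 - \<delta>)\<^sup>2)" by (intro mult_left_mono) auto
    then have "s\<^sup>2 / (1 - \<delta>)\<^sup>2 \<le> s\<^sup>2 * (1 + 4 * \<delta>)" using \<delta> by (simp add: field_simps)
    ultimately show ?thesis by (simp add: algebra_simps)
  qed
  \<comment> \<open>Chosen so that \<open>s * \<epsilon>\<close> is exactly the gap between the last
    two bounds on the norm.\<close>
  define \<epsilon> where "\<epsilon> = (sqrt (s\<^sup>2 + 4) - sqrt (s\<^sup>2 + 3)) / s"
  have \<epsilon>: "0 < \<epsilon>" unfolding \<epsilon>_def using s by simp
  obtain K where K: "additive_pairs \<epsilon>' x K" using additive_pairs[OF \<epsilon>'] by blast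
  \<comment> \<open>Index 0 is reserved for the point to be moved towards \<open>x\<close>; the
    other \<open>K\<close> points are for the choice of a pair.\<close>
  obtain E B y where E: "subspace E" and B: "symform B" and "\<forall>x\<in>E. N x ^ 2 \<le> B x x"
    and "\<forall>i<Suc K. y i \<in> E \<and> 1 - \<delta> \<le> N (y i) \<and> (\<forall>j<Suc K. B (y i) (y j) = (if i = j then 1 else 0))"
    using upper_contact_points[OF \<delta>(1) \<delta>1, of "Suc K"] by (elim exE conjE) (rule that; assumption)
  then have NB: "\<And>x. x \<in> E \<Longrightarrow> N x ^ 2 \<le> B x x"
    and y: "\<And>i. i < Suc K \<Longrightarrow> y i \<in> E" "\<And>i. i < Suc K \<Longrightarrow> 1 - \<delta> \<le> N (y i)"
      "\<And>i j. i < Suc K \<Longrightarrow> j < Suc K \<Longrightarrow> B (y i) (y j) = (if i = j then 1 else 0)"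
    by auto
  interpret B: symmetric_form B using B by unfold_locales
  have y1: "N (y i) \<le> 1" if "i < Suc K" for i
    using NB[OF y(1)[OF that]] y(3)[OF that that] by (simp add: power_le_one_iff)
  define r where "r = N (y 0)"
  have r: "1 - \<delta> \<le> r" "0 < r" using y(2)[of 0] \<delta> by (auto simp: r_def)
  obtain T where T: "N (T (inverse r *\<^sub>R y 0) - inverse s *\<^sub>R x) < \<epsilon>"
    "\<And>s u v w. N (s *\<^sub>R T u + T v - T w) = N (s *\<^sub>R u + v - w)"
    using transitive[of "inverse r *\<^sub>R y 0" "inverse s *\<^sub>R x" \<epsilon>] \<epsilon> r s x
    by (auto simp: N.scale r_def[symmetric] s_def[symmetric])
  define e where "e i = T (y (Suc i))" for i
  have "N (T u) = N u" for u
    using T(2)[of 1 u u u] by simp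
  then have "\<forall>i<K. N (e i) \<le> 1" using y1 by (simp add: e_def)
  then obtain i j where ij: "i < j" "j < K"
    "almost_additive p M \<epsilon>' x (e i - e j)"
    using K unfolding additive_pairs_def by blast
  define a b where "a = y (Suc i)" and "b = y (Suc j)"
  have ab: "a \<in> E" "b \<in> E" "B a a = 1" "B b b = 1" "B a b = 0" "B b a = 0" "7 / 8 \<le> N a"
    using y(1)[of "Suc i"] y(1)[of "Suc j"] y(2)[of "Suc i"] y(3)[of "Suc i" "Suc j"] y(3)[of "Suc j" "Suc i"]
      y(3)[of "Suc i" "Suc i"] y(3)[of "Suc j" "Suc j"] ij \<delta> by (auto simp: a_def b_def)
  have y0: "y 0 \<in> E" "B (y 0) (y 0) = 1" "B (y 0) a = 0" "B (y 0) b = 0" "B a (y 0) = 0" "B b (y 0) = 0"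
    using y(1)[of 0] y(3)[of 0 0] y(3)[of 0 "Suc i"] y(3)[of 0 "Suc j"] y(3)[of "Suc i" 0] y(3)[of "Suc j" 0] ij
    by (auto simp: a_def b_def)
  have "N (e i - e j) = N (a - b)" using T(2)[of 0 _ "y (Suc i)" "y (Suc j)"] by (simp add: e_def a_def b_def)
  moreover have "1 / 4 \<le> N (a - b)"
  \<comment> \<open>The form bounds \<open>N\<close> only from above. So \<open>a - b\<close> is
    shown to be long because \<open>a + b\<close> is short and their sum is
    \<open>2 *\<^sub>R a\<close>.\<close>
  proof -
    have "N (a + b) ^ 2 \<le> B (a + b) (a + b)" using NB ab E by (simp add: subspace_add)
    also have "\<dots> = 2" using ab by (simp add: B.bilinear_simps)
    also have "\<dots> \<le> (3 / 2)\<^sup>2" by (simp add: power2_eq_square)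
    finally have "N (a + b) \<le> 3 / 2" by (rule power2_le_imp_le) simp
    moreover have "N (2 *\<^sub>R a) \<le> N (a + b) + N (a - b)"
      using N.add_le[of "a + b" "a - b"] by (simp add: scaleR_2)
    ultimately show ?thesis using ab(7) by (simp add: N.scale)
  qed
  moreover have "N (x + (e i - e j)) ^ 2 \<le> N x ^ 2 + 4"
  proof -
    define t where "t = s / r"
    have "N (t *\<^sub>R y 0 + a - b) ^ 2 \<le> B (t *\<^sub>R y 0 + a - b) (t *\<^sub>R y 0 + a - b)"
      using NB ab y0 E by (simp add: subspace_add subspace_diff subspace_scale)
    also have "\<dots> = t\<^sup>2 + 2" using ab y0 by (simp add: B.bilinear_simps power2_eq_square)
    also have "t\<^sup>2 \<le> s\<^sup>2 / (1 - \<delta>)\<^sup>2"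
      unfolding t_def power_divide using r \<delta> by (intro divide_left_mono power_mono) auto
    finally have "N (t *\<^sub>R y 0 + a - b) ^ 2 \<le> s\<^sup>2 + 3" using s\<delta> by simp
    then have 1: "N (t *\<^sub>R y 0 + a - b) \<le> sqrt (s\<^sup>2 + 3)" by (rule real_le_rsqrt)
    have "N (s *\<^sub>R T (inverse r *\<^sub>R y 0) + T (y (Suc i)) - T (y (Suc j))) = N (t *\<^sub>R y 0 + a - b)"
      unfolding T(2) by (simp add: t_def a_def b_def divide_inverse)
    moreover have "x + (e i - e j) = (s *\<^sub>R T (inverse r *\<^sub>R y 0) + T (y (Suc i)) - T (y (Suc j)))
        - s *\<^sub>R (T (inverse r *\<^sub>R y 0) - inverse s *\<^sub>R x)"
      using s by (simp add: e_def algebra_simps)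
    ultimately have "N (x + (e i - e j)) \<le> N (t *\<^sub>R y 0 + a - b) + s * N (T (inverse r *\<^sub>R y 0) - inverse s *\<^sub>R x)"
      using N.diff_le N.scale s by (smt (verit, best))
    also have "\<dots> \<le> sqrt (s\<^sup>2 + 3) + s * \<epsilon>" using 1 T(1) s by (intro add_mono mult_left_mono) auto
    also have "\<dots> = sqrt (s\<^sup>2 + 4)" unfolding \<epsilon>_def using s by simp
    finally have "N (x + (e i - e j)) ^ 2 \<le> (sqrt (s\<^sup>2 + 4))\<^sup>2" by (intro power_mono) auto
    then show ?thesis by (simp add: s_def)
  qed
  ultimately show ?thesis using ij(3) by (intro exI[of _ "e i - e j"]) simp
qed

text \<open>The contact points are not orthogonal, so they are compared with the orthogonal vectors
  \<open>h\<close>: \<open>u\<close> combines the former, \<open>f\<close> the latter. From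
  \<open>s\<^sup>2 + 2\<close>, the value for exact orthonormality, the bound drops to
  \<open>s\<^sup>2 + 3 / 2\<close> for \<open>B u u\<close> and to \<open>s\<^sup>2 + 1\<close>
  after the isometry.\<close>

lemma lower_increment:
  assumes x: "0 < N x" and \<epsilon>': "0 < \<epsilon>'"
  shows "\<exists>y. N y \<le> 2 \<and> N x ^ 2 + 1 \<le> N (x + y) ^ 2 \<and>
    almost_additive p M \<epsilon>' x y"
proof -
  define s where "s = N x"
  have s: "0 < s" using x by (simp add: s_def)
  define w where "w = s\<^sup>2 + 2"
  have s1: "2 \<le> w" by (simp add: w_def)
  \<comment> \<open>Makes the total loss \<open>5 * (\<tau> * (s\<^sup>2 + 2))\<close> in
    \<open>B u u\<close> equal to 1 / 2.\<close>
  define \<tau> where "\<tau> = 1 / (10 * w)"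
  have \<tau>: "0 < \<tau>" "\<tau> \<le> 1 / 20" "\<tau> * (s\<^sup>2 + 2) = 1 / 10"
    unfolding \<tau>_def w_def[symmetric] using s1 by (auto simp: field_simps)
  \<comment> \<open>The square compensates the division by \<open>\<tau>\<close> in the estimate of
    the cross term.\<close>
  define \<delta> where "\<delta> = \<tau>\<^sup>2"
  have \<delta>: "0 < \<delta>" "\<delta> \<le> \<tau>" "\<delta> < 1"
    using \<tau>(1,2) power_decreasing[of 1 2 \<tau>] by (simp_all add: \<delta>_def)
  define \<epsilon> where "\<epsilon> = (sqrt (s\<^sup>2 + 3 / 2) - sqrt (s\<^sup>2 + 1)) / s"
  have \<epsilon>: "0 < \<epsilon>" unfolding \<epsilon>_def using s by simp
  obtain K where K: "additive_pairs \<epsilon>' x K" using additive_pairs[OF \<epsilon>'] by blast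
  obtain E B z h where E: "subspace E" and B: "symform B" and "\<forall>x\<in>E. 0 \<le> B x x \<and> B x x \<le> N x ^ 2"
    and "\<forall>i<Suc K. z i \<in> E \<and> h i \<in> E \<and> N (z i) = 1 \<and> 1 - \<delta> \<le> B (h i) (h i) \<and>
      B (z i - h i) (z i - h i) \<le> \<delta> \<and> (\<forall>j<Suc K. i \<noteq> j \<longrightarrow> B (h i) (h j) = 0)"
    using lower_contact_points[OF \<delta>(1,3), of "Suc K"] by (elim exE conjE) (rule that; assumption)
  then have NB: "\<And>x. x \<in> E \<Longrightarrow> 0 \<le> B x x" "\<And>x. x \<in> E \<Longrightarrow> B x x \<le> N x ^ 2"
    and zh: "\<And>i. i < Suc K \<Longrightarrow> z i \<in> E" "\<And>i. i < Suc K \<Longrightarrow> h i \<in> E" "\<And>i. i < Suc K \<Longrightarrow> N (z i) = 1"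
      "\<And>i. i < Suc K \<Longrightarrow> 1 - \<delta> \<le> B (h i) (h i)" "\<And>i. i < Suc K \<Longrightarrow> B (z i - h i) (z i - h i) \<le> \<delta>"
      "\<And>i j. i < Suc K \<Longrightarrow> j < Suc K \<Longrightarrow> i \<noteq> j \<Longrightarrow> B (h i) (h j) = 0"
    by auto
  interpret B: symmetric_form B using B by unfold_locales
  obtain T where T: "N (T (z 0) - inverse s *\<^sub>R x) < \<epsilon>"
    "\<And>s u v w. N (s *\<^sub>R T u + T v - T w) = N (s *\<^sub>R u + v - w)"
    using transitive[of "z 0" "inverse s *\<^sub>R x" \<epsilon>] \<epsilon> zh(3)[of 0] s x
    by (auto simp: N.scale s_def[symmetric])
  define e where "e i = T (z (Suc i))" for i
  have "N (T u) = N u" for u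
    using T(2)[of 1 u u u] by simp
  then have e1: "\<forall>i<K. N (e i) = 1" using zh(3) by (simp add: e_def)
  then obtain i j where ij: "i < j" "j < K"
    "almost_additive p M \<epsilon>' x (e i - e j)"
    using K unfolding additive_pairs_def by (metis order_refl)
  define i' j' where "i' = Suc i" and "j' = Suc j"
  have ij': "i' < Suc K" "j' < Suc K" "0 < Suc K" "i' \<noteq> j'" "0 \<noteq> i'" "0 \<noteq> j'" "i' \<noteq> 0" "j' \<noteq> 0" "j' \<noteq> i'"
    using ij by (auto simp: i'_def j'_def)
  define u where "u = s *\<^sub>R z 0 + z i' - z j'"
  define f where "f = s *\<^sub>R h 0 + h i' - h j'"
  have E1: "z k - h k \<in> E" if "k < Suc K" for k using zh that E by (simp add: subspace_diff)
  have uf: "u \<in> E" "f \<in> E" unfolding u_def f_def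
    using zh ij' E by (auto intro!: subspace_add subspace_diff subspace_scale)
  have "B f f = s\<^sup>2 * B (h 0) (h 0) + B (h i') (h i') + B (h j') (h j')"
    unfolding f_def using zh(6) ij' by (simp add: B.bilinear_simps power2_eq_square)
  also have "\<dots> \<ge> s\<^sup>2 * (1 - \<delta>) + (1 - \<delta>) + (1 - \<delta>)"
    using zh(4) ij' by (intro add_mono mult_left_mono) auto
  finally have Bf: "(1 - \<delta>) * (s\<^sup>2 + 2) \<le> B f f" by (simp add: algebra_simps)
  have Bg: "B (u - f) (u - f) \<le> 3 * \<delta> * (s\<^sup>2 + 2)"
  proof -
    define g0 g1 g2 where "g0 = s *\<^sub>R (z 0 - h 0)" and "g1 = z i' - h i'" and "g2 = h j' - z j'"
    have g: "g0 \<in> E" "g1 \<in> E" "g2 \<in> E" "u - f = g0 + g1 + g2"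
      using E1 zh ij' E
      by (simp_all add: g0_def g1_def g2_def subspace_diff subspace_scale)
        (simp add: u_def f_def scaleR_diff_right)
    have "B g0 g0 = s\<^sup>2 * B (z 0 - h 0) (z 0 - h 0)"
      unfolding g0_def B.scale_left B.scale_right by (simp add: power2_eq_square)
    moreover have "B g1 g1 = B (z i' - h i') (z i' - h i')"
      "B g2 g2 = B (z j' - h j') (z j' - h j')"
      by (simp_all add: g1_def g2_def B.diff_left B.diff_right)
    ultimately have gb: "B g0 g0 \<le> s\<^sup>2 * \<delta>" "B g1 g1 \<le> \<delta>" "B g2 g2 \<le> \<delta>"
      using zh(5) ij' by (auto intro: mult_left_mono)
    \<comment> \<open>Added up, these say that the form value of a sum of three vectors is at most
      three times the sum of their values.\<close>
    have "0 \<le> B (g0 - g1) (g0 - g1)" "0 \<le> B (g1 - g2) (g1 - g2)" "0 \<le> B (g0 - g2) (g0 - g2)"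
      using NB(1) g E by (simp_all add: subspace_diff)
    then have "B (u - f) (u - f) \<le> 3 * (B g0 g0 + B g1 g1 + B g2 g2)"
      unfolding g(4) by (simp add: B.bilinear_simps B.commute[of g1 g0] B.commute[of g2 g0] B.commute[of g2 g1])
    then show ?thesis using gb by (simp add: algebra_simps)
  qed
  have Bu: "s\<^sup>2 + 3 / 2 \<le> B u u"
  proof -
    define g where "g = u - f"
    have g: "u = f + g" "g \<in> E" using uf E by (auto simp: g_def subspace_diff)
    \<comment> \<open>Positivity at this vector is the weighted inequality that bounds the cross
      term \<open>2 * B f g\<close> from below.\<close>
    have "0 \<le> B (\<tau> *\<^sub>R f + g) (\<tau> *\<^sub>R f + g)" using NB(1) g uf E by (simp add: subspace_add subspace_scale)
    also have "\<dots> = \<tau> * (\<tau> * B f f + 2 * B f g) + B g g"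
      by (simp add: B.bilinear_simps B.commute[of g f] algebra_simps)
    finally have "0 \<le> (\<tau> * (\<tau> * B f f + 2 * B f g) + B g g) / \<tau>" using \<tau>(1) by (rule divide_nonneg_pos)
    also have "\<dots> = \<tau> * B f f + 2 * B f g + B g g / \<tau>" using \<tau>(1) by (simp add: add_divide_distrib)
    finally have "(1 - \<tau>) * B f f - B g g / \<tau> \<le> B u u"
      using NB(1)[OF g(2)] by (simp add: g(1) B.bilinear_simps B.commute[of g f] algebra_simps)
    moreover have "B g g / \<tau> \<le> 3 * \<tau> * (s\<^sup>2 + 2)"
      using Bg \<tau>(1) unfolding g_def[symmetric] \<delta>_def by (simp add: pos_divide_le_eq power2_eq_square mult_ac)
    moreover have "(1 - 2 * \<tau>) * (s\<^sup>2 + 2) \<le> (1 - \<tau>) * B f f"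
    proof -
      have "0 \<le> \<tau> - \<delta> + \<tau> * \<delta>" using \<delta> \<tau> by simp
      then have "1 - 2 * \<tau> \<le> (1 - \<tau>) * (1 - \<delta>)" by (simp add: algebra_simps)
      then have "(1 - 2 * \<tau>) * (s\<^sup>2 + 2) \<le> (1 - \<tau>) * (1 - \<delta>) * (s\<^sup>2 + 2)"
        using s1 by (intro mult_right_mono) (auto simp: w_def)
      also have "\<dots> \<le> (1 - \<tau>) * B f f" unfolding mult.assoc using Bf \<tau> by (intro mult_left_mono) auto
      finally show ?thesis .
    qed
    ultimately have "(s\<^sup>2 + 2) - 5 * (\<tau> * (s\<^sup>2 + 2)) \<le> B u u" by (simp add: algebra_simps)
    then show ?thesis using \<tau>(3) by simp
  qed
  have "N x ^ 2 + 1 \<le> N (x + (e i - e j)) ^ 2"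
  proof -
    have 1: "sqrt (s\<^sup>2 + 3 / 2) \<le> N u"
      using Bu NB(2)[OF uf(1)] by (intro real_le_lsqrt) auto
    have "N (s *\<^sub>R T (z 0) + T (z i') - T (z j')) = N u"
      unfolding T(2) u_def ..
    moreover have "s *\<^sub>R T (z 0) + T (z i') - T (z j') = (x + (e i - e j))
        + s *\<^sub>R (T (z 0) - inverse s *\<^sub>R x)"
      using s by (simp add: e_def i'_def j'_def algebra_simps)
    ultimately have "N u \<le> N (x + (e i - e j)) + s * N (T (z 0) - inverse s *\<^sub>R x)"
      using N.add_le N.scale s by (smt (verit, best))
    also have "\<dots> \<le> N (x + (e i - e j)) + s * \<epsilon>" using T(1) s by (intro add_mono mult_left_mono) auto
    also have "\<dots> = N (x + (e i - e j)) + sqrt (s\<^sup>2 + 3 / 2) - sqrt (s\<^sup>2 + 1)" unfolding \<epsilon>_def using s by simp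
    finally have "sqrt (s\<^sup>2 + 1) \<le> N (x + (e i - e j))" using 1 by simp
    then have "(sqrt (s\<^sup>2 + 1))\<^sup>2 \<le> N (x + (e i - e j)) ^ 2" by (intro power_mono) auto
    then show ?thesis by (simp add: s_def)
  qed
  moreover have "N (e i - e j) \<le> 2" using N.diff_le[of "e i" "e j"] e1 ij by simp
  ultimately show ?thesis using ij(3) by (intro exI[of _ "e i - e j"]) simp
qed

section \<open>Contradictory growth rates of the two norms\<close>

lemma unit_vector: "\<exists>x. N x = 1"
proof -
  obtain x where "M x \<noteq> 0" using infinite_dimensional[of "{}"] by auto
  then have "0 < M x" using M.nonneg[of x] by linarith
  then have "0 < c * M x" using c(1) by simp
  then have "0 < N x" using c(2)[of x] by simp
  then show ?thesis by (intro exI[of _ "inverse (N x) *\<^sub>R x"]) (simp add: N.scale)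
qed

lemma not_less_2: "\<not> p < 2"
proof
  assume p2: "p < 2"
  \<comment> \<open>\<open>1 / 4 \<le> N y\<close> gives \<open>2 * c' \<le> M y powr p\<close>;
    half of this pays for the error in the additivity.\<close>
  define c' where "c' = (1 / (4 * C)) powr p / 2"
  have c': "0 < c'" unfolding c'_def using C by simp
  have "\<exists>x. 0 < N x \<and> N x ^ 2 \<le> 4 * real n + 1 \<and> c' * n \<le> M x powr p" for n
  proof (induction n)
    case 0
    obtain x where "N x = 1" using unit_vector by blast
    then show ?case by (intro exI[of _ x]) simp
  next
    case (Suc n)
    then obtain x where x: "0 < N x" "N x ^ 2 \<le> 4 * real n + 1" "c' * n \<le> M x powr p" by blast
    obtain y where y: "1 / 4 \<le> N y" "N (x + y) ^ 2 \<le> N x ^ 2 + 4"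
      "almost_additive p M c' x y"
      using upper_increment[OF x(1) c'] by blast
    have "1 / (4 * C) \<le> M y" using y(1) C(1) C(2)[of y] by (simp add: field_simps)
    then have "2 * c' \<le> M y powr p" unfolding c'_def using p C by (simp add: powr_mono2)
    then have M: "c' * Suc n \<le> M (x + y) powr p" using x(3) y(3) by (simp add: algebra_simps)
    \<comment> \<open>The increment bounds \<open>N (x + y)\<close> only from above, so its
      positivity is recovered from the growth of \<open>M\<close>.\<close>
    then have "0 < M (x + y) powr p" using c' by (intro less_le_trans[OF _ M]) simp
    then have "0 < M (x + y)" using M.nonneg[of "x + y"] p by (cases "M (x + y) = 0") (simp, linarith)
    then have "0 < N (x + y)" using c(2)[of "x + y"] mult_pos_pos[OF c(1)] by (meson less_le_trans)
    then show ?case using x y M by (intro exI[of _ "x + y"]) auto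
  qed
  then have bound: "c' * c powr p * n \<le> (4 * real n + 1) powr (p / 2)" for n
  proof -
    obtain x where x: "0 < N x" "N x ^ 2 \<le> 4 * real n + 1" "c' * n \<le> M x powr p"
      using \<open>\<And>n. \<exists>x. _ n x\<close> by blast
    have "c' * c powr p * n \<le> c powr p * M x powr p" using x(3) c(1) by (simp add: mult_ac)
    also have "\<dots> = (c * M x) powr p" using c(1) by (simp add: powr_mult)
    also have "\<dots> \<le> N x powr p" using c p by (intro powr_mono2) auto
    also have "\<dots> = (N x ^ 2) powr (p / 2)" using x(1) by (simp add: powr_powr flip: powr_numeral)
    also have "\<dots> \<le> (4 * real n + 1) powr (p / 2)" using x p by (intro powr_mono2) auto
    finally show ?thesis .
  qed
  define a where "a = c' * c powr p"
  define q where "q = p / 2"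
  have "0 < a" "0 < q" "q < 1" using c' c p p2 by (auto simp: a_def q_def)
  then have "eventually (\<lambda>n. (4 * real n + 1) powr q < a * n) sequentially" by real_asymp
  then obtain n where "(4 * real n + 1) powr q < a * n" by (meson eventually_sequentially order_refl)
  then show False using bound[of n] by (simp add: a_def q_def)
qed

lemma not_greater_2: "\<not> 2 < p"
proof
  assume p2: "2 < p"
  \<comment> \<open>The summands cover the growth of \<open>M\<close> in one step, the error in the
    additivity, and the starting vector.\<close>
  define C' where "C' = (2 / c) powr p + 1 + (1 / c) powr p"
  have "\<exists>x. 0 < N x \<and> real n \<le> N x ^ 2 \<and> M x powr p \<le> C' * (n + 1)" for n
  proof (induction n)
    case 0
    obtain x where x: "N x = 1" using unit_vector by blast
    have "M x \<le> 1 / c" using c(1) c(2)[of x] x by (simp add: field_simps)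
    then have "M x powr p \<le> (1 / c) powr p" using p by (intro powr_mono2) auto
    also have "\<dots> \<le> C'" by (simp add: C'_def)
    finally show ?case using x by (intro exI[of _ x]) simp
  next
    case (Suc n)
    then obtain x where x: "0 < N x" "real n \<le> N x ^ 2" "M x powr p \<le> C' * (n + 1)" by blast
    obtain y where y: "N y \<le> 2" "N x ^ 2 + 1 \<le> N (x + y) ^ 2"
      "almost_additive p M 1 x y"
      using lower_increment[OF x(1), of 1] by auto
    have "M y \<le> 2 / c" using y(1) c(1) c(2)[of y] by (simp add: field_simps)
    then have "M y powr p \<le> (2 / c) powr p" using p by (intro powr_mono2) auto
    also have "\<dots> + 1 \<le> C'" by (simp add: C'_def)
    finally have "M (x + y) powr p \<le> C' * (Suc n + 1)" using x(3) y(3) by (simp add: algebra_simps)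
    moreover have "0 < N (x + y) ^ 2" using y(2) x(1) by (smt (verit) zero_le_power2)
    then have "0 < N (x + y)" using N.nonneg[of "x + y"] by (cases "N (x + y) = 0") (simp, linarith)
    ultimately show ?case using x y by (intro exI[of _ "x + y"]) auto
  qed
  then have bound: "real n powr (p / 2) \<le> C powr p * C' * (n + 1)" for n
  proof -
    obtain x where x: "0 < N x" "real n \<le> N x ^ 2" "M x powr p \<le> C' * (n + 1)"
      using \<open>\<And>n. \<exists>x. _ n x\<close> by blast
    have "real n powr (p / 2) \<le> (N x ^ 2) powr (p / 2)" using x p by (intro powr_mono2) auto
    also have "\<dots> = N x powr p" using x(1) by (simp add: powr_powr flip: powr_numeral)
    also have "\<dots> \<le> (C * M x) powr p" using C(2)[of x] p by (intro powr_mono2) auto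
    also have "\<dots> = C powr p * M x powr p" using C(1) by (simp add: powr_mult)
    also have "\<dots> \<le> C powr p * (C' * (n + 1))" using x(3) C(1) by (intro mult_left_mono) auto
    finally show ?thesis by (simp add: mult_ac)
  qed
  define a where "a = C powr p * C'"
  define q where "q = p / 2"
  have "0 < C'" unfolding C'_def by (intro add_pos_nonneg add_nonneg_pos) auto
  then have "0 < a" "1 < q" using C p2 by (auto simp: a_def q_def)
  then have "eventually (\<lambda>n. a * (real n + 1) < real n powr q) sequentially" by real_asymp
  then obtain n where "a * (real n + 1) < real n powr q" by (meson eventually_sequentially order_refl)
  then show False using bound[of n] by (simp add: a_def q_def add.commute)
qed

theorem exponent_eq_2: "p = 2"
  using not_less_2 not_greater_2 by linarith

end

section \<open>Additivity in sums of type \<open>\<ell>\<^sub>p\<close>\<close>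

text \<open>If \<open>a \<le> t * b\<close> with \<open>t\<close> small, continuity of the power at
  1 and homogeneity give \<open>\<epsilon> * b powr p\<close>; otherwise \<open>b\<close> and
  \<open>c\<close> are both at most a constant times \<open>a\<close>.\<close>

lemma powr_perturbation:
  fixes p \<epsilon> :: real
  assumes p: "0 < p" and \<epsilon>: "0 < \<epsilon>"
  shows "\<exists>K\<ge>0. \<forall>a b c. 0 \<le> a \<longrightarrow> 0 \<le> b \<longrightarrow> 0 \<le> c \<longrightarrow> \<bar>c - b\<bar> \<le> a \<longrightarrow>
    \<bar>c powr p - b powr p\<bar> \<le> \<epsilon> * b powr p + K * a powr p"
proof -
  have "((\<lambda>t. (1 + t) powr p) \<longlongrightarrow> (1 + 0) powr p) (at_right 0)"
    "((\<lambda>t. (1 - t) powr p) \<longlongrightarrow> (1 - 0) powr p) (at_right (0::real))"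
    by (intro tendsto_intros; simp)+
  then have "eventually (\<lambda>t. (1 + t) powr p < 1 + \<epsilon>) (at_right (0::real))"
    "eventually (\<lambda>t. 1 - \<epsilon> < (1 - t) powr p) (at_right (0::real))"
    using \<epsilon> by (auto elim!: order_tendstoD)
  moreover have "eventually (\<lambda>t. t \<in> {0<..<1}) (at_right (0::real))"
    by (rule eventually_at_right_real) simp
  ultimately have "eventually (\<lambda>t. (1 + t) powr p < 1 + \<epsilon> \<and> 1 - \<epsilon> < (1 - t) powr p \<and> t \<in> {0<..<1}) (at_right (0::real))"
    by eventually_elim simp
  then obtain t where t: "(1 + t) powr p < 1 + \<epsilon>" "1 - \<epsilon> < (1 - t) powr p" "0 < t" "t < 1"
    by (metis (no_types, lifting) eventually_happens greaterThanLessThan_iff trivial_limit_at_right_real)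
  define K where "K = (1 / t + 1) powr p"
  have "\<bar>c powr p - b powr p\<bar> \<le> \<epsilon> * b powr p + K * a powr p"
    if a: "0 \<le> a" and b: "0 \<le> b" and c: "0 \<le> c" and le: "\<bar>c - b\<bar> \<le> a" for a b c
  proof (cases "a \<le> t * b")
    case True
    have "c powr p \<le> ((1 + t) * b) powr p" using True le c p by (intro powr_mono2) (auto simp: algebra_simps)
    also have "\<dots> = (1 + t) powr p * b powr p" using t b by (simp add: powr_mult)
    also have "\<dots> \<le> (1 + \<epsilon>) * b powr p" using t by (intro mult_right_mono) auto
    finally have 1: "c powr p \<le> (1 + \<epsilon>) * b powr p" .
    have "(1 - \<epsilon>) * b powr p \<le> (1 - t) powr p * b powr p" using t by (intro mult_right_mono) auto
    also have "\<dots> = ((1 - t) * b) powr p" using t b by (simp add: powr_mult)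
    also have "\<dots> \<le> c powr p"
    proof (intro powr_mono2)
      have "t * b \<le> b" using t b by (simp add: mult_left_le_one_le)
      then show "0 \<le> (1 - t) * b" by (simp add: algebra_simps)
      show "(1 - t) * b \<le> c" using True le by (simp add: algebra_simps)
    qed (use p in simp)
    finally have "(1 - \<epsilon>) * b powr p \<le> c powr p" .
    moreover have "0 \<le> K * a powr p" by (simp add: K_def)
    ultimately show ?thesis using 1 by (simp add: algebra_simps abs_le_iff)
  next
    case False
    have "b \<le> 1 / t * a" using False t by (simp add: field_simps)
    then have "c \<le> (1 / t + 1) * a" "b \<le> (1 / t + 1) * a" using le a by (auto simp: algebra_simps)
    then have "c powr p \<le> ((1 / t + 1) * a) powr p" "b powr p \<le> ((1 / t + 1) * a) powr p"
      using b c p by (auto intro: powr_mono2)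
    moreover have "((1 / t + 1) * a) powr p = K * a powr p" using t a by (simp add: K_def powr_mult)
    moreover have "0 \<le> c powr p" "0 \<le> b powr p" "0 \<le> \<epsilon> * b powr p" using \<epsilon> by auto
    ultimately show ?thesis by linarith
  qed
  then show ?thesis by (intro exI[of _ K]) (auto simp: K_def)
qed

text \<open>What the triangle inequality gives when \<open>a n\<close>, \<open>b n\<close>,
  \<open>c n\<close> are the norms of the n-th coordinates of two vectors and of their sum. The next
  lemma thereby applies to coordinates in any space.\<close>

abbreviation triangle_bounds :: "(nat \<Rightarrow> real) \<Rightarrow> (nat \<Rightarrow> real) \<Rightarrow> (nat \<Rightarrow> real) \<Rightarrow> bool" where
  "triangle_bounds a b c \<equiv> \<forall>n. 0 \<le> b n \<and> 0 \<le> c n \<and> \<bar>c n - b n\<bar> \<le> a n \<and> \<bar>c n - a n\<bar> \<le> b n"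

text \<open>A quantitative Brezis-Lieb lemma, with \<open>m\<close> and \<open>\<eta>\<close>
  independent of \<open>b\<close> and \<open>c\<close>. Beyond \<open>m\<close> the sequence
  \<open>a\<close> has a small p-sum and is treated as a perturbation of \<open>b\<close>; before
  \<open>m\<close> the entries of \<open>b\<close> are small and are treated as perturbations of
  \<open>a\<close>.\<close>

lemma brezis_lieb:
  fixes a :: "nat \<Rightarrow> real"
  assumes p: "0 < p" and \<epsilon>: "0 < \<epsilon>" and a: "\<And>n. 0 \<le> a n" "summable (\<lambda>n. a n powr p)"
  shows "\<exists>m \<eta>. 0 < \<eta> \<and> (\<forall>b c. triangle_bounds a b c \<longrightarrow>
     summable (\<lambda>n. b n powr p) \<longrightarrow> (\<Sum>n. b n powr p) \<le> R \<longrightarrow> (\<forall>n<m. b n \<le> \<eta>) \<longrightarrow>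
     \<bar>(\<Sum>n. c n powr p) - (\<Sum>n. a n powr p) - (\<Sum>n. b n powr p)\<bar> \<le> \<epsilon>)"
proof -
  define S where "S = (\<Sum>n. a n powr p)"
  have S: "0 \<le> S" unfolding S_def using a by (intro suminf_nonneg) auto
  \<comment> \<open>Four errors of size at most \<open>\<epsilon> / 4\<close> will arise. The
    summands 1 keep the denominators positive, and \<open>R\<close> may be negative.\<close>
  define \<epsilon>1 where "\<epsilon>1 = \<epsilon> / (4 * (\<bar>R\<bar> + 1))"
  define \<epsilon>2 where "\<epsilon>2 = \<epsilon> / (4 * (S + 1))"
  have e12: "0 < \<epsilon>1" "0 < \<epsilon>2" "\<epsilon>1 * (\<bar>R\<bar> + 1) = \<epsilon> / 4" "\<epsilon>2 * (S + 1) = \<epsilon> / 4"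
    using \<epsilon> S by (auto simp: \<epsilon>1_def \<epsilon>2_def field_simps add_nonneg_pos)
  obtain K1 where K1: "K1 \<ge> 0" "\<And>a b c. 0 \<le> a \<Longrightarrow> 0 \<le> b \<Longrightarrow> 0 \<le> c \<Longrightarrow> \<bar>c - b\<bar> \<le> a \<Longrightarrow>
    \<bar>c powr p - b powr p\<bar> \<le> \<epsilon>1 * b powr p + K1 * a powr p"
    using powr_perturbation[OF p e12(1)] by metis
  obtain K2 where K2: "K2 \<ge> 0" "\<And>a b c. 0 \<le> a \<Longrightarrow> 0 \<le> b \<Longrightarrow> 0 \<le> c \<Longrightarrow> \<bar>c - b\<bar> \<le> a \<Longrightarrow>
    \<bar>c powr p - b powr p\<bar> \<le> \<epsilon>2 * b powr p + K2 * a powr p"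
    using powr_perturbation[OF p e12(2)] by metis
  have "0 < \<epsilon> / (4 * (K1 + 1))" using \<epsilon> K1 by simp
  then obtain m where "\<forall>n\<ge>m. norm (\<Sum>i. a (i + n) powr p) < \<epsilon> / (4 * (K1 + 1))"
    using suminf_exist_split[OF _ a(2)] by blast
  then have "norm (\<Sum>i. a (i + m) powr p) < \<epsilon> / (4 * (K1 + 1))" by blast
  then have "(\<Sum>i. a (i + m) powr p) < \<epsilon> / (4 * (K1 + 1))" by simp
  then have m: "(K1 + 1) * (\<Sum>i. a (i + m) powr p) \<le> \<epsilon> / 4" using K1 by (simp add: field_simps)
  \<comment> \<open>The bound for \<open>b n powr p\<close> on the first \<open>m\<close>
    coordinates; \<open>\<eta>\<close> is its p-th root.\<close>
  define \<theta> where "\<theta> = \<epsilon> / (4 * (real m + 1) * (K2 + 1))"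
  have \<theta>: "0 < \<theta>" "m * ((K2 + 1) * \<theta>) \<le> \<epsilon> / 4"
  proof -
    show "0 < \<theta>" using \<epsilon> K2 by (simp add: \<theta>_def)
    have "(K2 + 1) * \<theta> = \<epsilon> / (4 * (real m + 1))" using K2 by (simp add: \<theta>_def)
    then have "m * ((K2 + 1) * \<theta>) = \<epsilon> / 4 * (real m / (real m + 1))" by simp
    also have "\<dots> \<le> \<epsilon> / 4 * 1" using \<epsilon> by (intro mult_left_mono) auto
    finally show "m * ((K2 + 1) * \<theta>) \<le> \<epsilon> / 4" by simp
  qed
  define \<eta> where "\<eta> = \<theta> powr (1 / p)"
  have \<eta>: "0 < \<eta>" "\<eta> powr p = \<theta>" using \<theta> p by (auto simp: \<eta>_def powr_powr)
  have "\<bar>(\<Sum>n. c n powr p) - (\<Sum>n. a n powr p) - (\<Sum>n. b n powr p)\<bar> \<le> \<epsilon>"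
    if bc: "triangle_bounds a b c"
      and b: "summable (\<lambda>n. b n powr p)" "(\<Sum>n. b n powr p) \<le> R" "\<forall>n<m. b n \<le> \<eta>" for b c
  proof -
    define d where "d n = c n powr p - a n powr p - b n powr p" for n
    have d1: "\<bar>d n\<bar> \<le> \<epsilon>1 * b n powr p + (K1 + 1) * a n powr p" for n
    proof -
      have "\<bar>c n powr p - b n powr p\<bar> \<le> \<epsilon>1 * b n powr p + K1 * a n powr p"
        using K1(2)[of "a n" "b n" "c n"] bc a by simp
      moreover have "0 \<le> a n powr p" by simp
      ultimately show ?thesis unfolding d_def distrib_right by linarith
    qed
    have d2: "\<bar>d n\<bar> \<le> \<epsilon>2 * a n powr p + (K2 + 1) * b n powr p" for n
    proof -
      have "\<bar>c n powr p - a n powr p\<bar> \<le> \<epsilon>2 * a n powr p + K2 * b n powr p"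
        using K2(2)[of "b n" "a n" "c n"] bc a by simp
      moreover have "0 \<le> b n powr p" by simp
      ultimately show ?thesis unfolding d_def distrib_right by linarith
    qed
    have sd0: "summable (\<lambda>n. \<epsilon>1 * b n powr p + (K1 + 1) * a n powr p)"
      using a b by (intro summable_add summable_mult)
    have sd': "summable (\<lambda>n. \<bar>d n\<bar>)"
      by (rule summable_comparison_test'[OF sd0, of 0]) (use d1 in simp)
    then have sd: "summable d" by (rule summable_rabs_cancel)
    have "(\<lambda>n. c n powr p) = (\<lambda>n. d n + a n powr p + b n powr p)" by (simp add: d_def)
    then have "(\<Sum>n. c n powr p) = (\<Sum>n. d n) + (\<Sum>n. a n powr p) + (\<Sum>n. b n powr p)"
      using sd a(2) b(1) by (simp add: suminf_add summable_add)
    then have "\<bar>(\<Sum>n. c n powr p) - (\<Sum>n. a n powr p) - (\<Sum>n. b n powr p)\<bar> = \<bar>\<Sum>n. d n\<bar>" by simp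
    also have "\<dots> \<le> (\<Sum>n. \<bar>d n\<bar>)" using summable_rabs[OF sd'] .
    also have "\<dots> = (\<Sum>n. \<bar>d (n + m)\<bar>) + (\<Sum>n<m. \<bar>d n\<bar>)"
      using suminf_split_initial_segment[OF sd', of m] .
    also have "(\<Sum>n. \<bar>d (n + m)\<bar>) \<le> (\<Sum>n. \<epsilon>1 * b (n + m) powr p + (K1 + 1) * a (n + m) powr p)"
      using d1 sd' sd0 by (intro suminf_le) (auto simp: summable_iff_shift[of "\<lambda>n. \<bar>d n\<bar>"]
          summable_iff_shift[of "\<lambda>n. \<epsilon>1 * b n powr p + (K1 + 1) * a n powr p"])
    also have "\<dots> = \<epsilon>1 * (\<Sum>n. b (n + m) powr p) + (K1 + 1) * (\<Sum>n. a (n + m) powr p)"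
      using a(2) b(1) by (intro sums_unique[symmetric] sums_add sums_mult summable_sums
          summable_ignore_initial_segment)
    also have "(\<Sum>n. b (n + m) powr p) \<le> (\<Sum>n. b n powr p)"
      using suminf_split_initial_segment[OF b(1), of m] by (simp add: sum_nonneg)
    also have "(\<Sum>n<m. \<bar>d n\<bar>) \<le> (\<Sum>n<m. \<epsilon>2 * a n powr p + (K2 + 1) * \<theta>)"
    proof (rule sum_mono)
      fix n assume "n \<in> {..<m}"
      then have "b n powr p \<le> \<theta>" using b(3) bc p \<eta>(2) by (metis lessThan_iff less_imp_le powr_mono2)
      then have "(K2 + 1) * b n powr p \<le> (K2 + 1) * \<theta>" using K2 by (intro mult_left_mono) auto
      then show "\<bar>d n\<bar> \<le> \<epsilon>2 * a n powr p + (K2 + 1) * \<theta>" using d2[of n] by simp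
    qed
    also have "\<dots> = \<epsilon>2 * (\<Sum>n<m. a n powr p) + m * ((K2 + 1) * \<theta>)"
      by (simp add: sum.distrib sum_distrib_left)
    also have "(\<Sum>n<m. a n powr p) \<le> S" unfolding S_def using a by (intro sum_le_suminf) auto
    finally have "\<bar>(\<Sum>n. c n powr p) - (\<Sum>n. a n powr p) - (\<Sum>n. b n powr p)\<bar>
      \<le> \<epsilon>1 * (\<Sum>n. b n powr p) + (K1 + 1) * (\<Sum>n. a (n + m) powr p) + (\<epsilon>2 * S + m * ((K2 + 1) * \<theta>))"
      using e12 by (simp add: mult_left_mono)
    moreover have "\<epsilon>1 * (\<Sum>n. b n powr p) \<le> \<epsilon>1 * (\<bar>R\<bar> + 1)" using b e12 by (intro mult_left_mono) auto
    moreover have "\<epsilon>2 * S \<le> \<epsilon>2 * (S + 1)" using e12 by (intro mult_left_mono) auto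
    ultimately show ?thesis using m \<theta> e12 by simp
  qed
  then show ?thesis using \<eta> by (intro exI[of _ m] exI[of _ \<eta>]) auto
qed

section \<open>Minkowski's inequality for sequences\<close>

lemma powr_sum_le:
  fixes a b :: real
  assumes "0 \<le> a" "0 \<le> b" "0 < p"
  shows "(a + b) powr p \<le> 2 powr p * (a powr p + b powr p)"
proof -
  have "(a + b) powr p \<le> (2 * max a b) powr p" using assms by (intro powr_mono2) auto
  also have "\<dots> = 2 powr p * max a b powr p" using assms by (simp add: powr_mult)
  also have "\<dots> \<le> 2 powr p * (a powr p + b powr p)" by (intro mult_left_mono) (auto simp: max_def)
  finally show ?thesis .
qed

text \<open>Convexity of the p-th power at \<open>a / A\<close> and \<open>b / B\<close> with
  weights \<open>A / (A + B)\<close> and \<open>B / (A + B)\<close>. In this form it can be summed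
  over coordinates, with \<open>A\<close> and \<open>B\<close> the norms of two sequences.\<close>

lemma powr_convex_weighted:
  fixes a b A B p :: real
  assumes p: "1 \<le> p" and "0 \<le> a" "0 \<le> b" "0 < A" "0 < B"
  shows "(a + b) powr p \<le> (A + B) powr (p - 1) * (A * (a / A) powr p + B * (b / B) powr p)"
proof -
  have AB: "0 < A + B" using assms by simp
  define s where "s = A / (A + B)"
  have s: "0 < s" "s < 1" "1 - s = B / (A + B)" using assms by (auto simp: s_def field_simps)
  have conv: "(s * x + (1 - s) * y) powr p \<le> s * x powr p + (1 - s) * y powr p"
    if xy: "0 \<le> x" "0 \<le> y" for x y
  proof -
    \<comment> \<open>Convexity of the power is used for positive arguments only; these bounds
      replace it when an argument is 0.\<close>
    have le: "s powr p \<le> s" "(1 - s) powr p \<le> 1 - s"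
      using s(1,2) p powr_mono'[of 1 p s] powr_mono'[of 1 p "1 - s"] by auto
    consider "0 < x" "0 < y" | "x = 0" | "y = 0" using xy by fastforce
    then show ?thesis
    proof cases
      case 1
      then show ?thesis
        using convex_onD[OF powr_convex[OF p], of "1 - s" x y] s(1,2) by (simp add: algebra_simps)
    next
      case 2
      then show ?thesis using le(2) xy s(1,2) p by (simp add: powr_mult mult_right_mono)
    next
      case 3
      then show ?thesis using le(1) xy s(1,2) p by (simp add: powr_mult mult_right_mono)
    qed
  qed
  have fac: "(A + B) * (s * x + (1 - s) * y) = A * x + B * y" for x y
    unfolding s(3) distrib_left[of "A + B"] using AB by (simp add: s_def)
  have eq: "a + b = (A + B) * (s * (a / A) + (1 - s) * (b / B))"
    unfolding fac using assms by simp
  have "(a + b) powr p = (A + B) powr p * (s * (a / A) + (1 - s) * (b / B)) powr p"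
    by (subst eq, subst powr_mult) (use assms s in auto)
  also have "\<dots> \<le> (A + B) powr p * (s * (a / A) powr p + (1 - s) * (b / B) powr p)"
    using assms by (intro mult_left_mono conv) auto
  also have "\<dots> = (A + B) powr (p - 1) * ((A + B) * (s * (a / A) powr p + (1 - s) * (b / B) powr p))"
    using AB by (simp add: powr_diff)
  also have "(A + B) * (s * (a / A) powr p + (1 - s) * (b / B) powr p) = A * (a / A) powr p + B * (b / B) powr p"
    by (rule fac)
  finally show ?thesis .
qed

lemma minkowski:
  fixes a b c :: "nat \<Rightarrow> real"
  assumes p: "1 \<le> p" and nonneg: "\<And>n. 0 \<le> a n" "\<And>n. 0 \<le> b n" "\<And>n. 0 \<le> c n"
    and le: "\<And>n. c n \<le> a n + b n"
    and sum: "summable (\<lambda>n. a n powr p)" "summable (\<lambda>n. b n powr p)"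
  shows "summable (\<lambda>n. c n powr p)"
    and "(\<Sum>n. c n powr p) powr (1 / p) \<le> (\<Sum>n. a n powr p) powr (1 / p) + (\<Sum>n. b n powr p) powr (1 / p)"
proof -
  have cab: "c n powr p \<le> (a n + b n) powr p" for n using le nonneg p by (intro powr_mono2) auto
  have "norm (c n powr p) \<le> 2 powr p * (a n powr p + b n powr p)" for n
    using cab[of n] powr_sum_le[of "a n" "b n" p] nonneg p by simp
  moreover have "summable (\<lambda>n. 2 powr p * (a n powr p + b n powr p))"
    using sum by (intro summable_mult summable_add)
  ultimately show sc: "summable (\<lambda>n. c n powr p)" by (metis (no_types, lifting) summable_comparison_test')
  define A where "A = (\<Sum>n. a n powr p) powr (1 / p)"
  define B where "B = (\<Sum>n. b n powr p) powr (1 / p)"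
  have nn: "0 \<le> (\<Sum>n. a n powr p)" "0 \<le> (\<Sum>n. b n powr p)" "0 \<le> (\<Sum>n. c n powr p)"
    using sum sc by (auto intro: suminf_nonneg)
  have AB: "A powr p = (\<Sum>n. a n powr p)" "B powr p = (\<Sum>n. b n powr p)" "0 \<le> A" "0 \<le> B"
    using p nn by (auto simp: A_def B_def powr_powr)
  have zero: "f n = 0" if "summable (\<lambda>n. f n powr p)" "(\<Sum>n. f n powr p) = 0" "\<And>n. 0 \<le> f n" for f :: "nat \<Rightarrow> real" and n
    using that suminf_eq_zero_iff[OF that(1)] by simp
  have "(\<Sum>n. c n powr p) powr (1 / p) \<le> A + B"
  proof (cases "A = 0 \<or> B = 0")
    case True
    \<comment> \<open>Normalising by \<open>A\<close> or \<open>B\<close> is impossible here, but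
      one of the two sequences vanishes.\<close>
    have mono: "(\<Sum>n. c n powr p) powr (1 / p) \<le> (\<Sum>n. f n powr p) powr (1 / p)"
      if "summable (\<lambda>n. f n powr p)" "\<And>n. c n \<le> f n" for f
      using that sc nn p nonneg by (intro powr_mono2 suminf_le) auto
    show ?thesis
    proof (cases "A = 0")
      case True
      then have "a n = 0" for n using zero[OF sum(1)] AB p nonneg by auto
      then have "c n \<le> b n" for n using le[of n] by simp
      from mono[OF sum(2) this] show ?thesis using AB(3) B_def by simp
    next
      case False
      then have "B = 0" using True by simp
      then have "b n = 0" for n using zero[OF sum(2)] AB p nonneg by auto
      then have "c n \<le> a n" for n using le[of n] by simp
      from mono[OF sum(1) this] show ?thesis using AB(4) A_def by simp
    qed
  next
    case False
    then have pos: "0 < A" "0 < B" using AB by auto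
    have AA: "A * (x / A) powr p = A / A powr p * x powr p" "B * (x / B) powr p = B / B powr p * x powr p" if "0 \<le> x" for x
      using that pos by (auto simp: powr_divide)
    define g where "g n = (A + B) powr (p - 1) * (A / A powr p * a n powr p + B / B powr p * b n powr p)" for n
    have "(\<Sum>n. c n powr p) \<le> (\<Sum>n. g n)"
    proof (rule suminf_le)
      show "c n powr p \<le> g n" for n
        using cab[of n] powr_convex_weighted[OF p nonneg(1) nonneg(2) pos, of n n] nonneg
        unfolding g_def by (simp add: AA)
      show "summable g" unfolding g_def using sum by (intro summable_mult summable_add)
    qed (rule sc)
    also have "\<dots> = (A + B) powr (p - 1) * (A / A powr p * (\<Sum>n. a n powr p) + B / B powr p * (\<Sum>n. b n powr p))"
      unfolding g_def using sum by (intro sums_unique[symmetric] sums_mult sums_add summable_sums)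
    also have "\<dots> = (A + B) powr (p - 1) * (A + B)" using pos AB(1,2)[symmetric] by simp
    also have "\<dots> = (A + B) powr p" using pos by (simp add: powr_diff)
    finally have "(\<Sum>n. c n powr p) powr (1 / p) \<le> ((A + B) powr p) powr (1 / p)"
      using nn p by (intro powr_mono2) auto
    then show ?thesis using pos p by (simp add: powr_powr)
  qed
  then show "(\<Sum>n. c n powr p) powr (1 / p) \<le> (\<Sum>n. a n powr p) powr (1 / p) + (\<Sum>n. b n powr p) powr (1 / p)"
    by (simp add: A_def B_def)
qed

text \<open>Each point is coloured by choosing, for every \<open>l < m\<close>, a set of the cover
  that contains it; with one point more than there are colours, two points share all these
  sets.\<close>

lemma pigeonhole_covers:
  assumes "\<And>l. l < (m::nat) \<Longrightarrow> \<exists>\<A>. finite \<A> \<and> (\<forall>u\<in>U l. \<exists>Z\<in>\<A>. u \<in> Z) \<and> (\<forall>Z\<in>\<A>. \<forall>u\<in>Z. \<forall>w\<in>Z. near l u w)"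
  shows "\<exists>K. \<forall>e::nat \<Rightarrow> 'e. (\<forall>i<K. \<forall>l<m. e i \<in> U l) \<longrightarrow> (\<exists>i j. i < j \<and> j < K \<and> (\<forall>l<m. near l (e i) (e j)))"
proof -
  obtain \<A> where \<A>: "\<And>l. l < m \<Longrightarrow> finite (\<A> l)" "\<And>l u. l < m \<Longrightarrow> u \<in> U l \<Longrightarrow> \<exists>Z\<in>\<A> l. u \<in> Z"
    "\<And>l Z u w. l < m \<Longrightarrow> Z \<in> \<A> l \<Longrightarrow> u \<in> Z \<Longrightarrow> w \<in> Z \<Longrightarrow> near l u w"
    using assms by metis
  define P where "P = PiE {..<m} \<A>"
  have P: "finite P" unfolding P_def using \<A>(1) by (intro finite_PiE) auto
  have "\<exists>i j. i < j \<and> j < Suc (card P) \<and> (\<forall>l<m. near l (e i) (e j))"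
    if e: "\<forall>i<Suc (card P). \<forall>l<m. e i \<in> U l" for e :: "nat \<Rightarrow> 'e"
  proof -
    define f where "f i = (\<lambda>l\<in>{..<m}. SOME Z. Z \<in> \<A> l \<and> e i \<in> Z)" for i
    have f: "f i l \<in> \<A> l \<and> e i \<in> f i l" if "i < Suc (card P)" "l < m" for i l
      unfolding f_def using someI_ex[of "\<lambda>Z. Z \<in> \<A> l \<and> e i \<in> Z"] \<A>(2)[of l "e i"] e that by auto
    have "f ` {..<Suc (card P)} \<subseteq> P"
      using f by (auto simp: P_def PiE_iff f_def)
    then have "\<not> inj_on f {..<Suc (card P)}"
      using P card_inj_on_le[of f "{..<Suc (card P)}" P] by auto
    then obtain i j where ij: "i < Suc (card P)" "j < Suc (card P)" "i < j" "f i = f j"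
      unfolding inj_on_def by (metis lessThan_iff nat_neq_iff)
    have "near l (e i) (e j)" if "l < m" for l
      using \<A>(3)[of l "f i l"] f[OF ij(1) that] f[OF ij(2) that] ij(4) that by auto
    then show ?thesis using ij by blast
  qed
  then show ?thesis by blast
qed

context seminorm
begin

text \<open>Covers by small sets, unlike nets, pull back along maps that are not onto; this is how
  coordinates on a subspace are handled.\<close>

lemma span_cover:
  assumes "finite B" "0 < \<epsilon>"
  shows "\<exists>\<A>. finite \<A> \<and> (\<forall>x\<in>span B. N x \<le> R \<longrightarrow> (\<exists>Z\<in>\<A>. x \<in> Z)) \<and> (\<forall>Z\<in>\<A>. \<forall>x\<in>Z. \<forall>y\<in>Z. N (x - y) \<le> \<epsilon>)"
proof -
  obtain A where A: "finite A" "\<forall>x\<in>span B. N x \<le> R \<longrightarrow> (\<exists>a\<in>A. N (x - a) \<le> \<epsilon> / 2)"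
    using span_net[OF assms(1), of "\<epsilon> / 2" R] assms(2) by auto
  have "N (x - y) \<le> \<epsilon>" if "N (x - a) \<le> \<epsilon> / 2" "N (y - a) \<le> \<epsilon> / 2" for x y a
    using diff_triangle[of x y a] diff_commute[of y a] that by simp
  then show ?thesis using A
    by (intro exI[of _ "(\<lambda>a. {x. N (x - a) \<le> \<epsilon> / 2}) ` A"]) auto
qed

end

text \<open>The \<open>g n\<close> play the role of the norms of the coordinates in an \<open>\<ell>\<^sub>p\<close>-sum of finite-dimensional spaces.\<close>

lemma lp_additive_sum:
  fixes g :: "nat \<Rightarrow> 'v::real_vector \<Rightarrow> real"
  assumes p: "1 < p" and g: "\<And>n. seminorm (g n)" and sum: "\<And>x. summable (\<lambda>n. g n x powr p)"
    and M: "\<And>x. M x = (\<Sum>n. g n x powr p) powr (1 / p)"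
    and cover: "\<And>n R \<epsilon>. 0 < \<epsilon> \<Longrightarrow> \<exists>\<A>. finite \<A> \<and> (\<forall>x. g n x \<le> R \<longrightarrow> (\<exists>Z\<in>\<A>. x \<in> Z)) \<and>
      (\<forall>Z\<in>\<A>. \<forall>x\<in>Z. \<forall>y\<in>Z. g n (x - y) \<le> \<epsilon>)"
  shows "seminorm M" and "lp_additive p M"
proof -
  interpret g: seminorm "g n" for n by (rule g)
  have nn: "0 \<le> (\<Sum>n. g n x powr p)" for x using sum by (intro suminf_nonneg) auto
  have Mp: "M x powr p = (\<Sum>n. g n x powr p)" for x
    unfolding M using nn[of x] p by (simp add: powr_powr)
  show "seminorm M"
  proof
    show "M (x + y) \<le> M x + M y" for x y
      unfolding M by (rule minkowski(2)) (use p g.add_le sum in auto)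
    show "M (c *\<^sub>R x) = \<bar>c\<bar> * M x" for c x
    proof -
      have "(\<Sum>n. g n (c *\<^sub>R x) powr p) = \<bar>c\<bar> powr p * (\<Sum>n. g n x powr p)"
        using sum by (simp add: g.scale powr_mult suminf_mult)
      then show ?thesis unfolding M using nn[of x] p by (simp add: powr_mult powr_powr)
    qed
  qed
  then interpret M: seminorm M .
  show "lp_additive p M"
    unfolding lp_additive_def
  proof (intro allI impI)
    fix A :: "'v set" and \<epsilon> R :: real
    assume A: "finite A" and \<epsilon>: "0 < \<epsilon>"
    define R' where "R' = (2 * R) powr p"
    have "\<forall>x. \<exists>m \<eta>. 0 < \<eta> \<and> (\<forall>b c. triangle_bounds (\<lambda>n. g n x) b c \<longrightarrow>
     summable (\<lambda>n. b n powr p) \<longrightarrow> (\<Sum>n. b n powr p) \<le> R' \<longrightarrow> (\<forall>n<m. b n \<le> \<eta>) \<longrightarrow>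
     \<bar>(\<Sum>n. c n powr p) - (\<Sum>n. g n x powr p) - (\<Sum>n. b n powr p)\<bar> \<le> \<epsilon>)"
      using brezis_lieb[of p \<epsilon> "\<lambda>n. g n x" R' for x] p \<epsilon> sum by auto
    then obtain m \<eta> where m\<eta>: "\<And>x. 0 < \<eta> x" "\<And>x b c. triangle_bounds (\<lambda>n. g n x) b c \<Longrightarrow>
     summable (\<lambda>n. b n powr p) \<Longrightarrow> (\<Sum>n. b n powr p) \<le> R' \<Longrightarrow> (\<forall>n<m x. b n \<le> \<eta> x) \<Longrightarrow>
     \<bar>(\<Sum>n. c n powr p) - (\<Sum>n. g n x powr p) - (\<Sum>n. b n powr p)\<bar> \<le> \<epsilon>"
      by metis
    \<comment> \<open>Common thresholds for the finitely many \<open>x\<close> in \<open>A\<close>;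
      the inserted 0 and 1 cover an empty \<open>A\<close>.\<close>
    define m0 where "m0 = Max (insert 0 (m ` A))"
    define \<eta>0 where "\<eta>0 = Min (insert 1 (\<eta> ` A))"
    have \<eta>0: "0 < \<eta>0" unfolding \<eta>0_def using A m\<eta>(1) by (subst Min_gr_iff) auto
    have le: "m x \<le> m0" "\<eta>0 \<le> \<eta> x" if "x \<in> A" for x
      using that A by (auto simp: m0_def \<eta>0_def)
    have ex: "\<exists>\<A>. finite \<A> \<and> (\<forall>u\<in>{x. g l x \<le> R}. \<exists>Z\<in>\<A>. u \<in> Z) \<and> (\<forall>Z\<in>\<A>. \<forall>u\<in>Z. \<forall>w\<in>Z. g l (u - w) \<le> \<eta>0)" for l
      using cover[OF \<eta>0, of l R] by simp
    obtain K where K: "\<And>e::nat \<Rightarrow> 'v. (\<forall>i<K. \<forall>l<m0. e i \<in> {x. g l x \<le> R}) \<Longrightarrow>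
      (\<exists>i j. i < j \<and> j < K \<and> (\<forall>l<m0. g l (e i - e j) \<le> \<eta>0))"
      using pigeonhole_covers[of m0 "\<lambda>l. {x. g l x \<le> R}" "\<lambda>l u w. g l (u - w) \<le> \<eta>0"] ex by auto
    have gM: "g l x \<le> M x" for l x
    proof -
      have "g l x powr p \<le> (\<Sum>n. g n x powr p)" using sum_le_suminf[OF sum[of x], of "{l}"] by simp
      then have "g l x powr p \<le> M x powr p" by (simp add: Mp)
      then show ?thesis using p powr_less_mono2[of p "M x" "g l x"] by (meson M.nonneg less_trans not_le zero_less_one)
    qed
    show "\<exists>K. \<forall>e :: nat \<Rightarrow> 'v. (\<forall>i<K. M (e i) \<le> R) \<longrightarrow>
       (\<exists>i j. i < j \<and> j < K \<and>
         (\<forall>x\<in>A. almost_additive p M \<epsilon> x (e i - e j)))"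
    proof (rule exI[of _ K], intro allI impI)
      fix e :: "nat \<Rightarrow> 'v" assume e: "\<forall>i<K. M (e i) \<le> R"
      then have "\<forall>i<K. \<forall>l<m0. e i \<in> {x. g l x \<le> R}" using gM order_trans by blast
      then obtain i j where ij: "i < j" "j < K" "\<forall>l<m0. g l (e i - e j) \<le> \<eta>0" using K by blast
      define y where "y = e i - e j"
      have "M y \<le> 2 * R" using M.diff_le[of "e i" "e j"] e ij unfolding y_def by (smt (verit) less_trans)
      then have R': "(\<Sum>n. g n y powr p) \<le> R'" unfolding R'_def Mp[symmetric] using p by (intro powr_mono2) auto
      have "almost_additive p M \<epsilon> x y" if x: "x \<in> A" for x
      proof -
        have "\<bar>g n (x + y) - g n y\<bar> \<le> g n x \<and> \<bar>g n (x + y) - g n x\<bar> \<le> g n y" for n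
          using g.add_le[of n x y] g.diff_le[of n "x + y" x] g.diff_le[of n "x + y" y] by auto
        moreover have "\<forall>n<m x. g n y \<le> \<eta> x" using ij(3) le[OF x] by (metis y_def less_le_trans order_trans)
        ultimately show ?thesis unfolding Mp using m\<eta>(2)[where x = x and b = "\<lambda>n. g n y" and c = "\<lambda>n. g n (x + y)"] R' sum by simp
      qed
      then show "\<exists>i j. i < j \<and> j < K \<and>
         (\<forall>x\<in>A. almost_additive p M \<epsilon> x (e i - e j))"
        using ij y_def by blast
    qed
  qed
qed

section \<open>Additivity in quotients of \<open>\<ell>\<^sub>p\<close>\<close>

text \<open>A countable product of balls is compact by Tychonoff's theorem and metrisable, hence
  sequentially compact; this replaces a diagonal argument.\<close>

lemma coordinatewise_subsequence:
  fixes u :: "nat \<Rightarrow> nat \<Rightarrow> 'k::euclidean_space"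
  assumes "\<And>n l. norm (u n l) \<le> R"
  shows "\<exists>r v. strict_mono r \<and> (\<forall>l. (\<lambda>n. u (r n) l) \<longlonglongrightarrow> v l)"
proof -
  define K where "K = PiE UNIV (\<lambda>l::nat. cball (0::'k) R)"
  have "compactin (product_topology (\<lambda>l::nat. euclidean) UNIV) K"
    unfolding K_def by (simp add: compactin_PiE)
  then have "compact K" by (simp add: euclidean_product_topology)
  then have "seq_compact K" by (rule compact_imp_seq_compact)
  moreover have "u n \<in> K" for n using assms by (auto simp: K_def)
  ultimately obtain v r where r: "strict_mono r" "(u \<circ> r) \<longlonglongrightarrow> v"
    unfolding seq_compact_def by blast
  have "(\<lambda>n. u (r n) l) \<longlonglongrightarrow> v l" for l
  proof -
    have "((\<lambda>x :: nat \<Rightarrow> 'k. x l) \<circ> (u \<circ> r)) \<longlonglongrightarrow> v l"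
      unfolding o_def
      by (rule continuous_on_tendsto_compose[of UNIV "\<lambda>x. x l"]) (use r(2) in \<open>auto simp: o_def\<close>)
    then show ?thesis by (simp add: o_def)
  qed
  then show ?thesis using r by blast
qed

section \<open>The sequence space, through p-th powers of norms\<close>

definition lp_seq :: "real \<Rightarrow> (nat \<Rightarrow> 'k::real_normed_vector) set" where
  "lp_seq p = {x. summable (\<lambda>n. norm (x n) powr p)}"

definition lp_sum_powr :: "real \<Rightarrow> (nat \<Rightarrow> 'k::real_normed_vector) \<Rightarrow> real" where
  "lp_sum_powr p x = (\<Sum>n. norm (x n) powr p)"

lemma lp_sum_powr_nonneg: "x \<in> lp_seq p \<Longrightarrow> 0 \<le> lp_sum_powr p x"
  by (auto simp: lp_seq_def lp_sum_powr_def intro: suminf_nonneg)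

lemma lp_seq_scale:
  assumes "x \<in> lp_seq p"
  shows "(\<lambda>n. r *\<^sub>R x n) \<in> lp_seq p" "lp_sum_powr p (\<lambda>n. r *\<^sub>R x n) = \<bar>r\<bar> powr p * lp_sum_powr p x"
  using assms by (simp_all add: lp_seq_def lp_sum_powr_def powr_mult suminf_mult)

lemma lp_seq_add:
  assumes p: "1 \<le> p" and xy: "x \<in> lp_seq p" "y \<in> lp_seq p"
  shows "(\<lambda>n. x n + y n) \<in> lp_seq p"
    "lp_sum_powr p (\<lambda>n. x n + y n) powr (1 / p) \<le> lp_sum_powr p x powr (1 / p) + lp_sum_powr p y powr (1 / p)"
    "lp_sum_powr p (\<lambda>n. x n + y n) \<le> 2 powr p * (lp_sum_powr p x + lp_sum_powr p y)"
proof -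
  note M = minkowski[of p "\<lambda>n. norm (x n)" "\<lambda>n. norm (y n)" "\<lambda>n. norm (x n + y n)"]
  show "(\<lambda>n. x n + y n) \<in> lp_seq p"
    using M(1) p xy by (simp add: lp_seq_def norm_triangle_ineq)
  show "lp_sum_powr p (\<lambda>n. x n + y n) powr (1 / p) \<le> lp_sum_powr p x powr (1 / p) + lp_sum_powr p y powr (1 / p)"
    using M(2) p xy by (simp add: lp_seq_def lp_sum_powr_def norm_triangle_ineq)
  then have "(lp_sum_powr p (\<lambda>n. x n + y n) powr (1 / p)) powr p \<le>
      (lp_sum_powr p x powr (1 / p) + lp_sum_powr p y powr (1 / p)) powr p"
    using p by (intro powr_mono2) auto
  also have "\<dots> \<le> 2 powr p * ((lp_sum_powr p x powr (1 / p)) powr p + (lp_sum_powr p y powr (1 / p)) powr p)"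
    using p by (intro powr_sum_le) auto
  finally show "lp_sum_powr p (\<lambda>n. x n + y n) \<le> 2 powr p * (lp_sum_powr p x + lp_sum_powr p y)"
    using p lp_sum_powr_nonneg[OF xy(1)] lp_sum_powr_nonneg[OF xy(2)]
      lp_sum_powr_nonneg[OF \<open>(\<lambda>n. x n + y n) \<in> lp_seq p\<close>] by (simp add: powr_powr)
qed

lemma lp_seq_diff:
  assumes p: "1 \<le> p" and xy: "x \<in> lp_seq p" "y \<in> lp_seq p"
  shows "(\<lambda>n. x n - y n) \<in> lp_seq p"
    "lp_sum_powr p (\<lambda>n. x n - y n) \<le> 2 powr p * (lp_sum_powr p x + lp_sum_powr p y)"
proof -
  have y: "(\<lambda>n. - y n) \<in> lp_seq p" "lp_sum_powr p (\<lambda>n. - y n) = lp_sum_powr p y"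
    using lp_seq_scale[OF xy(2), of "-1"] by simp_all
  show "(\<lambda>n. x n - y n) \<in> lp_seq p"
    "lp_sum_powr p (\<lambda>n. x n - y n) \<le> 2 powr p * (lp_sum_powr p x + lp_sum_powr p y)"
    using lp_seq_add(1,3)[OF p xy(1) y(1)] y(2) by simp_all
qed

lemma norm_le_lp_sum_powr:
  assumes "0 < p" "x \<in> lp_seq p"
  shows "norm (x l) \<le> lp_sum_powr p x powr (1 / p)"
proof -
  have "norm (x l) powr p \<le> lp_sum_powr p x"
    using sum_le_suminf[of "\<lambda>n. norm (x n) powr p" "{l}"] assms by (simp add: lp_seq_def lp_sum_powr_def)
  then have "(norm (x l) powr p) powr (1 / p) \<le> lp_sum_powr p x powr (1 / p)"
    using assms by (intro powr_mono2) auto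
  then show ?thesis using assms by (simp add: powr_powr)
qed

text \<open>Finite partial sums pass to the limit with their bound \<open>R\<close>, and they
  determine the infinite sum.\<close>

lemma lp_fatou:
  assumes p: "0 < p" and u: "\<And>n. u n \<in> lp_seq p" "\<And>n. lp_sum_powr p (u n) \<le> R"
    and lim: "\<And>l. (\<lambda>n. u n l) \<longlonglongrightarrow> v l"
  shows "v \<in> lp_seq p" "lp_sum_powr p v \<le> R"
proof -
  have le: "(\<Sum>l<m. norm (v l) powr p) \<le> R" for m
  proof (rule LIMSEQ_le_const2)
    show "(\<lambda>n. \<Sum>l<m. norm (u n l) powr p) \<longlonglongrightarrow> (\<Sum>l<m. norm (v l) powr p)"
      using p by (intro tendsto_sum tendsto_powr2 tendsto_norm lim tendsto_const) auto
    have "(\<Sum>l<m. norm (u n l) powr p) \<le> R" for n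
      using sum_le_suminf[of "\<lambda>l. norm (u n l) powr p" "{..<m}"] u[of n]
      by (simp add: lp_seq_def lp_sum_powr_def)
    then show "\<exists>N. \<forall>n\<ge>N. (\<Sum>l<m. norm (u n l) powr p) \<le> R" by blast
  qed
  show v: "v \<in> lp_seq p" unfolding lp_seq_def mem_Collect_eq
    by (rule summableI_nonneg_bounded[of _ R]) (use le in auto)
  then show "lp_sum_powr p v \<le> R" unfolding lp_sum_powr_def lp_seq_def
    by (intro suminf_le_const le) auto
qed

abbreviation lp_split :: "real \<Rightarrow> real \<Rightarrow> (nat \<Rightarrow> 'k::real_normed_vector) \<Rightarrow> (nat \<Rightarrow> 'k) \<Rightarrow> bool" where
  "lp_split p \<epsilon> x w \<equiv> \<bar>lp_sum_powr p (\<lambda>l. x l + w l) - lp_sum_powr p x - lp_sum_powr p w\<bar> \<le> \<epsilon>"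

text \<open>The thresholds in \<open>brezis_lieb\<close> involve finitely many coordinates and are
  uniform over bounded sequences, so coordinatewise convergence to 0 is enough.\<close>

lemma brezis_lieb_lp:
  fixes x :: "nat \<Rightarrow> 'k::real_normed_vector"
  assumes p: "0 < p" and \<epsilon>: "0 < \<epsilon>" and x: "x \<in> lp_seq p"
    and w: "\<And>n. w n \<in> lp_seq p" "\<And>n. lp_sum_powr p (w n) \<le> R" and lim: "\<And>l. (\<lambda>n. w n l) \<longlonglongrightarrow> 0"
  shows "eventually (\<lambda>n. lp_split p \<epsilon> x (w n)) sequentially"
proof -
  obtain m \<eta> where \<eta>: "0 < \<eta>" and m: "\<And>b c. triangle_bounds (\<lambda>n. norm (x n)) b c \<Longrightarrow>
     summable (\<lambda>n. b n powr p) \<Longrightarrow> (\<Sum>n. b n powr p) \<le> R \<Longrightarrow> (\<forall>n<m. b n \<le> \<eta>) \<Longrightarrow>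
     \<bar>(\<Sum>n. c n powr p) - (\<Sum>n. norm (x n) powr p) - (\<Sum>n. b n powr p)\<bar> \<le> \<epsilon>"
    using brezis_lieb[OF p \<epsilon>, of "\<lambda>n. norm (x n)" R] x by (auto simp: lp_seq_def)
  have "eventually (\<lambda>n. norm (w n l) < \<eta>) sequentially" for l
    using order_tendstoD(2)[OF tendsto_norm[OF lim[of l]], of \<eta>] \<eta> by simp
  then have "eventually (\<lambda>n. \<forall>l\<in>{..<m}. norm (w n l) < \<eta>) sequentially"
    by (intro eventually_ball_finite) auto
  then show ?thesis
  proof eventually_elim
    case (elim n)
    have "\<bar>norm (x l + w n l) - norm (w n l)\<bar> \<le> norm (x l) \<and> \<bar>norm (x l + w n l) - norm (x l)\<bar> \<le> norm (w n l)" for l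
      using norm_triangle_ineq3[of "x l + w n l" "w n l"] norm_triangle_ineq3[of "x l + w n l" "x l"] by simp
    then show ?case
      using m[of "\<lambda>l. norm (w n l)" "\<lambda>l. norm (x l + w n l)"] w[of n] elim
      by (auto simp: lp_seq_def lp_sum_powr_def less_imp_le)
  qed
qed

text \<open>\<open>L f\<close> is the set of all lifts of \<open>f\<close> to \<open>\<ell>\<^sub>p\<close>; the kernel of the quotient map is \<open>L 0\<close>.\<close>

locale lp_quotient =
  fixes p :: real and L :: "'v::real_vector \<Rightarrow> (nat \<Rightarrow> 'k::euclidean_space) set"
  assumes p: "1 < p"
    and lifts: "\<And>f. L f \<subseteq> lp_seq p" "\<And>f. L f \<noteq> {}"
    and lift_add: "\<And>f g u v. u \<in> L f \<Longrightarrow> v \<in> L g \<Longrightarrow> (\<lambda>n. u n + v n) \<in> L (f + g)"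
    and lift_scale: "\<And>f u r. u \<in> L f \<Longrightarrow> (\<lambda>n. r *\<^sub>R u n) \<in> L (r *\<^sub>R f)"
    and kernel_closed: "\<And>u. u \<in> lp_seq p \<Longrightarrow>
      (\<And>\<epsilon>. 0 < \<epsilon> \<Longrightarrow> \<exists>w\<in>L 0. lp_sum_powr p (\<lambda>n. u n - w n) < \<epsilon>) \<Longrightarrow> u \<in> L 0"
begin

abbreviation S :: "(nat \<Rightarrow> 'k) \<Rightarrow> real" where "S \<equiv> lp_sum_powr p"

definition M :: "'v \<Rightarrow> real" where
  "M f = Inf ((\<lambda>u. S u powr (1 / p)) ` L f)"

lemma in_lp: "u \<in> L f \<Longrightarrow> u \<in> lp_seq p"
  using lifts by blast

lemma lift_diff: "u \<in> L f \<Longrightarrow> v \<in> L g \<Longrightarrow> (\<lambda>n. u n - v n) \<in> L (f - g)"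
  using lift_add[of u f "\<lambda>n. (-1) *\<^sub>R v n" "(-1) *\<^sub>R g"] lift_scale[of v g "-1"] by simp

lemma lift_kernel_add: "u \<in> L f \<Longrightarrow> (\<lambda>n. v n - u n) \<in> L 0 \<Longrightarrow> v \<in> L f"
  using lift_add[of u f "\<lambda>n. v n - u n" 0] by simp

lemma M_nonneg: "0 \<le> M f"
  unfolding M_def using lifts by (intro cInf_greatest) auto

lemma M_le: assumes "u \<in> L f" shows "M f \<le> S u powr (1 / p)"
  unfolding M_def using assms by (intro cInf_lower bdd_belowI[of _ 0]) auto

lemma M_powr_le: assumes "u \<in> L f" shows "M f powr p \<le> S u"
proof -
  have "M f powr p \<le> (S u powr (1 / p)) powr p" using M_le[OF assms] M_nonneg p by (intro powr_mono2) auto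
  then show ?thesis using p lp_sum_powr_nonneg[OF in_lp[OF assms]] by (simp add: powr_powr)
qed

lemma almost_optimal_lift: assumes "M f < t" shows "\<exists>u\<in>L f. S u powr (1 / p) < t"
  using assms cInf_lessD[of "(\<lambda>u. S u powr (1 / p)) ` L f" t] lifts(2) unfolding M_def by auto

lemma almost_optimal_lift_powr: assumes "0 < \<epsilon>" shows "\<exists>u\<in>L f. S u \<le> M f powr p + \<epsilon>"
proof -
  have pos: "0 < M f powr p + \<epsilon>" using assms by (simp add: add_nonneg_pos)
  have "(M f powr p) powr (1 / p) < (M f powr p + \<epsilon>) powr (1 / p)"
    using assms p by (intro powr_less_mono2) auto
  then have "M f < (M f powr p + \<epsilon>) powr (1 / p)" using M_nonneg[of f] p by (simp add: powr_powr)
  then obtain u where u: "u \<in> L f" "S u powr (1 / p) < (M f powr p + \<epsilon>) powr (1 / p)"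
    using almost_optimal_lift by blast
  have "(S u powr (1 / p)) powr p \<le> ((M f powr p + \<epsilon>) powr (1 / p)) powr p"
    by (rule powr_mono2) (use u p in auto)
  then have "S u \<le> M f powr p + \<epsilon>"
    using p pos lp_sum_powr_nonneg[OF in_lp[OF u(1)]] by (simp add: powr_powr)
  then show ?thesis using u by blast
qed

sublocale M: seminorm M
proof
  show "M (f + g) \<le> M f + M g" for f g
  proof (rule field_le_epsilon)
    fix e :: real assume e: "0 < e"
    obtain u where u: "u \<in> L f" "S u powr (1 / p) < M f + e / 2" using almost_optimal_lift[of f "M f + e / 2"] e by auto
    obtain v where v: "v \<in> L g" "S v powr (1 / p) < M g + e / 2" using almost_optimal_lift[of g "M g + e / 2"] e by auto
    have "M (f + g) \<le> S (\<lambda>n. u n + v n) powr (1 / p)" using M_le lift_add u v by blast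
    also have "\<dots> \<le> S u powr (1 / p) + S v powr (1 / p)"
      using lp_seq_add(2)[of p u v] p in_lp u(1) v(1) by auto
    finally show "M (f + g) \<le> M f + M g + e" using u v by simp
  qed
  have le: "M (r *\<^sub>R f) \<le> \<bar>r\<bar> * M f" for r f
  proof (rule field_le_epsilon)
    fix e :: real assume e: "0 < e"
    have "0 < e / (\<bar>r\<bar> + 1)" using e by (simp add: add_nonneg_pos)
    then obtain u where u: "u \<in> L f" "S u powr (1 / p) < M f + e / (\<bar>r\<bar> + 1)"
      using almost_optimal_lift[of f "M f + e / (\<bar>r\<bar> + 1)"] by auto
    have "M (r *\<^sub>R f) \<le> S (\<lambda>n. r *\<^sub>R u n) powr (1 / p)" using M_le lift_scale u by blast
    also have "\<dots> = \<bar>r\<bar> * S u powr (1 / p)"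
      using lp_seq_scale(2)[OF in_lp[OF u(1)], of r] lp_sum_powr_nonneg[OF in_lp[OF u(1)]] p
      by (simp add: powr_mult powr_powr)
    also have "\<dots> \<le> \<bar>r\<bar> * (M f + e / (\<bar>r\<bar> + 1))" using u by (intro mult_left_mono) auto
    also have "\<dots> = \<bar>r\<bar> * M f + \<bar>r\<bar> * (e / (\<bar>r\<bar> + 1))" by (rule distrib_left)
    also have "\<bar>r\<bar> * (e / (\<bar>r\<bar> + 1)) \<le> e" using e by (simp add: field_simps)
    finally show "M (r *\<^sub>R f) \<le> \<bar>r\<bar> * M f + e" by simp
  qed
  show "M (r *\<^sub>R f) = \<bar>r\<bar> * M f" for r f
  proof (cases "r = 0")
    case True
    then show ?thesis using le[of 0 f] M_nonneg[of 0] by simp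
  next
    case False
    then have "M f \<le> \<bar>inverse r\<bar> * M (r *\<^sub>R f)" using le[of "inverse r" "r *\<^sub>R f"] by simp
    then have "\<bar>r\<bar> * M f \<le> M (r *\<^sub>R f)" using False by (simp add: field_simps)
    then show ?thesis using le[of r f] by simp
  qed
qed

text \<open>The Banach--Saks argument: far-out differences \<open>u n - v\<close> are almost disjoint, so that sums of \<open>k\<close> of
  them have norm \<open>O (k powr (1 / p))\<close> and their averages tend to \<open>0\<close>.\<close>

lemma kernel_coordinatewise_closed:
  assumes u: "\<And>n. u n \<in> L 0" "\<And>n. S (u n) \<le> R" and lim: "\<And>l. (\<lambda>n. u n l) \<longlonglongrightarrow> v l"
  shows "v \<in> L 0"
proof (rule kernel_closed)
  have p0: "0 < p" "1 \<le> p" using p by auto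
  note v = lp_fatou[OF p0(1) in_lp[OF u(1)] u(2) lim]
  show "v \<in> lp_seq p" by (rule v(1))
  define R' where "R' = 2 powr p * (R + R)"
  have d: "(\<lambda>l. u n l - v l) \<in> lp_seq p" "S (\<lambda>l. u n l - v l) \<le> R'" for n
  proof -
    show "(\<lambda>l. u n l - v l) \<in> lp_seq p" using lp_seq_diff(1)[OF p0(2) in_lp[OF u(1)] v(1)] .
    have "S (\<lambda>l. u n l - v l) \<le> 2 powr p * (S (u n) + S v)" using lp_seq_diff(2)[OF p0(2) in_lp[OF u(1)] v(1)] .
    also have "\<dots> \<le> R'" unfolding R'_def using u(2) v(2) by (intro mult_left_mono add_mono) auto
    finally show "S (\<lambda>l. u n l - v l) \<le> R'" .
  qed
  have R': "0 \<le> R'" using d[of 0] lp_sum_powr_nonneg order_trans by blast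
  have dlim: "(\<lambda>n. u n l - v l) \<longlonglongrightarrow> 0" for l using lim[of l] by (simp add: LIM_zero)
  \<comment> \<open>\<open>w\<close> is a sum of \<open>k\<close> of the \<open>u n\<close>. Each is
    chosen so far out that \<open>u n - v\<close> is almost disjoint from what was summed before,
    which costs \<open>R'\<close> plus an error of 1.\<close>
  have ex: "\<exists>w\<in>L 0. S (\<lambda>l. w l - real k *\<^sub>R v l) \<le> k * (R' + 1)" for k
  proof (induction k)
    case 0
    have "(\<lambda>l. 0 *\<^sub>R u 0 l) \<in> L (0 *\<^sub>R 0)" by (rule lift_scale[OF u(1)])
    then show ?case by (intro bexI[of _ "\<lambda>l. 0"]) (simp_all add: lp_sum_powr_def)
  next
    case (Suc k)
    then obtain w where w: "w \<in> L 0" "S (\<lambda>l. w l - real k *\<^sub>R v l) \<le> k * (R' + 1)" by blast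
    have x: "(\<lambda>l. w l - real k *\<^sub>R v l) \<in> lp_seq p"
      using lp_seq_diff(1)[OF p0(2) in_lp[OF w(1)] lp_seq_scale(1)[OF v(1)]] .
    have "eventually (\<lambda>n. \<bar>S (\<lambda>l. (w l - real k *\<^sub>R v l) + (u n l - v l)) - S (\<lambda>l. w l - real k *\<^sub>R v l)
        - S (\<lambda>l. u n l - v l)\<bar> \<le> 1) sequentially"
      by (rule brezis_lieb_lp[OF p0(1) _ x d dlim]) simp
    then obtain n where n: "\<bar>S (\<lambda>l. (w l - real k *\<^sub>R v l) + (u n l - v l)) - S (\<lambda>l. w l - real k *\<^sub>R v l)
        - S (\<lambda>l. u n l - v l)\<bar> \<le> 1"
      by (meson eventually_sequentially order_refl)
    have "(\<lambda>l. (w l - real k *\<^sub>R v l) + (u n l - v l)) = (\<lambda>l. (w l + u n l) - real (Suc k) *\<^sub>R v l)"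
      by (simp add: algebra_simps)
    then have "S (\<lambda>l. (w l + u n l) - real (Suc k) *\<^sub>R v l) \<le> k * (R' + 1) + R' + 1"
      using n w(2) d(2)[of n] by simp
    also have "\<dots> = Suc k * (R' + 1)" by (simp add: algebra_simps)
    finally show ?case
      using lift_add[OF w(1) u(1)[of n]] by (intro bexI[of _ "\<lambda>l. w l + u n l"]) simp_all
  qed
  fix \<epsilon> :: real assume \<epsilon>: "0 < \<epsilon>"
  \<comment> \<open>Averaging divides the p-th power, at most \<open>k * (R' + 1)\<close>, by
    \<open>k powr p\<close>; the resulting exponent \<open>1 - p\<close> is negative.\<close>
  define q where "q = 1 - p"
  have "q < 0" using p by (simp add: q_def)
  then have "(\<lambda>k. (R' + 1) * real k powr q) \<longlonglongrightarrow> 0" by real_asymp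
  then have "eventually (\<lambda>k. (R' + 1) * real k powr q < \<epsilon>) sequentially" using \<epsilon> by (rule order_tendstoD)
  then have "eventually (\<lambda>k. (R' + 1) * real k powr q < \<epsilon> \<and> 0 < k) sequentially"
    using eventually_gt_at_top[of 0] by eventually_elim simp
  from eventually_happens'[OF sequentially_bot this]
  obtain k where k: "(R' + 1) * real k powr q < \<epsilon>" "0 < k" by blast
  obtain w where w: "w \<in> L 0" "S (\<lambda>l. w l - real k *\<^sub>R v l) \<le> k * (R' + 1)" using ex by blast
  have x: "(\<lambda>l. w l - real k *\<^sub>R v l) \<in> lp_seq p"
    using lp_seq_diff(1)[OF p0(2) in_lp[OF w(1)] lp_seq_scale(1)[OF v(1)]] .
  have "(\<lambda>l. v l - inverse (real k) *\<^sub>R w l) = (\<lambda>l. (- inverse (real k)) *\<^sub>R (w l - real k *\<^sub>R v l))"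
    using k by (simp add: algebra_simps)
  then have "S (\<lambda>l. v l - inverse (real k) *\<^sub>R w l) = inverse (real k) powr p * S (\<lambda>l. w l - real k *\<^sub>R v l)"
    using lp_seq_scale(2)[OF x, of "- inverse (real k)"] k by simp
  also have "\<dots> \<le> inverse (real k) powr p * (k * (R' + 1))" using w by (intro mult_left_mono) auto
  also have "\<dots> = (R' + 1) * real k powr q"
    using k by (simp add: q_def powr_diff field_simps powr_divide inverse_eq_divide)
  also have "\<dots> < \<epsilon>" by (rule k)
  finally show "\<exists>w\<in>L 0. S (\<lambda>n. v n - w n) < \<epsilon>"
    using lift_scale[OF w(1), of "inverse (real k)"] by (intro bexI[of _ "\<lambda>l. inverse (real k) *\<^sub>R w l"]) simp_all
qed

lemma lifts_subsequence:
  fixes z :: "nat \<Rightarrow> nat \<Rightarrow> 'k"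
  assumes z: "\<And>n. z n \<in> L (f n)" "\<And>n. S (z n) \<le> R"
  shows "\<exists>r v. strict_mono r \<and> (\<forall>l. (\<lambda>n. z (r n) l) \<longlonglongrightarrow> v l) \<and> v \<in> lp_seq p"
proof -
  have "norm (z n l) \<le> R powr (1 / p)" for n l
  proof -
    have "norm (z n l) \<le> S (z n) powr (1 / p)" using norm_le_lp_sum_powr[OF _ in_lp[OF z(1)]] p by simp
    also have "\<dots> \<le> R powr (1 / p)" using z lp_sum_powr_nonneg[OF in_lp[OF z(1)]] p by (intro powr_mono2) auto
    finally show ?thesis .
  qed
  then obtain r v where r: "strict_mono r" "\<forall>l. (\<lambda>n. z (r n) l) \<longlonglongrightarrow> v l"
    using coordinatewise_subsequence[of z] by blast
  have "v \<in> lp_seq p"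
    by (rule lp_fatou(1)[of p "\<lambda>n. z (r n)" R]) (use z(2) r(2) in_lp[OF z(1)] p in auto)
  then show ?thesis using r by blast
qed

context
  fixes y :: "nat \<Rightarrow> 'v" and y' R
  assumes y': "\<And>n. y' n \<in> L (y n)" "\<And>n. S (y' n) \<le> R" "\<And>l. (\<lambda>n. y' n l) \<longlonglongrightarrow> 0"
begin

lemma M_bounded: "M (y n) \<le> R powr (1 / p)"
  using M_le[OF y'(1)[of n]] powr_mono2[of "1 / p" "S (y' n)" R] y'(2)[of n] p
    lp_sum_powr_nonneg[OF in_lp[OF y'(1)[of n]]] by simp

text \<open>After subtracting the null lifts \<open>y' n\<close> and a fixed lift of
  \<open>x\<close>, the \<open>z n\<close> become bounded kernel elements, and the kernel is closed
  under their coordinatewise limits; so a limit \<open>v\<close> of the \<open>z n\<close> is a lift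
  of \<open>x\<close>. The remainder is then a lift of \<open>y (r n)\<close> that tends to 0 in
  each coordinate, hence is almost disjoint from every fixed sequence.\<close>

lemma null_remainder:
  assumes z: "\<And>n. z n \<in> L (x + y n)" "\<And>n. S (z n) \<le> Q"
  shows "\<exists>r v w. v \<in> L x \<and> (\<forall>n. w n \<in> L (y (r n)) \<and> (\<lambda>l. v l + w n l) = z (r n)) \<and>
    (\<forall>x'\<in>lp_seq p. \<forall>\<epsilon>>0. eventually (\<lambda>n. lp_split p \<epsilon> x' (w n)) sequentially)"
proof -
  have p0: "0 < p" "1 \<le> p" using p by auto
  obtain r v where r: "strict_mono r" "\<And>l. (\<lambda>n. z (r n) l) \<longlonglongrightarrow> v l" "v \<in> lp_seq p"
    using lifts_subsequence[where z = z and f = "\<lambda>n. x + y n" and R = Q] z by blast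
  obtain x' where x': "x' \<in> L x" using lifts(2) by blast
  have "(\<lambda>l. v l - x' l) \<in> L 0"
  proof (rule kernel_coordinatewise_closed)
    fix n
    have 1: "(\<lambda>l. z (r n) l - y' (r n) l) \<in> L x" using lift_diff[OF z(1) y'(1), of "r n" "r n"] by simp
    then show "(\<lambda>l. (z (r n) l - y' (r n) l) - x' l) \<in> L 0" using lift_diff[OF _ x'] by fastforce
    have "S (\<lambda>l. (z (r n) l - y' (r n) l) - x' l) \<le> 2 powr p * (S (\<lambda>l. z (r n) l - y' (r n) l) + S x')"
      by (rule lp_seq_diff(2)[OF p0(2) in_lp[OF 1] in_lp[OF x']])
    also have "S (\<lambda>l. z (r n) l - y' (r n) l) \<le> 2 powr p * (S (z (r n)) + S (y' (r n)))"
      by (rule lp_seq_diff(2)[OF p0(2) in_lp[OF z(1)] in_lp[OF y'(1)]])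
    also have "\<dots> \<le> 2 powr p * (Q + R)" using z(2) y'(2) by (intro mult_left_mono add_mono) auto
    finally show "S (\<lambda>l. (z (r n) l - y' (r n) l) - x' l) \<le> 2 powr p * (2 powr p * (Q + R) + S x')"
      by simp
  next
    fix l
    have "(\<lambda>n. (z (r n) l - y' (r n) l) - x' l) \<longlonglongrightarrow> (v l - 0) - x' l"
      using r(2)[of l] LIMSEQ_subseq_LIMSEQ[OF y'(3)[of l] r(1)] by (intro tendsto_intros) (simp_all add: o_def)
    then show "(\<lambda>n. (z (r n) l - y' (r n) l) - x' l) \<longlonglongrightarrow> v l - x' l" by simp
  qed
  then have v: "v \<in> L x" by (rule lift_kernel_add[OF x'])
  have w: "(\<lambda>l. z (r n) l - v l) \<in> L (y (r n))" for n
    using lift_diff[OF z(1)[of "r n"] v] by simp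
  have wS: "S (\<lambda>l. z (r n) l - v l) \<le> 2 powr p * (Q + S v)" for n
  proof -
    have "S (\<lambda>l. z (r n) l - v l) \<le> 2 powr p * (S (z (r n)) + S v)"
      by (rule lp_seq_diff(2)[OF p0(2) in_lp[OF z(1)] in_lp[OF v]])
    also have "\<dots> \<le> 2 powr p * (Q + S v)" using z(2) by (intro mult_left_mono add_mono) auto
    finally show ?thesis .
  qed
  have wlim: "(\<lambda>n. z (r n) l - v l) \<longlonglongrightarrow> 0" for l using r(2)[of l] by (simp add: LIM_zero)
  have "eventually (\<lambda>n. lp_split p \<epsilon> x' (\<lambda>l. z (r n) l - v l)) sequentially"
    if "x' \<in> lp_seq p" "0 < \<epsilon>" for x' \<epsilon>
    by (rule brezis_lieb_lp[OF p0(1) that(2,1) in_lp[OF w] wS wlim])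
  then show ?thesis
    using v w by (intro exI[of _ r] exI[of _ v] exI[of _ "\<lambda>n l. z (r n) l - v l"]) simp
qed

text \<open>Almost optimal lifts of \<open>x + y n\<close> split, up to a small error, into a lift
  of \<open>x\<close> and a lift of \<open>y n\<close>, and no lift is shorter than the quotient
  seminorm.\<close>

lemma additive_lower:
  assumes \<epsilon>: "0 < \<epsilon>"
  shows "\<exists>n. M x powr p + M (y n) powr p - \<epsilon> \<le> M (x + y n) powr p"
proof -
  have "\<exists>z. z \<in> L (x + y n) \<and> S z \<le> M (x + y n) powr p + \<epsilon> / 4" for n
    using almost_optimal_lift_powr[of "\<epsilon> / 4"] \<epsilon> by auto
  then obtain z where z: "\<And>n. z n \<in> L (x + y n)" "\<And>n. S (z n) \<le> M (x + y n) powr p + \<epsilon> / 4" by metis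
  have "S (z n) \<le> (M x + R powr (1 / p)) powr p + \<epsilon> / 4" for n
  proof -
    have "M (x + y n) powr p \<le> (M x + R powr (1 / p)) powr p"
      using M.add_le[of x "y n"] M_bounded[of n] p by (intro powr_mono2) auto
    then show ?thesis using z(2)[of n] by simp
  qed
  from null_remainder[OF z(1) this] obtain r v w where v: "v \<in> L x"
    and w: "\<And>n. w n \<in> L (y (r n))" "\<And>n. (\<lambda>l. v l + w n l) = z (r n)"
    and ev: "\<forall>x'\<in>lp_seq p. \<forall>\<epsilon>>0. eventually (\<lambda>n. lp_split p \<epsilon> x' (w n)) sequentially"
    by auto
  have "eventually (\<lambda>n. lp_split p (\<epsilon> / 4) v (w n)) sequentially"
    by (intro ev[rule_format] in_lp[OF v]) (use \<epsilon> in simp)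
  from eventually_happens'[OF sequentially_bot this]
  obtain n where "\<bar>S (z (r n)) - S v - S (w n)\<bar> \<le> \<epsilon> / 4" unfolding w(2) by blast
  then have "M x powr p + M (y (r n)) powr p - \<epsilon> \<le> M (x + y (r n)) powr p"
    using z(2)[of "r n"] M_powr_le[OF v] M_powr_le[OF w(1)[of n]] \<epsilon> by linarith
  then show ?thesis by blast
qed

text \<open>The null lifts \<open>y' n\<close> need not be almost optimal, and almost optimal lifts
  need not be null. Applying \<open>null_remainder\<close> to the latter, with 0 in place of
  \<open>x\<close>, and removing the kernel part \<open>v\<close> yields lifts of
  \<open>y (r n)\<close> with both properties; these are added to an almost optimal lift of
  \<open>x\<close>.\<close>

lemma additive_upper:
  assumes \<epsilon>: "0 < \<epsilon>"
  shows "\<exists>n. M (x + y n) powr p \<le> M x powr p + M (y n) powr p + \<epsilon>"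
proof -
  have "\<exists>z. z \<in> L (0 + y n) \<and> S z \<le> M (y n) powr p + \<epsilon> / 4" for n
    using almost_optimal_lift_powr[of "\<epsilon> / 4"] \<epsilon> by auto
  then obtain z where z: "\<And>n. z n \<in> L (0 + y n)" "\<And>n. S (z n) \<le> M (y n) powr p + \<epsilon> / 4" by metis
  have "S (z n) \<le> (R powr (1 / p)) powr p + \<epsilon> / 4" for n
  proof -
    have "M (y n) powr p \<le> (R powr (1 / p)) powr p" using M_bounded[of n] p by (intro powr_mono2) auto
    then show ?thesis using z(2)[of n] by simp
  qed
  from null_remainder[OF z(1) this] obtain r v w where v: "v \<in> L 0"
    and w: "\<And>n. w n \<in> L (y (r n))" "\<And>n. (\<lambda>l. v l + w n l) = z (r n)"
    and ev: "\<forall>x'\<in>lp_seq p. \<forall>\<epsilon>>0. eventually (\<lambda>n. lp_split p \<epsilon> x' (w n)) sequentially"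
    by auto
  obtain x' where x': "x' \<in> L x" "S x' \<le> M x powr p + \<epsilon> / 4" using almost_optimal_lift_powr[of "\<epsilon> / 4"] \<epsilon> by auto
  have "eventually (\<lambda>n. lp_split p (\<epsilon> / 4) v (w n) \<and> lp_split p (\<epsilon> / 4) x' (w n)) sequentially"
    by (intro eventually_conj ev[rule_format] in_lp[OF v] in_lp[OF x'(1)]) (use \<epsilon> in simp_all)
  from eventually_happens'[OF sequentially_bot this]
  obtain n where n: "\<bar>S (z (r n)) - S v - S (w n)\<bar> \<le> \<epsilon> / 4"
    "\<bar>S (\<lambda>l. x' l + w n l) - S x' - S (w n)\<bar> \<le> \<epsilon> / 4" unfolding w(2) by blast
  have "S (w n) \<le> M (y (r n)) powr p + \<epsilon> / 2"
    using n(1) z(2)[of "r n"] lp_sum_powr_nonneg[OF in_lp[OF v]] by linarith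
  moreover have "M (x + y (r n)) powr p \<le> S (\<lambda>l. x' l + w n l)"
    by (rule M_powr_le[OF lift_add[OF x'(1) w(1)]])
  ultimately have "M (x + y (r n)) powr p \<le> M x powr p + M (y (r n)) powr p + \<epsilon>"
    using n(2) x'(2) by linarith
  then show ?thesis by blast
qed

end

text \<open>The two preceding bounds yield one index each; applied to a subsequence of
  counterexamples, they show that there are only finitely many.\<close>

lemma asymptotically_additive:
  assumes y': "\<And>n. y' n \<in> L (y n)" "\<And>n. S (y' n) \<le> R" "\<And>l. (\<lambda>n. y' n l) \<longlonglongrightarrow> 0" and \<epsilon>: "0 < \<epsilon>"
  shows "eventually (\<lambda>n. almost_additive p M \<epsilon> x (y n)) sequentially"
proof -
  have sub: "(\<lambda>n. y' (r n) l) \<longlonglongrightarrow> 0" if "strict_mono r" for r :: "nat \<Rightarrow> nat" and l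
    using LIMSEQ_subseq_LIMSEQ[OF y'(3)[of l] that] by (simp add: o_def)
  have "eventually (\<lambda>n. M x powr p + M (y n) powr p - \<epsilon> \<le> M (x + y n) powr p) sequentially"
  proof (rule ccontr)
    assume "\<not> ?thesis"
    from not_eventually_sequentiallyD[OF this] obtain r :: "nat \<Rightarrow> nat" where "strict_mono r" "\<forall>n. \<not> M x powr p + M (y (r n)) powr p - \<epsilon> \<le> M (x + y (r n)) powr p"
      by auto
    then show False using additive_lower[of "\<lambda>n. y' (r n)" "\<lambda>n. y (r n)" R \<epsilon> x] y' sub \<epsilon> by blast
  qed
  moreover have "eventually (\<lambda>n. M (x + y n) powr p \<le> M x powr p + M (y n) powr p + \<epsilon>) sequentially"
  proof (rule ccontr)
    assume "\<not> ?thesis"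
    from not_eventually_sequentiallyD[OF this] obtain r :: "nat \<Rightarrow> nat" where "strict_mono r" "\<forall>n. \<not> M (x + y (r n)) powr p \<le> M x powr p + M (y (r n)) powr p + \<epsilon>"
      by auto
    then show False using additive_upper[of "\<lambda>n. y' (r n)" "\<lambda>n. y (r n)" R \<epsilon> x] y' sub \<epsilon> by blast
  qed
  ultimately show ?thesis by eventually_elim (simp add: abs_le_iff)
qed

lemma coordinate_cover:
  fixes l :: nat
  assumes "0 < \<eta>"
  shows "\<exists>\<A>. finite \<A> \<and> (\<forall>u\<in>{u. norm (u l) \<le> R}. \<exists>Z\<in>\<A>. u \<in> Z) \<and>
    (\<forall>Z\<in>\<A>. \<forall>u\<in>Z. \<forall>w\<in>Z. norm (u l - w l :: 'k) \<le> \<eta>)"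
proof -
  interpret seminorm "norm :: 'k \<Rightarrow> real"
    by unfold_locales (auto simp: norm_triangle_ineq)
  obtain \<A> where \<A>: "finite \<A>" "\<And>x::'k. norm x \<le> R \<Longrightarrow> \<exists>Z\<in>\<A>. x \<in> Z" "\<forall>Z\<in>\<A>. \<forall>x\<in>Z. \<forall>y\<in>Z. norm (x - y :: 'k) \<le> \<eta>"
    using span_cover[of "Basis :: 'k set" \<eta> R] assms by auto
  show ?thesis
    using \<A> by (intro exI[of _ "(\<lambda>Z. {u. u l \<in> Z}) ` \<A>"]) auto
qed

text \<open>Suppose no \<open>K\<close> works. For each \<open>n\<close> take a failure whose
  \<open>K\<close> comes from pigeonholing the first \<open>n\<close> coordinates of lifts: two
  lifts are within \<open>inverse (Suc n)\<close> there. The bad differences so obtained have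
  bounded lifts that tend to 0 coordinatewise, against
  \<open>asymptotically_additive\<close>.\<close>

lemma lp_additive: "lp_additive p M"
proof (rule ccontr)
  have p0: "0 < p" "1 \<le> p" using p by auto
  assume "\<not> lp_additive p M"
  then obtain A \<epsilon> R where A: "finite A" "0 < \<epsilon>"
    and bad: "\<And>K. \<exists>e :: nat \<Rightarrow> 'v. (\<forall>i<K. M (e i) \<le> R) \<and>
       (\<forall>i j. i < j \<longrightarrow> j < K \<longrightarrow>
         (\<exists>x\<in>A. \<not> almost_additive p M \<epsilon> x (e i - e j)))"
    unfolding lp_additive_def by (smt (verit))
  define Q where "Q = R powr p + 1"
  have "\<exists>y y'. y' \<in> L y \<and> S y' \<le> 2 powr p * (Q + Q) \<and> (\<forall>l<n. norm (y' l) \<le> inverse (Suc n)) \<and>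
     (\<exists>x\<in>A. \<not> almost_additive p M \<epsilon> x y)" for n
  proof -
    have "\<exists>K. \<forall>e::nat \<Rightarrow> nat \<Rightarrow> 'k. (\<forall>i<K. \<forall>l<n. e i \<in> {u. norm (u l) \<le> Q powr (1 / p)}) \<longrightarrow>
        (\<exists>i j. i < j \<and> j < K \<and> (\<forall>l<n. norm (e i l - e j l) \<le> inverse (Suc n)))"
      by (rule pigeonhole_covers, rule coordinate_cover) simp
    then obtain K where K: "\<And>e::nat \<Rightarrow> nat \<Rightarrow> 'k. (\<forall>i<K. \<forall>l<n. norm (e i l) \<le> Q powr (1 / p)) \<Longrightarrow>
        (\<exists>i j. i < j \<and> j < K \<and> (\<forall>l<n. norm (e i l - e j l) \<le> inverse (Suc n)))" by auto
    obtain e :: "nat \<Rightarrow> 'v" where e: "\<And>i. i < K \<Longrightarrow> M (e i) \<le> R" "\<And>i j. i < j \<Longrightarrow> j < K \<Longrightarrow>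
         (\<exists>x\<in>A. \<not> almost_additive p M \<epsilon> x (e i - e j))"
      using bad[of K] by blast
    have "\<exists>u. u \<in> L (e i) \<and> S u \<le> M (e i) powr p + 1" for i
      using almost_optimal_lift_powr[of 1 "e i"] by auto
    then obtain u where u: "\<And>i. u i \<in> L (e i)" "\<And>i. S (u i) \<le> M (e i) powr p + 1" by metis
    have uQ: "S (u i) \<le> Q" if "i < K" for i
    proof -
      have "M (e i) powr p \<le> R powr p" using e(1)[OF that] p by (intro powr_mono2) auto
      then show ?thesis using u(2)[of i] by (simp add: Q_def)
    qed
    have "norm (u i l) \<le> Q powr (1 / p)" if "i < K" for i l
    proof -
      have "norm (u i l) \<le> S (u i) powr (1 / p)" by (rule norm_le_lp_sum_powr[OF p0(1) in_lp[OF u(1)]])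
      also have "\<dots> \<le> Q powr (1 / p)"
        using uQ[OF that] lp_sum_powr_nonneg[OF in_lp[OF u(1)]] p by (intro powr_mono2) auto
      finally show ?thesis .
    qed
    then obtain i j where ij: "i < j" "j < K" "\<forall>l<n. norm (u i l - u j l) \<le> inverse (Suc n)" using K[of u] by blast
    have "S (\<lambda>l. u i l - u j l) \<le> 2 powr p * (S (u i) + S (u j))"
      by (rule lp_seq_diff(2)[OF p0(2) in_lp[OF u(1)] in_lp[OF u(1)]])
    also have "\<dots> \<le> 2 powr p * (Q + Q)" using uQ ij by (intro mult_left_mono add_mono) auto
    finally have "S (\<lambda>l. u i l - u j l) \<le> 2 powr p * (Q + Q)" .
    then show ?thesis using lift_diff[OF u(1)[of i] u(1)[of j]] ij e(2)[OF ij(1,2)]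
      by (intro exI[of _ "e i - e j"] exI[of _ "\<lambda>l. u i l - u j l"]) simp
  qed
  then obtain y y' where y: "\<And>n. y' n \<in> L (y n)" "\<And>n. S (y' n) \<le> 2 powr p * (Q + Q)"
    "\<And>n l. l < n \<Longrightarrow> norm (y' n l) \<le> inverse (Suc n)"
    "\<And>n. \<exists>x\<in>A. \<not> almost_additive p M \<epsilon> x (y n)"
    by metis
  have "(\<lambda>n. y' n l) \<longlonglongrightarrow> 0" for l
  proof (rule Lim_null_comparison[OF _ LIMSEQ_inverse_real_of_nat])
    show "eventually (\<lambda>n. norm (y' n l) \<le> inverse (real (Suc n))) sequentially"
      using eventually_gt_at_top[of l] by eventually_elim (rule y(3))
  qed
  then have "eventually (\<lambda>n. \<forall>x\<in>A. almost_additive p M \<epsilon> x (y n)) sequentially"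
    using A y by (intro eventually_ball_finite ballI asymptotically_additive) auto
  from eventually_happens'[OF sequentially_bot this] show False using y(4) by blast
qed

end

section \<open>Normed spaces with explicit carriers\<close>

lemma scalar_ring_simps [simp]:
  "carrier ring_of_type_algebra = UNIV"
  "x \<oplus>\<^bsub>ring_of_type_algebra\<^esub> y = x + y"
  "x \<otimes>\<^bsub>ring_of_type_algebra\<^esub> y = x * y"
  "\<one>\<^bsub>ring_of_type_algebra\<^esub> = 1"
  "\<zero>\<^bsub>ring_of_type_algebra\<^esub> = 0"
  by (simp_all add: ring_of_type_algebra_def)

context normed_space
begin

lemma smult_in_carrier [simp, intro]: "x \<in> carrier E \<Longrightarrow> a \<odot> x \<in> carrier E"
  using smult_closed[of a x] by simp

lemma smult_add_left: "x \<in> carrier E \<Longrightarrow> (a + b) \<odot> x = a \<odot> x \<oplus> b \<odot> x"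
  using smult_l_distr[of a b x] by simp

lemma smult_add_right: "x \<in> carrier E \<Longrightarrow> y \<in> carrier E \<Longrightarrow> a \<odot> (x \<oplus> y) = a \<odot> x \<oplus> a \<odot> y"
  using smult_r_distr[of a x y] by simp

lemma smult_assoc: "x \<in> carrier E \<Longrightarrow> (a * b) \<odot> x = a \<odot> (b \<odot> x)"
  using smult_assoc1[of a b x] by simp

lemma one_smult [simp]: "x \<in> carrier E \<Longrightarrow> 1 \<odot> x = x"
  using smult_one[of x] by simp

lemma zero_smult [simp]: "x \<in> carrier E \<Longrightarrow> 0 \<odot> x = \<zero>"
  using smult_l_null[of x] by simp

lemma minus_one_smult: "x \<in> carrier E \<Longrightarrow> (- 1) \<odot> x = \<ominus> x"
  using smult_add_left[of x "-1" 1] M.add.inv_equality[of "(- 1) \<odot> x" x] by simp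

lemma minus_eq_smult: "x \<in> carrier E \<Longrightarrow> y \<in> carrier E \<Longrightarrow> x \<ominus> y = x \<oplus> (- 1) \<odot> y"
  by (simp add: minus_one_smult a_minus_def)

lemma minus_eq_zero_iff: "x \<in> carrier E \<Longrightarrow> y \<in> carrier E \<Longrightarrow> x \<ominus> y = \<zero> \<longleftrightarrow> x = y"
  using M.add.inv_solve_right[of \<zero> x y] by (auto simp: a_minus_def)

lemma nrm_zero [simp]: "nrm E \<zero> = 0"
  using nrm_eq_zero_iff[of \<zero>] by simp

lemma nrm_minus_commute:
  assumes "x \<in> carrier E" "y \<in> carrier E"
  shows "nrm E (x \<ominus> y) = nrm E (y \<ominus> x)"
proof -
  have "y \<ominus> x = (- 1) \<odot> (x \<ominus> y)"
    using assms by (simp add: minus_one_smult M.minus_eq M.minus_add M.a_comm)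
  then show ?thesis using assms nrm_smult[of "x \<ominus> y" "- 1"] by simp
qed

sublocale metric: Metric_space "carrier E" "ndist E"
proof
  show "0 \<le> ndist E x y" for x y by (simp add: ndist_def nrm_nonneg)
  show "ndist E x y = ndist E y x" for x y by (auto simp: ndist_def nrm_minus_commute)
  show "ndist E x y = 0 \<longleftrightarrow> x = y" if "x \<in> carrier E" "y \<in> carrier E" for x y
    using that nrm_eq_zero_iff[of "x \<ominus> y"] by (simp add: ndist_def minus_eq_zero_iff)
  show "ndist E x z \<le> ndist E x y + ndist E y z" if "x \<in> carrier E" "y \<in> carrier E" "z \<in> carrier E" for x y z
  proof -
    have "x \<ominus> z = (x \<ominus> y) \<oplus> (y \<ominus> z)"
      using that by (simp add: M.minus_eq M.a_assoc[symmetric]) (simp add: M.a_assoc M.l_neg)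
    then show ?thesis using that nrm_triangle[of "x \<ominus> y" "y \<ominus> z"] by (simp add: ndist_def)
  qed
qed

lemma topspace_norm_topology [simp]: "topspace (norm_topology E) = carrier E"
  by (simp add: norm_topology_def)

lemma closure_of_approx:
  assumes "x \<in> norm_topology E closure_of A" "0 < \<epsilon>"
  shows "\<exists>a\<in>A. a \<in> carrier E \<and> nrm E (a \<ominus> x) < \<epsilon>"
proof -
  have "x \<in> carrier E" "\<exists>a\<in>A. a \<in> metric.mball x \<epsilon>"
    using assms by (auto simp: norm_topology_def metric.metric_closure_of)
  then show ?thesis by (auto simp: ndist_def nrm_minus_commute)
qed

lemma closedin_approx:
  assumes "closedin (norm_topology E) A" "x \<in> carrier E" "\<And>\<epsilon>. 0 < \<epsilon> \<Longrightarrow> \<exists>a\<in>A. nrm E (a \<ominus> x) < \<epsilon>"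
  shows "x \<in> A"
proof -
  have "A \<subseteq> carrier E" using closedin_subset[OF assms(1)] by simp
  then have "x \<in> norm_topology E closure_of A"
    using assms(2,3) by (auto simp: norm_topology_def metric.metric_closure_of ndist_def nrm_minus_commute)
      (metis nrm_minus_commute subsetD)
  then show ?thesis using closure_of_closedin[OF assms(1)] by simp
qed

text \<open>The coefficients are real even for complex scalars. Dropping keys outside the carrier
  makes the evaluation total on the type, so that its linearity has no side conditions.\<close>

definition real_lin :: "('a, real) poly_mapping \<Rightarrow> 'a" where
  "real_lin f = (\<Oplus>x\<in>Poly_Mapping.keys f \<inter> carrier E. of_real (Poly_Mapping.lookup f x) \<odot> x)"

lemma real_lin_superset:
  assumes "finite A" "A \<subseteq> carrier E" "Poly_Mapping.keys f \<inter> carrier E \<subseteq> A"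
  shows "real_lin f = (\<Oplus>x\<in>A. of_real (Poly_Mapping.lookup f x) \<odot> x)"
  unfolding real_lin_def using assms
  by (intro M.add.finprod_mono_neutral_cong_left) (auto simp: in_keys_iff)

lemma real_lin_closed [simp, intro]: "real_lin f \<in> carrier E"
  unfolding real_lin_def by (intro M.finsum_closed) auto

lemma real_lin_add: "real_lin (f + g) = real_lin f \<oplus> real_lin g"
proof -
  define A where "A = (Poly_Mapping.keys f \<union> Poly_Mapping.keys g) \<inter> carrier E"
  have A: "finite A" "A \<subseteq> carrier E" by (auto simp: A_def)
  have "real_lin (f + g) = (\<Oplus>x\<in>A. of_real (Poly_Mapping.lookup (f + g) x) \<odot> x)"
    by (rule real_lin_superset[OF A]) (use Poly_Mapping.keys_add[of f g] in \<open>auto simp: A_def\<close>)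
  also have "\<dots> = (\<Oplus>x\<in>A. of_real (Poly_Mapping.lookup f x) \<odot> x \<oplus> of_real (Poly_Mapping.lookup g x) \<odot> x)"
    using A by (intro M.finsum_cong') (auto simp: lookup_add smult_add_left)
  also have "\<dots> = (\<Oplus>x\<in>A. of_real (Poly_Mapping.lookup f x) \<odot> x) \<oplus> (\<Oplus>x\<in>A. of_real (Poly_Mapping.lookup g x) \<odot> x)"
    using A by (intro M.finsum_addf) auto
  also have "\<dots> = real_lin f \<oplus> real_lin g"
  proof -
    have "Poly_Mapping.keys f \<inter> carrier E \<subseteq> A" "Poly_Mapping.keys g \<inter> carrier E \<subseteq> A" by (auto simp: A_def)
    then show ?thesis using real_lin_superset[OF A, of f] real_lin_superset[OF A, of g] by simp
  qed
  finally show ?thesis .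
qed

lemma lookup_scaleR: "Poly_Mapping.lookup (r *\<^sub>R f) x = r * Poly_Mapping.lookup f x" for f :: "('a, real) poly_mapping"
proof -
  have "finite {i. r * Poly_Mapping.lookup f i \<noteq> 0}"
    by (rule finite_subset[OF _ finite_keys[of f]]) (auto simp: in_keys_iff)
  then show ?thesis by (simp add: scaleR_poly_mapping_def)
qed

lemma real_lin_scale: "real_lin (r *\<^sub>R f) = of_real r \<odot> real_lin f"
proof -
  define A where "A = Poly_Mapping.keys f \<inter> carrier E"
  have A: "finite A" "A \<subseteq> carrier E" by (auto simp: A_def)
  have "real_lin (r *\<^sub>R f) = (\<Oplus>x\<in>A. of_real (Poly_Mapping.lookup (r *\<^sub>R f) x) \<odot> x)"
    by (rule real_lin_superset[OF A]) (auto simp: A_def in_keys_iff lookup_scaleR)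
  also have "\<dots> = (\<Oplus>x\<in>A. of_real r \<odot> (of_real (Poly_Mapping.lookup f x) \<odot> x))"
    using A by (intro M.finsum_cong') (auto simp: lookup_scaleR smult_assoc)
  also have "\<dots> = of_real r \<odot> real_lin f"
    using finsum_smult_ldistr[of A "of_real r" "\<lambda>x. of_real (Poly_Mapping.lookup f x) \<odot> x"] A
    by (auto simp: real_lin_def A_def)
  finally show ?thesis .
qed

lemma real_lin_single [simp]: "x \<in> carrier E \<Longrightarrow> real_lin (Poly_Mapping.single x 1) = x"
  unfolding real_lin_def by (simp add: M.add.finprod_singleton)

lemma real_lin_diff: "real_lin (f - g) = real_lin f \<ominus> real_lin g"
proof -
  have "real_lin (f - g) = real_lin (f + (- 1) *\<^sub>R g)" by simp
  also have "\<dots> = real_lin f \<oplus> (- 1) \<odot> real_lin g"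
    unfolding real_lin_add real_lin_scale by simp
  finally show ?thesis by (simp add: minus_eq_smult)
qed

lemma real_lin_zero [simp]: "real_lin 0 = \<zero>"
  by (simp add: real_lin_def)

lemma seminorm_real_lin: "seminorm (\<lambda>f. nrm E (real_lin f))"
  by unfold_locales (simp_all add: real_lin_add real_lin_scale nrm_triangle nrm_smult)

text \<open>Real coefficients act as scalars through \<open>of_real\<close>. So the formal
  combinations whose value is a scalar combination of the values of \<open>B\<close> form a real
  subspace, and it contains \<open>B\<close>.\<close>

lemma real_lin_span_finite_dim:
  assumes B: "finite B" and onto: "\<And>x. x \<in> carrier E \<Longrightarrow> \<exists>f\<in>span B. real_lin f = x"
  shows "finite_dim E"
proof -
  define V where "V = {f. \<exists>a. real_lin f = (\<Oplus>v\<in>real_lin ` B. a v \<odot> v)}"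
  have fin: "finite (real_lin ` B)" and sub: "real_lin ` B \<subseteq> carrier E" using B by auto
  have "subspace V"
  proof (rule subspaceI)
    have "(\<Oplus>v\<in>real_lin ` B. 0 \<odot> v) = (\<Oplus>v\<in>real_lin ` B. \<zero>)"
      using sub by (intro M.finsum_cong') auto
    then show "0 \<in> V" unfolding V_def by (intro CollectI exI[of _ "\<lambda>_. 0"]) (simp add: M.finsum_zero)
  next
    fix f g assume "f \<in> V" "g \<in> V"
    then obtain a b where ab: "real_lin f = (\<Oplus>v\<in>real_lin ` B. a v \<odot> v)" "real_lin g = (\<Oplus>v\<in>real_lin ` B. b v \<odot> v)"
      by (auto simp: V_def)
    have "(\<Oplus>v\<in>real_lin ` B. (a v + b v) \<odot> v) = (\<Oplus>v\<in>real_lin ` B. a v \<odot> v \<oplus> b v \<odot> v)"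
      using sub by (intro M.finsum_cong') (auto simp: smult_add_left)
    also have "\<dots> = real_lin (f + g)"
      unfolding real_lin_add ab using sub by (intro M.finsum_addf) auto
    finally show "f + g \<in> V" unfolding V_def by (intro CollectI exI[of _ "\<lambda>v. a v + b v"]) simp
  next
    fix r f assume "f \<in> V"
    then obtain a where a: "real_lin f = (\<Oplus>v\<in>real_lin ` B. a v \<odot> v)" by (auto simp: V_def)
    have "real_lin (r *\<^sub>R f) = (\<Oplus>v\<in>real_lin ` B. of_real r \<odot> (a v \<odot> v))"
      unfolding real_lin_scale a using sub fin by (intro finsum_smult_ldistr) auto
    also have "\<dots> = (\<Oplus>v\<in>real_lin ` B. (of_real r * a v) \<odot> v)"
      using sub by (intro M.finsum_cong') (auto simp: smult_assoc)
    finally show "r *\<^sub>R f \<in> V" unfolding V_def by (intro CollectI exI[of _ "\<lambda>v. of_real r * a v"])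
  qed
  moreover have "B \<subseteq> V"
  proof
    fix f assume f: "f \<in> B"
    have "(\<Oplus>v\<in>real_lin ` B. (if v = real_lin f then 1 else 0) \<odot> v) =
        (\<Oplus>v\<in>real_lin ` B. (if real_lin f = v then v else \<zero>))"
      using sub by (intro M.finsum_cong') auto
    also have "\<dots> = real_lin f"
      using f fin sub by (intro M.finsum_singleton) auto
    finally show "f \<in> V"
      unfolding V_def by (intro CollectI exI[of _ "\<lambda>v. if v = real_lin f then 1 else 0"]) simp
  qed
  ultimately have "span B \<subseteq> V" by (rule span_minimal[rotated])
  then have "\<exists>a. x = (\<Oplus>v\<in>real_lin ` B. a v \<odot> v)" if "x \<in> carrier E" for x
    using onto[OF that] by (auto simp: V_def)
  then show ?thesis unfolding finite_dim_def using fin sub by blast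
qed

end

text \<open>Multiplying a finite spanning set by a real basis of the scalar field gives a finite
  real spanning set; for this the field is taken to be a Euclidean space.\<close>

lemma finite_dim_real_span:
  fixes F :: "('k::{real_normed_field,euclidean_space}, 'b) nspace" (structure)
  assumes "normed_space F" "finite_dim F"
  shows "\<exists>B. finite B \<and> (\<forall>x\<in>carrier F. \<exists>f\<in>span B. normed_space.real_lin F f = x)"
proof -
  interpret normed_space F by fact
  obtain B where B: "finite B" "B \<subseteq> carrier F"
    "\<And>x. x \<in> carrier F \<Longrightarrow> \<exists>a. x = (\<Oplus>v\<in>B. a v \<odot> v)"
    using assms(2) unfolding finite_dim_def by blast
  define B' where "B' = (\<lambda>(b, v). Poly_Mapping.single (b \<odot> v) (1::real)) ` ((Basis :: 'k set) \<times> B)"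
  define V where "V = real_lin ` span B'"
  have V: "x \<oplus> y \<in> V" if "x \<in> V" "y \<in> V" for x y
    using that span_add[of _ B'] unfolding V_def by (auto simp flip: real_lin_add)
  have smult: "a \<odot> v \<in> V" if v: "v \<in> B" for a :: 'k and v
  proof -
    have "subspace {a :: 'k. a \<odot> v \<in> V}"
    proof (rule subspaceI)
      have "real_lin 0 \<in> V" unfolding V_def by (rule imageI[OF span_zero])
      then show "0 \<in> {a :: 'k. a \<odot> v \<in> V}" using v B by auto
    next
      fix a b :: 'k assume "a \<in> {a. a \<odot> v \<in> V}" "b \<in> {a. a \<odot> v \<in> V}"
      then show "a + b \<in> {a. a \<odot> v \<in> V}" using V v B by (auto simp: smult_add_left subsetD)
    next
      fix r and a :: 'k assume "a \<in> {a. a \<odot> v \<in> V}"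
      then obtain f where f: "f \<in> span B'" "a \<odot> v = real_lin f" by (auto simp: V_def)
      have "(r *\<^sub>R a) \<odot> v = real_lin (r *\<^sub>R f)"
        using v B f(2) by (auto simp: real_lin_scale scaleR_conv_of_real smult_assoc)
      then show "r *\<^sub>R a \<in> {a. a \<odot> v \<in> V}" using span_scale[OF f(1)] by (auto simp: V_def)
    qed
    moreover have "(Basis :: 'k set) \<subseteq> {a. a \<odot> v \<in> V}"
    proof
      fix b :: 'k assume b: "b \<in> Basis"
      have "Poly_Mapping.single (b \<odot> v) 1 \<in> span B'"
        using b v by (intro span_base) (auto simp: B'_def)
      then have "real_lin (Poly_Mapping.single (b \<odot> v) 1) \<in> V" unfolding V_def by (rule imageI)
      then show "b \<in> {a. a \<odot> v \<in> V}" using v B by auto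
    qed
    ultimately have "span (Basis :: 'k set) \<subseteq> {a. a \<odot> v \<in> V}" by (rule span_minimal[rotated])
    then show ?thesis by auto
  qed
  have sum: "(\<Oplus>v\<in>C. a v \<odot> v) \<in> V" if "finite C" "C \<subseteq> B" for a :: "'b \<Rightarrow> 'k" and C
    using that
  proof (induction C rule: finite_induct)
    case empty
    have "real_lin 0 \<in> V" unfolding V_def by (rule imageI[OF span_zero])
    then show ?case by simp
  next
    case (insert v C)
    then have "(\<lambda>v. a v \<odot> v) \<in> C \<rightarrow> carrier F" "a v \<odot> v \<in> carrier F" using B by auto
    then show ?case using insert V smult by (simp add: M.finsum_insert)
  qed
  have "x \<in> V" if "x \<in> carrier F" for x
    using B(3)[OF that] sum[OF B(1) order_refl] by auto
  moreover have "finite B'" unfolding B'_def using B by auto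
  ultimately show ?thesis unfolding V_def by (intro exI[of _ B']) auto
qed

lemma finite_dim_cover:
  fixes F :: "('k::{real_normed_field,euclidean_space}, 'b) nspace" (structure)
  assumes "normed_space F" "finite_dim F" "0 < \<epsilon>"
  shows "\<exists>\<A>. finite \<A> \<and> (\<forall>x\<in>carrier F. nrm F x \<le> R \<longrightarrow> (\<exists>Z\<in>\<A>. x \<in> Z)) \<and>
    (\<forall>Z\<in>\<A>. \<forall>x\<in>Z. \<forall>y\<in>Z. nrm F (x \<ominus> y) \<le> \<epsilon>)"
proof -
  interpret normed_space F by fact
  interpret S: seminorm "\<lambda>f. nrm F (real_lin f)" by (rule seminorm_real_lin)
  obtain B where B: "finite B" "\<And>x. x \<in> carrier F \<Longrightarrow> \<exists>f\<in>span B. real_lin f = x"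
    using finite_dim_real_span[OF assms(1,2)] by blast
  obtain \<A> where \<A>: "finite \<A>" "\<forall>x\<in>span B. nrm F (real_lin x) \<le> R \<longrightarrow> (\<exists>Z\<in>\<A>. x \<in> Z)"
    "\<forall>Z\<in>\<A>. \<forall>x\<in>Z. \<forall>y\<in>Z. nrm F (real_lin (x - y)) \<le> \<epsilon>"
    using S.span_cover[OF B(1) assms(3), of R] by blast
  have "\<exists>Z\<in>(`) real_lin ` \<A>. x \<in> Z" if "x \<in> carrier F" "nrm F x \<le> R" for x
  proof -
    obtain f where f: "f \<in> span B" "real_lin f = x" using B(2)[OF \<open>x \<in> carrier F\<close>] by blast
    then obtain Z where "Z \<in> \<A>" "f \<in> Z" using \<A>(2) \<open>nrm F x \<le> R\<close> by auto
    then show ?thesis using f(2) by auto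
  qed
  moreover have "\<forall>Z\<in>(`) real_lin ` \<A>. \<forall>x\<in>Z. \<forall>y\<in>Z. nrm F (x \<ominus> y) \<le> \<epsilon>"
    using \<A>(3) by (auto simp: real_lin_diff)
  ultimately show ?thesis using \<A>(1) by (intro exI[of _ "(`) real_lin ` \<A>"]) auto
qed

section \<open>From spaces with explicit carriers to the core argument\<close>

lemma linear_mapsD:
  assumes "T \<in> linear_maps E F"
  shows "x \<in> carrier E \<Longrightarrow> T x \<in> carrier F"
    "x \<in> carrier E \<Longrightarrow> y \<in> carrier E \<Longrightarrow> T (x \<oplus>\<^bsub>E\<^esub> y) = T x \<oplus>\<^bsub>F\<^esub> T y"
    "x \<in> carrier E \<Longrightarrow> T (a \<odot>\<^bsub>E\<^esub> x) = a \<odot>\<^bsub>F\<^esub> T x"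
  using assms by (auto simp: linear_maps_def hom_def Pi_def)

lemma linear_maps_minus:
  assumes "normed_space E" "normed_space F" and T: "T \<in> linear_maps E F" and "x \<in> carrier E" "y \<in> carrier E"
  shows "T (x \<ominus>\<^bsub>E\<^esub> y) = T x \<ominus>\<^bsub>F\<^esub> T y"
proof -
  interpret E: normed_space E by fact
  interpret F: normed_space F by fact
  show ?thesis using assms(4,5) linear_mapsD[OF T] by (simp add: E.minus_eq_smult F.minus_eq_smult)
qed

text \<open>The core argument is applied to the space of formal real linear combinations of the points of \<open>G\<close>,
  a type of class \<open>real_vector\<close>.\<close>

lemma almost_transitive_exponent:
  fixes G :: "('k::real_normed_field, 'a) nspace" (structure)
  assumes "normed_space G" and at: "almost_transitive G" and inf: "\<not> finite_dim G"
    and M: "seminorm M" "lp_additive p M" and p: "1 < p"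
    and c: "0 < c" "\<And>f. c * M f \<le> nrm G (normed_space.real_lin G f)"
    and C: "0 < C" "\<And>f. nrm G (normed_space.real_lin G f) \<le> C * M f"
  shows "p = 2"
proof -
  interpret normed_space G by fact
  interpret M: seminorm M by fact
  define N where "N f = nrm G (real_lin f)" for f
  have "almost_transitive_renorming N M p c C"
  proof (rule almost_transitive_renorming.intro)
    show "seminorm N" unfolding N_def[abs_def] by (rule seminorm_real_lin)
    show "seminorm M" by fact
    show "0 < c" "0 < C" "\<And>f. c * M f \<le> N f" "\<And>f. N f \<le> C * M f" "1 < p" "lp_additive p M"
      using c C p M unfolding N_def by auto
  next
    fix B :: "('a, real) poly_mapping set" assume B: "finite B"
    show "\<exists>x. \<forall>y\<in>span B. M (x - y) \<noteq> 0"
    proof (rule ccontr)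
      assume "\<not> ?thesis"
      then have all: "\<And>x. \<exists>y\<in>span B. M (x - y) = 0" by blast
      have "\<exists>f\<in>span B. real_lin f = x" if x: "x \<in> carrier G" for x
      proof -
        obtain y where y: "y \<in> span B" "M (Poly_Mapping.single x 1 - y) = 0" using all by blast
        then have "nrm G (real_lin (Poly_Mapping.single x 1 - y)) \<le> 0" using C(2) by (metis mult_zero_right)
        then have "nrm G (x \<ominus> real_lin y) = 0"
          using nrm_nonneg[of "x \<ominus> real_lin y"] x by (simp add: real_lin_diff)
        then have "x = real_lin y" using nrm_eq_zero_iff[of "x \<ominus> real_lin y"] minus_eq_zero_iff x by simp
        then show ?thesis using y by blast
      qed
      then show False using real_lin_span_finite_dim[OF B] inf by blast
    qed
  next
    fix x y :: "('a, real) poly_mapping" and \<epsilon> :: real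
    assume xy: "N x = 1" "N y = 1" and \<epsilon>: "0 < \<epsilon>"
    have "real_lin x \<in> unit_sphere G" "real_lin y \<in> unit_sphere G"
      using xy by (simp_all add: unit_sphere_def N_def)
    then have "real_lin y \<in> norm_topology G closure_of {T (real_lin x) |T. T \<in> Isom G}"
      using at unfolding almost_transitive_def by blast
    from closure_of_approx[OF this \<epsilon>] obtain T where
      T: "T \<in> Isom G" "nrm G (T (real_lin x) \<ominus> real_lin y) < \<epsilon>" by blast
    then have lin: "T \<in> linear_maps G G" and iso: "\<And>u. u \<in> carrier G \<Longrightarrow> nrm G (T u) = nrm G u"
      by (auto simp: Isom_def)
    note TD = linear_mapsD[OF lin]
    \<comment> \<open>\<open>T'\<close> picks the one-point combination that represents
      \<open>T (real_lin f)\<close>. It need not be linear, but \<open>N\<close> depends only on the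
      value of \<open>real_lin\<close>, and on values it acts as the linear map
      \<open>T\<close>.\<close>
    define T' where "T' f = Poly_Mapping.single (T (real_lin f)) (1::real)" for f
    have T': "real_lin (T' f) = T (real_lin f)" for f using TD by (simp add: T'_def)
    have "N (T' x - y) < \<epsilon>" using T(2) by (simp add: N_def real_lin_diff T')
    moreover have "N (s *\<^sub>R T' u + T' v - T' w) = N (s *\<^sub>R u + v - w)" for s u v w
    proof -
      have "real_lin (s *\<^sub>R T' u + T' v - T' w) = T (real_lin (s *\<^sub>R u + v - w))"
        using linear_maps_minus[OF assms(1) assms(1) lin] TD
        by (simp add: real_lin_diff real_lin_add real_lin_scale T')
      then show ?thesis using iso by (simp add: N_def)
    qed
    ultimately show "\<exists>T. N (T x - y) < \<epsilon> \<and> (\<forall>s u v w. N (s *\<^sub>R T u + T v - T w) = N (s *\<^sub>R u + v - w))"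
      by blast
  qed
  then show ?thesis by (rule almost_transitive_renorming.exponent_eq_2)
qed

section \<open>Subspaces of sums of finite-dimensional spaces\<close>

lemma lp_sum_simps [simp]:
  "carrier (lp_sum p F) = {x. (\<forall>n. x n \<in> carrier (F n)) \<and> summable (\<lambda>n. nrm (F n) (x n) powr p)}"
  "x \<oplus>\<^bsub>lp_sum p F\<^esub> y = (\<lambda>n. x n \<oplus>\<^bsub>F n\<^esub> y n)"
  "\<zero>\<^bsub>lp_sum p F\<^esub> = (\<lambda>n. \<zero>\<^bsub>F n\<^esub>)"
  "a \<odot>\<^bsub>lp_sum p F\<^esub> x = (\<lambda>n. a \<odot>\<^bsub>F n\<^esub> x n)"
  "nrm (lp_sum p F) x = (\<Sum>n. nrm (F n) (x n) powr p) powr (1 / p)"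
  by (simp_all add: lp_sum_def)

lemma normed_space_lp_sum:
  fixes F :: "nat \<Rightarrow> ('k::real_normed_field, 'b) nspace"
  assumes p: "1 \<le> p" and F: "\<And>n. normed_space (F n)"
  shows "normed_space (lp_sum p F)"
proof -
  interpret F: normed_space "F n" for n by (rule F)
  have add: "summable (\<lambda>n. nrm (F n) (x n \<oplus>\<^bsub>F n\<^esub> y n) powr p)"
    "(\<Sum>n. nrm (F n) (x n \<oplus>\<^bsub>F n\<^esub> y n) powr p) powr (1 / p) \<le>
      (\<Sum>n. nrm (F n) (x n) powr p) powr (1 / p) + (\<Sum>n. nrm (F n) (y n) powr p) powr (1 / p)"
    if "x \<in> carrier (lp_sum p F)" "y \<in> carrier (lp_sum p F)" for x y
    using minkowski[of p "\<lambda>n. nrm (F n) (x n)" "\<lambda>n. nrm (F n) (y n)" "\<lambda>n. nrm (F n) (x n \<oplus>\<^bsub>F n\<^esub> y n)"]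
      that p by (auto simp: F.nrm_nonneg F.nrm_triangle)
  have scale: "(\<lambda>n. nrm (F n) (a \<odot>\<^bsub>F n\<^esub> x n) powr p) = (\<lambda>n. norm a powr p * nrm (F n) (x n) powr p)"
    if "x \<in> carrier (lp_sum p F)" for a x
    using that by (simp add: F.nrm_smult F.nrm_nonneg powr_mult)
  have zero: "\<zero>\<^bsub>lp_sum p F\<^esub> \<in> carrier (lp_sum p F)" by simp
  have smult: "a \<odot>\<^bsub>lp_sum p F\<^esub> x \<in> carrier (lp_sum p F)" if "x \<in> carrier (lp_sum p F)" for a x
    using that scale[OF that, of a] by (auto intro: summable_mult)
  have "abelian_group (lp_sum p F)"
  proof (rule abelian_groupI)
    fix x assume x: "x \<in> carrier (lp_sum p F)"
    show "\<exists>y\<in>carrier (lp_sum p F). y \<oplus>\<^bsub>lp_sum p F\<^esub> x = \<zero>\<^bsub>lp_sum p F\<^esub>"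
      using smult[OF x, of "- 1"] x
      by (intro bexI[of _ "(- 1) \<odot>\<^bsub>lp_sum p F\<^esub> x"]) (auto simp: F.minus_one_smult F.M.l_neg)
  qed (use add zero in \<open>auto simp: F.M.a_assoc fun_eq_iff intro: F.M.a_comm\<close>)
  then have "module ring_of_type_algebra (lp_sum p F)"
    by (rule moduleI[OF cring_from_type_algebra _ smult])
      (simp_all add: F.smult_add_left F.smult_add_right F.smult_assoc)
  then show ?thesis
  proof (rule normed_space.intro, unfold_locales)
    fix x assume x: "x \<in> carrier (lp_sum p F)"
    then have s: "summable (\<lambda>n. nrm (F n) (x n) powr p)" by simp
    then have nn: "0 \<le> (\<Sum>n. nrm (F n) (x n) powr p)" by (intro suminf_nonneg) auto
    show "0 \<le> nrm (lp_sum p F) x" by simp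
    show "nrm (lp_sum p F) x = 0 \<longleftrightarrow> x = \<zero>\<^bsub>lp_sum p F\<^esub>"
      using x suminf_eq_zero_iff[OF s] by (auto simp: F.nrm_eq_zero_iff fun_eq_iff)
    show "nrm (lp_sum p F) (a \<odot>\<^bsub>lp_sum p F\<^esub> x) = norm a * nrm (lp_sum p F) x" for a
      using scale[OF x, of a] s nn p by (simp add: suminf_mult powr_mult powr_powr)
    show "nrm (lp_sum p F) (x \<oplus>\<^bsub>lp_sum p F\<^esub> y) \<le> nrm (lp_sum p F) x + nrm (lp_sum p F) y"
      if "y \<in> carrier (lp_sum p F)" for y
      using add(2)[OF x that] by simp
  qed
qed

lemma restrict_to_simps [simp]:
  "carrier (restrict_to E W) = W"
  "x \<oplus>\<^bsub>restrict_to E W\<^esub> y = x \<oplus>\<^bsub>E\<^esub> y"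
  "\<zero>\<^bsub>restrict_to E W\<^esub> = \<zero>\<^bsub>E\<^esub>"
  "a \<odot>\<^bsub>restrict_to E W\<^esub> x = a \<odot>\<^bsub>E\<^esub> x"
  "nrm (restrict_to E W) = nrm E"
  by (simp_all add: restrict_to_def)

lemma normed_space_restrict_to:
  fixes E :: "('k::real_normed_field, 'a) nspace"
  assumes "normed_space E" and W: "submodule W (ring_of_type_algebra :: 'k ring) E"
  shows "normed_space (restrict_to E W)"
proof -
  interpret E: normed_space E by fact
  have sub: "W \<subseteq> carrier E" using E.submoduleE(1)[OF W] .
  have "module ring_of_type_algebra (restrict_to E W)"
    unfolding restrict_to_def by (rule submodule.submodule_is_module[OF W E.module_axioms])
  then show ?thesis
    by (rule normed_space.intro, unfold_locales)
      (use sub in \<open>auto simp: E.nrm_nonneg E.nrm_eq_zero_iff E.nrm_smult E.nrm_triangle subset_iff\<close>)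
qed

text \<open>If \<open>x\<close> is rescaled so that \<open>B\<close> takes the value 1, then
  \<open>A\<close> is at least \<open>\<delta>\<close>. With two functionals in place of a map the
  lemma serves an isomorphism and its inverse alike.\<close>

lemma homogeneous_bound:
  fixes E :: "('k::real_normed_field, 'a) nspace"
  assumes "normed_space E" and \<delta>: "0 < \<delta>"
    and A: "\<And>r x. x \<in> carrier E \<Longrightarrow> 0 < r \<Longrightarrow> A (of_real r \<odot>\<^bsub>E\<^esub> x) = r * A x"
    and B: "\<And>r x. x \<in> carrier E \<Longrightarrow> 0 < r \<Longrightarrow> B (of_real r \<odot>\<^bsub>E\<^esub> x) = r * B x"
    and A0: "\<And>x. x \<in> carrier E \<Longrightarrow> 0 \<le> A x"
    and small: "\<And>x. x \<in> carrier E \<Longrightarrow> A x < \<delta> \<Longrightarrow> B x < (1::real)"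
    and x: "x \<in> carrier E"
  shows "B x \<le> 1 / \<delta> * A x"
proof (cases "0 < B x")
  case True
  interpret normed_space E by fact
  define r where "r = 1 / B x"
  have r: "0 < r" "r * B x = 1" using True by (auto simp: r_def)
  have "\<not> A (of_real r \<odot>\<^bsub>E\<^esub> x) < \<delta>"
    using small[of "of_real r \<odot>\<^bsub>E\<^esub> x"] B[OF x r(1)] r x by auto
  then have "\<delta> \<le> r * A x" using A[OF x r(1)] by simp
  then show ?thesis using True \<delta> by (simp add: r_def field_simps)
next
  case False
  then show ?thesis using A0[OF x] \<delta> by (smt (verit) divide_nonneg_nonneg mult_nonneg_nonneg)
qed

text \<open>Isomorphisms are defined topologically. Continuity at zero gives one bound; openness
  together with injectivity gives the other.\<close>

lemma isomorphism_bounds: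
  fixes E :: "('k::real_normed_field, 'a) nspace" and F :: "('k, 'b) nspace"
  assumes "normed_space E" "normed_space F" and T: "T \<in> linear_maps E F"
    and hom: "homeomorphic_map (norm_topology E) (norm_topology F) T"
  shows "\<exists>c>0. \<exists>C>0. \<forall>x\<in>carrier E. c * nrm F (T x) \<le> nrm E x \<and> nrm E x \<le> C * nrm F (T x)"
proof -
  interpret E: normed_space E by fact
  interpret F: normed_space F by fact
  note TD = linear_mapsD[OF T]
  have T0: "T \<zero>\<^bsub>E\<^esub> = \<zero>\<^bsub>F\<^esub>" using TD(3)[of "\<zero>\<^bsub>E\<^esub>" 0] TD(1)[of "\<zero>\<^bsub>E\<^esub>"] by simp
  have ball0: "x \<in> E.metric.mball \<zero>\<^bsub>E\<^esub> r \<longleftrightarrow> x \<in> carrier E \<and> nrm E x < r" for x r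
    using E.nrm_minus_commute[of "\<zero>\<^bsub>E\<^esub>" x] by (auto simp: ndist_def E.minus_eq_smult)
  have ball0': "x \<in> F.metric.mball \<zero>\<^bsub>F\<^esub> r \<longleftrightarrow> x \<in> carrier F \<and> nrm F x < r" for x r
    using F.nrm_minus_commute[of "\<zero>\<^bsub>F\<^esub>" x] by (auto simp: ndist_def F.minus_eq_smult)
  have homE: "nrm E (of_real r \<odot>\<^bsub>E\<^esub> x) = r * nrm E x" if "x \<in> carrier E" "0 < r" for x r
    using that by (simp add: E.nrm_smult)
  have homF: "nrm F (T (of_real r \<odot>\<^bsub>E\<^esub> x)) = r * nrm F (T x)" if "x \<in> carrier E" "0 < r" for x r
    using that TD by (simp add: F.nrm_smult)
  have "openin (norm_topology E) {x \<in> topspace (norm_topology E). T x \<in> F.metric.mball \<zero>\<^bsub>F\<^esub> 1}"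
    by (rule openin_continuous_map_preimage[OF homeomorphic_imp_continuous_map[OF hom]])
      (simp add: norm_topology_def)
  then obtain \<delta> where \<delta>: "0 < \<delta>" "E.metric.mball \<zero>\<^bsub>E\<^esub> \<delta> \<subseteq> {x \<in> carrier E. T x \<in> F.metric.mball \<zero>\<^bsub>F\<^esub> 1}"
    unfolding norm_topology_def E.metric.openin_mtopology using T0
    by (auto simp: ball0' norm_topology_def dest!: spec[of _ "\<zero>\<^bsub>E\<^esub>"])
  have 1: "nrm F (T x) \<le> 1 / \<delta> * nrm E x" if "x \<in> carrier E" for x
    by (rule homogeneous_bound[OF assms(1) \<delta>(1) homE homF E.nrm_nonneg _ that])
      (use \<delta>(2) ball0 ball0' in auto)
  have "openin (norm_topology F) (T ` E.metric.mball \<zero>\<^bsub>E\<^esub> 1)"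
    using homeomorphic_imp_open_map[OF hom] unfolding open_map_def by (simp add: norm_topology_def)
  moreover have "\<zero>\<^bsub>F\<^esub> \<in> T ` E.metric.mball \<zero>\<^bsub>E\<^esub> 1"
    using T0 by (intro image_eqI[of _ _ "\<zero>\<^bsub>E\<^esub>"]) (auto simp: ball0)
  ultimately obtain \<eta> where \<eta>: "0 < \<eta>" "F.metric.mball \<zero>\<^bsub>F\<^esub> \<eta> \<subseteq> T ` E.metric.mball \<zero>\<^bsub>E\<^esub> 1"
    unfolding norm_topology_def F.metric.openin_mtopology by blast
  have inj: "inj_on T (carrier E)" using homeomorphic_imp_injective_map[OF hom] by simp
  have small: "nrm E x < 1" if x: "x \<in> carrier E" "nrm F (T x) < \<eta>" for x
  proof -
    have "T x \<in> F.metric.mball \<zero>\<^bsub>F\<^esub> \<eta>" unfolding ball0' using x TD(1) by blast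
    then obtain y where y: "T x = T y" "y \<in> carrier E" "nrm E y < 1" using \<eta>(2) ball0 by blast
    then have "x = y" using inj x by (auto simp: inj_on_def)
    then show ?thesis using y by simp
  qed
  have 2: "nrm E x \<le> 1 / \<eta> * nrm F (T x)" if "x \<in> carrier E" for x
    by (rule homogeneous_bound[OF assms(1) \<eta>(1) homF homE _ small that]) (use TD F.nrm_nonneg in auto)
  have "\<delta> * nrm F (T x) \<le> nrm E x" if "x \<in> carrier E" for x
    using 1[OF that] \<delta>(1) by (simp add: field_simps)
  then show ?thesis using 2 \<delta>(1) \<eta>(1) by (intro exI[of _ \<delta>] exI[of _ "1 / \<eta>"] conjI) auto
qed

lemma finite_dim_nrm_update [simp]: "finite_dim (E\<lparr>nrm := N\<rparr>) \<longleftrightarrow> finite_dim E"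
  by (simp add: finite_dim_def finsum_def)

theorem class_C_exponent:
  fixes E :: "('k::{real_normed_field,euclidean_space}, 'a) nspace"
  assumes E: "E \<in> class_C TYPE('b) p" and p: "1 < p"
    and adm: "admits_equivalent_almost_transitive_norm E"
  shows "p = 2"
proof -
  obtain F :: "nat \<Rightarrow> ('k, 'b) nspace" and W where
    F: "\<And>n. normed_space (F n)" "\<And>n. finite_dim (F n)" and
    W: "infinite_dim_closed_subspace W (lp_sum p F)" and
    iso: "isomorphic_nspaces E (restrict_to (lp_sum p F) W)" and
    E': "banach_space E" "\<not> finite_dim E"
    using E unfolding class_C_def by blast
  have nE: "normed_space E" using E'(1) by (simp add: banach_space_def)
  have L: "normed_space (lp_sum p F)" using p F by (intro normed_space_lp_sum) auto
  have W': "submodule W (ring_of_type_algebra :: 'k ring) (lp_sum p F)"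
    using W by (simp add: infinite_dim_closed_subspace_def closed_linear_subspace_def)
  have sub: "W \<subseteq> carrier (lp_sum p F)"
    using module.submoduleE(1)[OF normed_space.axioms(1)[OF L] W'] .
  obtain T where T: "T \<in> linear_maps E (restrict_to (lp_sum p F) W)"
    "homeomorphic_map (norm_topology E) (norm_topology (restrict_to (lp_sum p F) W)) T"
    using iso unfolding isomorphic_nspaces_def by blast
  obtain c1 C1 where c1: "0 < c1" "0 < C1" "\<And>x. x \<in> carrier E \<Longrightarrow>
      c1 * nrm (lp_sum p F) (T x) \<le> nrm E x \<and> nrm E x \<le> C1 * nrm (lp_sum p F) (T x)"
    using isomorphism_bounds[OF nE normed_space_restrict_to[OF L W'] T] by (auto simp del: lp_sum_simps)
  obtain N where N: "equivalent_norm E N" "almost_transitive (E\<lparr>nrm := N\<rparr>)"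
    using adm unfolding admits_equivalent_almost_transitive_norm_def by blast
  obtain c2 C2 where c2: "0 < c2" "0 < C2" "\<And>x. x \<in> carrier E \<Longrightarrow> c2 * nrm E x \<le> N x \<and> N x \<le> C2 * nrm E x"
    using N(1) unfolding equivalent_norm_def by blast
  have nG: "normed_space (E\<lparr>nrm := N\<rparr>)" using N(1) by (simp add: equivalent_norm_def)
  interpret G: normed_space "E\<lparr>nrm := N\<rparr>" by (rule nG)
  interpret F: normed_space "F n" for n by (rule F(1))
  have cE: "G.real_lin f \<in> carrier E" for f using G.real_lin_closed[of f] by simp
  note TD = linear_mapsD[OF T(1)]
  define t where "t f = T (G.real_lin f)" for f
  have tW: "t f \<in> W" for f unfolding t_def using TD(1)[OF cE] by simp
  have tF: "t f n \<in> carrier (F n)" for f n using tW sub by auto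
  have t_add: "t (f + g) n = t f n \<oplus>\<^bsub>F n\<^esub> t g n" for f g n
    using TD(2)[OF cE cE] by (simp add: t_def G.real_lin_add)
  have t_scale: "t (r *\<^sub>R f) n = of_real r \<odot>\<^bsub>F n\<^esub> t f n" for r f n
    using TD(3)[OF cE] by (simp add: t_def G.real_lin_scale)
  have t_diff: "t (f - g) n = t f n \<ominus>\<^bsub>F n\<^esub> t g n" for f g n
    using t_add[of f "(- 1) *\<^sub>R g" n] t_scale[of "- 1" g n] by (simp add: F.minus_eq_smult tF)
  \<comment> \<open>The norm of the sum, pulled back along \<open>t\<close>, becomes the
    \<open>M\<close> of the core argument, and the \<open>g n\<close> are its coordinate
    norms.\<close>
  define g where "g n f = nrm (F n) (t f n)" for n f
  define M where "M f = nrm (lp_sum p F) (t f)" for f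
  have sg: "seminorm (g n)" for n
    by unfold_locales (simp_all add: g_def t_add t_scale tF F.nrm_triangle F.nrm_smult)
  have sm: "summable (\<lambda>n. g n f powr p)" for f unfolding g_def using tW[of f] sub by auto
  have Mg: "M f = (\<Sum>n. g n f powr p) powr (1 / p)" for f by (simp add: M_def g_def)
  have cov: "\<exists>\<A>. finite \<A> \<and> (\<forall>f. g n f \<le> R \<longrightarrow> (\<exists>Z\<in>\<A>. f \<in> Z)) \<and>
      (\<forall>Z\<in>\<A>. \<forall>f\<in>Z. \<forall>h\<in>Z. g n (f - h) \<le> \<epsilon>)" if \<epsilon>: "0 < \<epsilon>" for n R \<epsilon>
  proof -
    obtain \<A> where \<A>: "finite \<A>" "\<And>x. x \<in> carrier (F n) \<Longrightarrow> nrm (F n) x \<le> R \<Longrightarrow> \<exists>Z\<in>\<A>. x \<in> Z"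
      "\<forall>Z\<in>\<A>. \<forall>x\<in>Z. \<forall>y\<in>Z. nrm (F n) (x \<ominus>\<^bsub>F n\<^esub> y) \<le> \<epsilon>"
      using finite_dim_cover[OF F(1)[of n] F(2)[of n] \<epsilon>, of R] by auto
    show ?thesis
      using \<A> tF by (intro exI[of _ "(\<lambda>Z. {f. t f n \<in> Z}) ` \<A>"]) (auto simp: g_def t_diff)
  qed
  note M = lp_additive_sum[OF p sg sm Mg cov]
  show ?thesis
  proof (rule almost_transitive_exponent[OF nG N(2) _ M p])
    show "\<not> finite_dim (E\<lparr>nrm := N\<rparr>)" using E'(2) by simp
    show "0 < c2 * c1" "0 < C2 * C1" using c1 c2 by auto
  next
    fix f
    have "c2 * (c1 * M f) \<le> c2 * nrm E (G.real_lin f)"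
      unfolding M_def t_def using c1(3)[OF cE] c2(1) by (intro mult_left_mono) auto
    then show "c2 * c1 * M f \<le> nrm (E\<lparr>nrm := N\<rparr>) (G.real_lin f)"
      using c2(3)[OF cE[of f]] by simp
    have "C2 * nrm E (G.real_lin f) \<le> C2 * (C1 * M f)"
      unfolding M_def t_def using c1(3)[OF cE] c2(2) by (intro mult_left_mono) auto
    then show "nrm (E\<lparr>nrm := N\<rparr>) (G.real_lin f) \<le> C2 * C1 * M f"
      using c2(3)[OF cE[of f]] by simp
  qed
qed

section \<open>Subspaces of quotients of sequence spaces\<close>

lemma normed_space_scalar: "normed_space (scalar_nspace :: ('k::real_normed_field, 'k) nspace)"
proof -
  have "abelian_group (scalar_nspace :: ('k, 'k) nspace)"
    by (rule abelian_groupI) (auto simp: scalar_nspace_def intro: exI[of _ "- _"] ab_left_minus)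
  then have "module ring_of_type_algebra (scalar_nspace :: ('k, 'k) nspace)"
    by (intro moduleI cring_from_type_algebra) (auto simp: scalar_nspace_def algebra_simps)
  then show ?thesis
    by (rule normed_space.intro, unfold_locales)
      (auto simp: scalar_nspace_def norm_mult norm_triangle_ineq)
qed

lemma ell_p_simps:
  "carrier (ell_p p) = lp_seq p"
  "x \<oplus>\<^bsub>ell_p p\<^esub> y = (\<lambda>n. x n + y n)"
  "\<zero>\<^bsub>ell_p p\<^esub> = (\<lambda>n. 0)"
  "a \<odot>\<^bsub>ell_p p\<^esub> x = (\<lambda>n. a * x n)"
  "nrm (ell_p p) x = lp_sum_powr p x powr (1 / p)"
  by (simp_all add: ell_p_def lp_seq_def lp_sum_powr_def scalar_nspace_def)

text \<open>A point of the quotient is a coset, that is, the set of all its lifts. So the evaluation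
  \<open>G.real_lin\<close> itself can be the family \<open>L\<close> of \<open>lp_quotient\<close>;
  its value at 0 is \<open>M\<close>, and the seminorm of that locale is the quotient norm.\<close>

theorem quotient_subspace_exponent:
  fixes M :: "(nat \<Rightarrow> 'k::{real_normed_field,euclidean_space}) set" and W :: "(nat \<Rightarrow> 'k) set set"
  assumes p: "1 < p" and M: "closed_linear_subspace M (ell_p p :: ('k, nat \<Rightarrow> 'k) nspace)"
    and W: "infinite_dim_closed_subspace W (quotient_nspace (ell_p p :: ('k, nat \<Rightarrow> 'k) nspace) M)"
    and adm: "admits_equivalent_almost_transitive_norm
      (restrict_to (quotient_nspace (ell_p p :: ('k, nat \<Rightarrow> 'k) nspace) M) W)"
  shows "p = 2"
proof -
  let ?l = "ell_p p :: ('k, nat \<Rightarrow> 'k) nspace"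
  let ?E = "restrict_to (quotient_nspace ?l M) W"
  have nl: "normed_space ?l"
    unfolding ell_p_def using p normed_space_scalar by (intro normed_space_lp_sum) auto
  interpret l: normed_space ?l by (rule nl)
  have M': "submodule M (ring_of_type_algebra :: 'k ring) ?l" "closedin (norm_topology ?l) M"
    using M by (auto simp: closed_linear_subspace_def)
  note MD = l.submoduleE[OF M'(1)]
  have M0: "(\<lambda>n. 0) \<in> M"
    using subgroup.one_closed[OF submodule.axioms(1)[OF M'(1)]] by (simp add: ell_p_simps)
  have Wsub: "W \<subseteq> a_rcosets\<^bsub>?l\<^esub> M"
    using subgroup.subset[OF submodule.axioms(1)] W
    unfolding infinite_dim_closed_subspace_def closed_linear_subspace_def
    by (fastforce simp: quotient_nspace_def)
  obtain N where N: "equivalent_norm ?E N" "almost_transitive (?E\<lparr>nrm := N\<rparr>)"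
    using adm unfolding admits_equivalent_almost_transitive_norm_def by blast
  obtain c C where c: "0 < c" "0 < C" "\<And>x. x \<in> carrier ?E \<Longrightarrow> c * nrm ?E x \<le> N x \<and> N x \<le> C * nrm ?E x"
    using N(1) unfolding equivalent_norm_def by blast
  have nG: "normed_space (?E\<lparr>nrm := N\<rparr>)" using N(1) by (simp add: equivalent_norm_def)
  interpret G: normed_space "?E\<lparr>nrm := N\<rparr>" by (rule nG)
  have cW: "G.real_lin f \<in> W" for f using G.real_lin_closed[of f] by simp
  have coset: "\<exists>a\<in>lp_seq p. G.real_lin f = (\<Union>h\<in>M. {\<lambda>n. h n + a n})" for f
  proof -
    have "G.real_lin f \<in> a_rcosets\<^bsub>?l\<^esub> M" using cW Wsub by blast
    then show ?thesis by (auto simp: A_RCOSETS_def' a_r_coset_def' ell_p_simps)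
  qed
  have add: "G.real_lin (f + g) = (\<Union>h\<in>G.real_lin f. \<Union>k\<in>G.real_lin g. {\<lambda>n. h n + k n})" for f g
    unfolding G.real_lin_add by (simp add: quotient_nspace_def set_add_def' ell_p_simps)
  have smult: "G.real_lin (r *\<^sub>R f) =
      (\<Union>h\<in>M. \<Union>k\<in>(\<lambda>x n. of_real r * x n) ` G.real_lin f. {\<lambda>n. h n + k n})" for r f
    unfolding G.real_lin_scale by (simp add: quotient_nspace_def set_add_def' ell_p_simps)
  have ker: "G.real_lin 0 = M" unfolding G.real_lin_zero by (simp add: quotient_nspace_def)
  interpret Q: lp_quotient p G.real_lin
  proof
    show "1 < p" by (rule p)
    fix f
    obtain a where a: "a \<in> lp_seq p" "G.real_lin f = (\<Union>h\<in>M. {\<lambda>n. h n + a n})" using coset by blast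
    show "G.real_lin f \<subseteq> lp_seq p"
      using a MD(1) p by (auto simp: ell_p_simps intro!: lp_seq_add(1))
    show "G.real_lin f \<noteq> {}" using a M0 by auto
  next
    fix f g u v assume "u \<in> G.real_lin f" "v \<in> G.real_lin g"
    then show "(\<lambda>n. u n + v n) \<in> G.real_lin (f + g)" unfolding add by blast
  next
    fix f u r assume u: "u \<in> G.real_lin f"
    show "(\<lambda>n. r *\<^sub>R u n) \<in> G.real_lin (r *\<^sub>R f)"
      \<comment> \<open>The product in the quotient is a coset sum with \<open>M\<close>; the
        summand from \<open>M\<close> is taken to be 0.\<close>
      unfolding smult
      by (rule UN_I[OF M0], rule UN_I[OF imageI[OF u]]) (simp add: scaleR_conv_of_real)
  next
    fix u :: "nat \<Rightarrow> 'k"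
    assume u: "u \<in> lp_seq p" and approx: "\<And>\<epsilon>. 0 < \<epsilon> \<Longrightarrow> \<exists>w\<in>G.real_lin 0. lp_sum_powr p (\<lambda>n. u n - w n) < \<epsilon>"
    have "u \<in> M"
    proof (rule l.closedin_approx[OF M'(2)])
      show "u \<in> carrier ?l" using u by (simp add: ell_p_simps)
      fix \<epsilon> :: real assume \<epsilon>: "0 < \<epsilon>"
      obtain w where w: "w \<in> M" "lp_sum_powr p (\<lambda>n. u n - w n) < \<epsilon> powr p"
        using approx[of "\<epsilon> powr p"] \<epsilon> unfolding ker by auto
      have wl: "w \<in> carrier ?l" "u \<in> carrier ?l" using w MD(1) u by (auto simp: ell_p_simps)
      have d: "u \<ominus>\<^bsub>?l\<^esub> w = (\<lambda>n. u n - w n)" unfolding l.minus_eq_smult[OF wl(2,1)] by (simp add: ell_p_simps)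
      have "lp_sum_powr p (\<lambda>n. u n - w n) powr (1 / p) < (\<epsilon> powr p) powr (1 / p)"
        using w p lp_sum_powr_nonneg[of "\<lambda>n. u n - w n" p] lp_seq_diff(1)[of p u w] wl
        by (intro powr_less_mono2) (auto simp: ell_p_simps)
      then have "nrm ?l (w \<ominus>\<^bsub>?l\<^esub> u) < \<epsilon>"
        unfolding l.nrm_minus_commute[OF wl] d using p \<epsilon> by (simp add: ell_p_simps powr_powr)
      then show "\<exists>a\<in>M. nrm ?l (a \<ominus>\<^bsub>?l\<^esub> u) < \<epsilon>" using w by blast
    qed
    then show "u \<in> G.real_lin 0" by (simp only: ker)
  qed
  have "nrm (quotient_nspace ?l M) Z = Inf ((\<lambda>u. lp_sum_powr p u powr (1 / p)) ` Z)" for Z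
    by (simp add: quotient_nspace_def ell_p_simps)
  then have nrmE: "nrm ?E (G.real_lin f) = Q.M f" for f
    by (simp only: restrict_to_simps Q.M_def)
  show ?thesis
  proof (rule almost_transitive_exponent[OF nG N(2) _ Q.M.seminorm_axioms Q.lp_additive p c(1) _ c(2)])
    show "\<not> finite_dim (?E\<lparr>nrm := N\<rparr>)"
      using W unfolding infinite_dim_closed_subspace_def finite_dim_nrm_update by blast
  next
    fix f
    have "G.real_lin f \<in> carrier ?E" using cW by (simp only: restrict_to_simps)
    from c(3)[OF this] show "c * Q.M f \<le> nrm (?E\<lparr>nrm := N\<rparr>) (G.real_lin f)"
      "nrm (?E\<lparr>nrm := N\<rparr>) (G.real_lin f) \<le> C * Q.M f"
      unfolding nrmE by simp_all
  qed
qed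

theorem corollary2p11:
  fixes p :: real
  assumes "1 < p" and "p \<noteq> 2"
  shows "(\<forall>E :: (real, 'a) nspace. E \<in> class_C TYPE('b) p \<longrightarrow>
            \<not> admits_equivalent_almost_transitive_norm E) \<and>
         (\<forall>E :: (complex, 'a) nspace. E \<in> class_C TYPE('b) p \<longrightarrow>
            \<not> admits_equivalent_almost_transitive_norm E) \<and>
         (\<forall>M W. closed_linear_subspace M (ell_p p :: (real, nat \<Rightarrow> real) nspace) \<longrightarrow>
            infinite_dim_closed_subspace W
              (quotient_nspace (ell_p p :: (real, nat \<Rightarrow> real) nspace) M) \<longrightarrow>
            \<not> admits_equivalent_almost_transitive_norm
              (restrict_to (quotient_nspace (ell_p p :: (real, nat \<Rightarrow> real) nspace) M) W)) \<and>
         (\<forall>M W. closed_linear_subspace M (ell_p p :: (complex, nat \<Rightarrow> complex) nspace) \<longrightarrow>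
            infinite_dim_closed_subspace W
              (quotient_nspace (ell_p p :: (complex, nat \<Rightarrow> complex) nspace) M) \<longrightarrow>
            \<not> admits_equivalent_almost_transitive_norm
              (restrict_to (quotient_nspace (ell_p p :: (complex, nat \<Rightarrow> complex) nspace) M) W))"
  using assms by (intro conjI allI impI notI)
    (metis class_C_exponent, metis class_C_exponent,
      metis quotient_subspace_exponent, metis quotient_subspace_exponent)

end
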